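(* Let $p\ge 1$ and $\alpha\ge 0$. The family of operators $(T_{t,p})_{t\in\mathbb{R}}$ defined by $$T_{t,p}f(s)=e^{-t/p}f(e^{-t}s),\qquad s>0,\ f\in\mathcal{T}_p^{(\alpha)}(t^\alpha),$$ is a $C_0$-group of isometries on $\mathcal{T}_p^{(\alpha)}(t^\alpha)$, whose infinitesimal generator $\Lambda$ is given by $(\Lambda f)(s)=-sf'(s)-\frac1p f(s)$ with domain $D(\Lambda)=\mathcal{T}_p^{(\alpha+1)}(t^{\alpha+1})$.
   Context: $\mathcal{S}_+$ denotes the Schwartz class on $[0,\infty)$. For $\alpha>0$ and $f\in\mathcal{S}_+$, the Weyl fractional integral is $W_+^{-\alpha}f(t)=\frac{1}{\Gamma(\alpha)}\int_t^\infty (s-t)^{\alpha-1}f(s)\,ds$ ($t>0$), and the Weyl fractional derivative is $W_+^{\alpha}f(t)=(-1)^n\frac{d^n}{dt^n}W_+^{-(n-\alpha)}f(t)$ with $n=[\alpha]+1$; $W_+^0$ is the identity. For $\alpha>0$ and $1\le p<\infty$, $\mathcal{T}_p^{(\alpha)}(t^\alpha)$ is the Banach space obtained as the completion of $\mathcal{S}_+$ in the norm $\|f\|_{\alpha,p}=\frac{1}{\Gamma(\alpha+1)}\left(\int_0^\infty |W_+^\alpha f(t)|^p t^{\alpha p}\,dt\right)^{1/p}$; by convention $\mathcal{T}_p^{(0)}(t^0)=L^p(\mathbb{R}^+)$ with $\|\cdot\|_{0,p}=\|\cdot\|_p$. These spaces embed continuously into $L^p(\mathbb{R}^+)$, so their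 elements are (a.e. defined) functions on $(0,\infty)$. *)

theory Defs
  imports "HOL-Analysis.Analysis"
begin

text \<open>Functions on the half line are modelled as maps real => complex; only their
values on (0,infinity) matter.\<close>

definition vderiv :: "(real \<Rightarrow> complex) \<Rightarrow> real \<Rightarrow> complex" where
  "vderiv g = (\<lambda>t. vector_derivative g (at t))"

definition schwartz_plus :: "(real \<Rightarrow> complex) \<Rightarrow> bool" where
  "schwartz_plus f \<longleftrightarrow>
     (\<forall>n. \<forall>t>0. ((vderiv ^^ n) f has_vector_derivative (vderiv ^^ Suc n) f t) (at t)) \<and>
     (\<forall>n. \<exists>L. ((vderiv ^^ n) f \<longlongrightarrow> L) (at_right 0)) \<and>
     (\<forall>n m. \<exists>C. \<forall>t>0. t ^ m * norm ((vderiv ^^ n) f t) \<le> C)"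

definition weyl_int :: "real \<Rightarrow> (real \<Rightarrow> complex) \<Rightarrow> real \<Rightarrow> complex" where
  "weyl_int \<beta> f t = complex_of_real (1 / Gamma \<beta>) *
      (LINT s:{t..}|lborel. complex_of_real ((s - t) powr (\<beta> - 1)) * f s)"

definition weyl_deriv :: "real \<Rightarrow> (real \<Rightarrow> complex) \<Rightarrow> real \<Rightarrow> complex" where
  "weyl_deriv \<alpha> f =
     (if \<alpha> = 0 then f
      else (let n = nat \<lfloor>\<alpha>\<rfloor> + 1 in
            (\<lambda>t. (-1) ^ n * (vderiv ^^ n) (weyl_int (real n - \<alpha>) f) t)))"

definition T_norm :: "real \<Rightarrow> real \<Rightarrow> (real \<Rightarrow> complex) \<Rightarrow> real" where
  "T_norm \<alpha> p f = (1 / Gamma (\<alpha> + 1)) *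
     (LINT t:{0<..}|lborel. (norm (weyl_deriv \<alpha> f t) * t powr \<alpha>) powr p) powr (1 / p)"

definition Lp :: "real \<Rightarrow> (real \<Rightarrow> complex) \<Rightarrow> bool" where
  "Lp p f \<longleftrightarrow> set_borel_measurable lborel {0<..} f \<and>
                set_integrable lborel {0<..} (\<lambda>t. norm (f t) powr p)"

definition Lp_norm :: "real \<Rightarrow> (real \<Rightarrow> complex) \<Rightarrow> real" where
  "Lp_norm p f = (LINT t:{0<..}|lborel. norm (f t) powr p) powr (1 / p)"

text \<open>phi is a sequence in the Schwartz class, Cauchy for the norm T_norm alpha p,
and converging to f in L^p (concrete realisation of the completion inside L^p).\<close>
definition T_approx :: "real \<Rightarrow> real \<Rightarrow> (nat \<Rightarrow> real \<Rightarrow> complex) \<Rightarrow> (real \<Rightarrow> complex) \<Rightarrow> bool" where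
  "T_approx \<alpha> p \<phi> f \<longleftrightarrow>
     (\<forall>n. schwartz_plus (\<phi> n)) \<and>
     (\<forall>e>0. \<exists>N. \<forall>m\<ge>N. \<forall>n\<ge>N. T_norm \<alpha> p (\<lambda>s. \<phi> m s - \<phi> n s) < e) \<and>
     ((\<lambda>n. Lp_norm p (\<lambda>s. \<phi> n s - f s)) \<longlonglongrightarrow> 0)"

definition T_space :: "real \<Rightarrow> real \<Rightarrow> (real \<Rightarrow> complex) set" where
  "T_space \<alpha> p =
     (if \<alpha> = 0 then {f. Lp p f} else {f. Lp p f \<and> (\<exists>\<phi>. T_approx \<alpha> p \<phi> f)})"

definition T_space_norm :: "real \<Rightarrow> real \<Rightarrow> (real \<Rightarrow> complex) \<Rightarrow> real" where
  "T_space_norm \<alpha> p f =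
     (if \<alpha> = 0 then Lp_norm p f
      else lim (\<lambda>n. T_norm \<alpha> p ((SOME \<phi>. T_approx \<alpha> p \<phi> f) n)))"

definition T_grp :: "real \<Rightarrow> real \<Rightarrow> (real \<Rightarrow> complex) \<Rightarrow> real \<Rightarrow> complex" where
  "T_grp p t f = (\<lambda>s. complex_of_real (exp (- t / p)) * f (exp (- t) * s))"

definition is_generator_value :: "real \<Rightarrow> real \<Rightarrow> (real \<Rightarrow> complex) \<Rightarrow> (real \<Rightarrow> complex) \<Rightarrow> bool" where
  "is_generator_value \<alpha> p f g \<longleftrightarrow> g \<in> T_space \<alpha> p \<and>
     ((\<lambda>t. T_space_norm \<alpha> p (\<lambda>s. (T_grp p t f s - f s) / complex_of_real t - g s)) \<longlongrightarrow> 0) (at 0)"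

definition test_fun :: "(real \<Rightarrow> complex) \<Rightarrow> bool" where
  "test_fun \<psi> \<longleftrightarrow>
     (\<forall>n t. ((vderiv ^^ n) \<psi> has_vector_derivative (vderiv ^^ Suc n) \<psi> t) (at t)) \<and>
     (\<exists>a b. 0 < a \<and> a \<le> b \<and> (\<forall>s. s \<notin> {a..b} \<longrightarrow> \<psi> s = 0))"

end

theory Submission
  imports Defs
begin

text \<open>
  An element \<open>f\<close> of the completion is determined by its weighted derivative \<open>G = t\<^sup>\<alpha> W\<^sup>\<alpha> f\<close>, which
  ranges over the whole Lebesgue space: \<open>f\<close> is recovered from \<open>G\<close> by an Erdelyi--Kober operator, that
  is, by integration against dilates of a fixed kernel, and every \<open>G\<close> occurs because linear combinations
  of the functions \<open>t\<^sup>\<alpha> exp (- k t)\<close> are dense. Such operators commute with the dilation group, so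
  isometry and strong continuity only have to be checked for \<open>G\<close>. The resolvents of the generator on the
  Lebesgue space are the Erdelyi--Kober operators of order one, and by the semigroup law in the order
  applying the resolvent at \<open>\<alpha> + 1 / p\<close> to \<open>G\<close> raises \<open>\<alpha>\<close> by one, which identifies the domain.
  The distributional formula for the generator is the transpose of its resolvent at \<open>1 / p\<close>.
\<close>

section \<open>Lebesgue spaces\<close>

lemma powr_ge_tangent:
  fixes c x p :: real
  assumes "p \<ge> 1" "c \<ge> 0" "x \<ge> 0"
  shows "c powr p + p * c powr (p - 1) * (x - c) \<le> x powr p"
proof -
  consider (base_zero) "c = 0" | (arg_zero) "c > 0" "x = 0" | (pos) "c > 0" "x > 0"
    using assms by linarith
  then show ?thesis
  proof cases
    case arg_zero
    then have "c powr p + p * c powr (p - 1) * (x - c) = (1 - p) * c powr p"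
      by (simp add: powr_diff algebra_simps)
    also have "\<dots> \<le> 0" using assms by (simp add: mult_nonpos_nonneg)
    finally show ?thesis using arg_zero by simp
  next
    case pos
    have "p * c powr (p - 1) * (x - c) \<le> x powr p - c powr p"
      by (rule convex_on_imp_above_tangent[OF powr_convex[OF assms(1)]])
        (use pos in \<open>auto intro!: derivative_eq_intros simp: interior_open\<close>)
    then show ?thesis by simp
  qed simp
qed

lemma powr_ge_tangent_weighted:
  fixes c f p w :: real
  assumes "p \<ge> 1" "c \<ge> 0" "f \<ge> 0" "w > 0"
  shows "w * c powr p + p * c powr (p - 1) * (f - w * c) \<le> f powr p / w powr (p - 1)"
proof -
  have "w * (c powr p + p * c powr (p - 1) * (f / w - c)) \<le> w * (f / w) powr p"
    using assms by (intro mult_left_mono powr_ge_tangent) auto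
  also have "w * (f / w) powr p = f powr p / w powr (p - 1)"
    using assms by (simp add: powr_divide powr_diff)
  finally show ?thesis using assms by (simp add: algebra_simps)
qed

lemma radon_inequality:
  fixes a b x y p :: real
  assumes "p \<ge> 1" "x \<ge> 0" "y \<ge> 0" "a > 0" "b > 0"
  shows "(x + y) powr p \<le> (a + b) powr (p - 1) * (x powr p / a powr (p - 1) + y powr p / b powr (p - 1))"
proof -
  define c where "c = (x + y) / (a + b)"
  have "c \<ge> 0" using assms by (simp add: c_def)
  have c: "(a + b) * c = x + y" using assms by (simp add: c_def)
  have "(x + y) powr p = (a + b) powr (p - 1) * ((a + b) * c powr p)"
    using assms by (simp add: c_def powr_divide powr_diff)
  also have "(a + b) * c powr p = (a * c powr p + p * c powr (p - 1) * (x - a * c))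
      + (b * c powr p + p * c powr (p - 1) * (y - b * c))"
    using arg_cong[OF c, of "\<lambda>z. p * c powr (p - 1) * z"] by (simp add: algebra_simps)
  also have "\<dots> \<le> x powr p / a powr (p - 1) + y powr p / b powr (p - 1)"
    using assms \<open>c \<ge> 0\<close> by (intro add_mono powr_ge_tangent_weighted) auto
  finally show ?thesis by (simp add: mult_left_mono)
qed

lemma le_add_powr_weighted:
  fixes f p w :: real
  assumes "p \<ge> 1" "f \<ge> 0" "w > 0"
  shows "f \<le> w + f powr p / w powr (p - 1)"
proof (cases "f \<le> w")
  case True
  then show ?thesis by (simp add: add_increasing2)
next
  case False
  then have "1 * (f - w) \<le> p * (f - w)" using assms by (intro mult_right_mono) auto
  then show ?thesis
    using powr_ge_tangent_weighted[OF assms(1) zero_le_one assms(2,3)] assms(3) by simp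
qed

lemma radon_inequality_integral:
  fixes f w :: "'a \<Rightarrow> real"
  assumes p: "p \<ge> 1"
    and w: "integrable N w" "\<And>u. u \<in> space N \<Longrightarrow> w u > 0"
    and f: "f \<in> borel_measurable N" "\<And>u. u \<in> space N \<Longrightarrow> f u \<ge> 0"
    and fw: "integrable N (\<lambda>u. f u powr p / w u powr (p - 1))"
  shows "integrable N f"
    and "(\<integral>u. f u \<partial>N) powr p \<le> (\<integral>u. w u \<partial>N) powr (p - 1) * (\<integral>u. f u powr p / w u powr (p - 1) \<partial>N)"
proof -
  show int: "integrable N f"
  proof (rule Bochner_Integration.integrable_bound
      [OF Bochner_Integration.integrable_add[OF w(1) fw] f(1)])
    show "AE u in N. norm (f u) \<le> norm (w u + f u powr p / w u powr (p - 1))"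
      using le_add_powr_weighted[OF p f(2) w(2)] f(2)
      by (intro AE_I2) (simp add: order_trans[OF _ abs_ge_self])
  qed
  define W where "W = (\<integral>u. w u \<partial>N)"
  define I where "I = (\<integral>u. f u \<partial>N)"
  have "W \<ge> 0" "I \<ge> 0"
    unfolding W_def I_def using w(2) f(2)
    by (auto intro!: Bochner_Integration.integral_nonneg simp: less_imp_le)
  then consider (zero) "W = 0" | (pos) "W > 0" by linarith
  then show "I powr p \<le> W powr (p - 1) * (\<integral>u. f u powr p / w u powr (p - 1) \<partial>N)"
  proof cases
    case zero
    then have "AE u in N. w u = 0"
      using integral_nonneg_eq_0_iff_AE[OF w(1)] w(2) by (auto simp: W_def less_imp_le)
    then have "AE u in N. f u = 0"
      using AE_space by eventually_elim (use w(2) in force)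
    then have "I = 0" unfolding I_def by (rule integral_eq_zero_AE)
    then show ?thesis using p zero by simp
  next
    case pos
    define c where "c = I / W"
    have "W * c powr p = (\<integral>u. w u * c powr p + p * c powr (p - 1) * (f u - w u * c) \<partial>N)"
      using int w(1) pos by (simp add: W_def[symmetric] I_def[symmetric] c_def)
    also have "\<dots> \<le> (\<integral>u. f u powr p / w u powr (p - 1) \<partial>N)"
      using int w f fw p \<open>I \<ge> 0\<close> pos
      by (intro integral_mono powr_ge_tangent_weighted) (auto simp: c_def)
    finally have "W powr (p - 1) * (W * c powr p)
        \<le> W powr (p - 1) * (\<integral>u. f u powr p / w u powr (p - 1) \<partial>N)"
      by (rule mult_left_mono) simp
    moreover have "W powr (p - 1) * (W * c powr p) = I powr p"
      using pos \<open>I \<ge> 0\<close> by (simp add: c_def powr_divide powr_diff)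
    ultimately show ?thesis by simp
  qed
qed

definition lp_fun :: "'a measure \<Rightarrow> real \<Rightarrow> ('a \<Rightarrow> 'b::{banach, second_countable_topology}) \<Rightarrow> bool" where
  "lp_fun M p f \<longleftrightarrow> f \<in> borel_measurable M \<and> integrable M (\<lambda>x. norm (f x) powr p)"

definition lp_norm :: "'a measure \<Rightarrow> real \<Rightarrow> ('a \<Rightarrow> 'b::{banach, second_countable_topology}) \<Rightarrow> real" where
  "lp_norm M p f = (\<integral>x. norm (f x) powr p \<partial>M) powr (1 / p)"

lemma lp_fun_measurable: "lp_fun M p f \<Longrightarrow> f \<in> borel_measurable M"
  by (simp add: lp_fun_def)

lemma lp_fun_integrable: "lp_fun M p f \<Longrightarrow> integrable M (\<lambda>x. norm (f x) powr p)"
  by (simp add: lp_fun_def)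

lemma lp_norm_nonneg [simp]: "0 \<le> lp_norm M p f"
  by (simp add: lp_norm_def)

lemma lp_norm_powr: "p \<ge> 1 \<Longrightarrow> lp_norm M p f powr p = (\<integral>x. norm (f x) powr p \<partial>M)"
  by (simp add: lp_norm_def powr_powr Bochner_Integration.integral_nonneg)

lemma lp_norm_zero [simp]: "p \<ge> 1 \<Longrightarrow> lp_norm M p (\<lambda>x. 0) = 0"
  by (simp add: lp_norm_def)

lemma lp_norm_le_iff:
  assumes "p \<ge> 1" "c \<ge> 0"
  shows "lp_norm M p f \<le> c \<longleftrightarrow> (\<integral>x. norm (f x) powr p \<partial>M) \<le> c powr p"
  unfolding lp_norm_powr[OF assms(1), symmetric]
  using assms powr_mono2[of p "lp_norm M p f" c] powr_less_mono2[of p c "lp_norm M p f"] by fastforce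

lemma nn_integral_lp_fun_le:
  assumes "p \<ge> 1" "lp_fun M p f" "lp_norm M p f \<le> c"
  shows "(\<integral>\<^sup>+x. ennreal (norm (f x) powr p) \<partial>M) \<le> ennreal (c powr p)"
proof -
  have "c \<ge> 0" using assms(3) lp_norm_nonneg order_trans by blast
  then show ?thesis
    using assms by (subst nn_integral_eq_integral)
      (auto simp: lp_fun_integrable lp_norm_le_iff ennreal_leI)
qed

lemma lp_fun_nn_integralI:
  assumes "p \<ge> 1" "c \<ge> 0" "f \<in> borel_measurable M"
    and le: "(\<integral>\<^sup>+x. ennreal (norm (f x) powr p) \<partial>M) \<le> ennreal (c powr p)"
  shows "lp_fun M p f" "lp_norm M p f \<le> c"
proof -
  have int: "integrable M (\<lambda>x. norm (f x) powr p)"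
    using assms by (intro integrableI_nonneg) (auto simp: less_top[symmetric] top_unique)
  then show "lp_fun M p f" using assms by (simp add: lp_fun_def)
  have "ennreal (\<integral>x. norm (f x) powr p \<partial>M) \<le> ennreal (c powr p)"
    using le by (subst (asm) nn_integral_eq_integral[OF int]) auto
  then show "lp_norm M p f \<le> c" using assms by (simp add: lp_norm_le_iff)
qed

lemma lp_fun_cong: "(\<And>x. x \<in> space M \<Longrightarrow> f x = g x) \<Longrightarrow> lp_fun M p f \<longleftrightarrow> lp_fun M p g"
  unfolding lp_fun_def
  by (intro arg_cong2[where f = "(\<and>)"] measurable_cong Bochner_Integration.integrable_cong) auto

lemma lp_norm_cong: "(\<And>x. x \<in> space M \<Longrightarrow> f x = g x) \<Longrightarrow> lp_norm M p f = lp_norm M p g"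
  unfolding lp_norm_def
  by (intro arg_cong2[where f = "(powr)"] refl Bochner_Integration.integral_cong) auto

lemma lp_norm_cong_AE:
  assumes "f \<in> borel_measurable M" "g \<in> borel_measurable M" "AE x in M. f x = g x"
  shows "lp_norm M p f = lp_norm M p g"
  unfolding lp_norm_def
  by (intro arg_cong2[where f = "(powr)"] refl integral_cong_AE) (use assms in auto)

lemma lp_fun_norm: "lp_fun M p f \<Longrightarrow> lp_fun M p (\<lambda>x. norm (f x))"
  unfolding lp_fun_def by auto

lemma lp_norm_norm: "lp_norm M p (\<lambda>x. norm (f x)) = lp_norm M p f"
  by (simp add: lp_norm_def)

lemma lp_fun_scaleR: "lp_fun M p f \<Longrightarrow> lp_fun M p (\<lambda>x. c *\<^sub>R f x)"
  by (auto simp: lp_fun_def powr_mult)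

lemma lp_norm_scaleR: "p \<ge> 1 \<Longrightarrow> lp_norm M p (\<lambda>x. c *\<^sub>R f x) = \<bar>c\<bar> * lp_norm M p f"
  by (simp add: lp_norm_def powr_mult powr_powr Bochner_Integration.integral_nonneg)

lemma lp_fun_cmult:
  fixes f :: "'a \<Rightarrow> complex"
  shows "lp_fun M p f \<Longrightarrow> lp_fun M p (\<lambda>x. c * f x)"
  by (auto simp: lp_fun_def norm_mult powr_mult)

lemma lp_norm_cmult:
  fixes f :: "'a \<Rightarrow> complex"
  shows "p \<ge> 1 \<Longrightarrow> lp_norm M p (\<lambda>x. c * f x) = norm c * lp_norm M p f"
  by (simp add: lp_norm_def norm_mult powr_mult powr_powr Bochner_Integration.integral_nonneg)

lemma lp_fun_bound:
  assumes "p \<ge> 1" "lp_fun M p g" "f \<in> borel_measurable M" "AE x in M. norm (f x) \<le> norm (g x)"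
  shows "lp_fun M p f" "lp_norm M p f \<le> lp_norm M p g"
proof -
  have "AE x in M. ennreal (norm (f x) powr p) \<le> ennreal (norm (g x) powr p)"
    using assms(4) by eventually_elim (use assms(1) in \<open>auto intro: ennreal_leI powr_mono2\<close>)
  then have "(\<integral>\<^sup>+x. ennreal (norm (f x) powr p) \<partial>M) \<le> (\<integral>\<^sup>+x. ennreal (norm (g x) powr p) \<partial>M)"
    by (rule nn_integral_mono_AE)
  also have "\<dots> \<le> ennreal (lp_norm M p g powr p)"
    by (rule nn_integral_lp_fun_le[OF assms(1,2) order_refl])
  finally show "lp_fun M p f" "lp_norm M p f \<le> lp_norm M p g"
    by (auto intro!: lp_fun_nn_integralI[OF assms(1) lp_norm_nonneg assms(3)])
qed

lemma lp_norm_eq_0_iff: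
  assumes "p \<ge> 1" "lp_fun M p f"
  shows "lp_norm M p f = 0 \<longleftrightarrow> (AE x in M. f x = 0)"
  using assms integral_nonneg_eq_0_iff_AE[OF lp_fun_integrable[OF assms(2)]]
  by (simp add: lp_norm_def)

lemma lp_norm_minus_commute: "lp_norm M p (\<lambda>x. f x - g x) = lp_norm M p (\<lambda>x. g x - f x)"
  by (simp add: lp_norm_def norm_minus_commute)

context
  fixes p :: real
  assumes p: "p \<ge> 1"
begin

lemma lp_add_positive_bounds:
  assumes f: "lp_fun M p f" "lp_norm M p f \<le> a" and g: "lp_fun M p g" "lp_norm M p g \<le> b"
    and "a > 0" "b > 0"
  shows "lp_fun M p (\<lambda>x. f x + g x)" "lp_norm M p (\<lambda>x. f x + g x) \<le> a + b"
proof -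
  define A where "A = (a + b) powr (p - 1) / a powr (p - 1)"
  define B where "B = (a + b) powr (p - 1) / b powr (p - 1)"
  have [measurable]: "f \<in> borel_measurable M" "g \<in> borel_measurable M"
    using f g by (auto simp: lp_fun_def)
  have "norm (f x + g x) powr p \<le> A * norm (f x) powr p + B * norm (g x) powr p" for x
  proof -
    have "norm (f x + g x) powr p \<le> (norm (f x) + norm (g x)) powr p"
      using p by (intro powr_mono2 norm_triangle_ineq) auto
    also have "\<dots> \<le> A * norm (f x) powr p + B * norm (g x) powr p"
      using radon_inequality[OF p norm_ge_zero norm_ge_zero assms(5,6), of "f x" "g x"]
      by (simp add: A_def B_def algebra_simps)
    finally show ?thesis .
  qed
  then have "(\<integral>\<^sup>+x. ennreal (norm (f x + g x) powr p) \<partial>M) 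
      \<le> (\<integral>\<^sup>+x. ennreal A * ennreal (norm (f x) powr p) + ennreal B * ennreal (norm (g x) powr p) \<partial>M)"
    by (intro nn_integral_mono)
      (auto simp: A_def B_def ennreal_leI ennreal_mult[symmetric] simp flip: ennreal_plus)
  also have "\<dots> = ennreal A * (\<integral>\<^sup>+x. ennreal (norm (f x) powr p) \<partial>M)
      + ennreal B * (\<integral>\<^sup>+x. ennreal (norm (g x) powr p) \<partial>M)"
    by (simp add: nn_integral_add nn_integral_cmult)
  also have "\<dots> \<le> ennreal A * ennreal (a powr p) + ennreal B * ennreal (b powr p)"
    by (intro add_mono mult_left_mono nn_integral_lp_fun_le p f g) auto
  also have "\<dots> = ennreal (A * a powr p + B * b powr p)"
    by (simp add: A_def B_def ennreal_mult[symmetric] flip: ennreal_plus)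
  also have "A * a powr p + B * b powr p = (a + b) powr p"
    using assms(5,6) by (simp add: A_def B_def powr_diff distrib_left[symmetric] flip: distrib_right
      add_divide_distrib)
  finally show "lp_fun M p (\<lambda>x. f x + g x)" "lp_norm M p (\<lambda>x. f x + g x) \<le> a + b"
    using assms(5,6) by (auto intro!: lp_fun_nn_integralI[OF p, where c = "a + b"])
qed

lemma
  assumes f: "lp_fun M p f" and g: "lp_fun M p g"
  shows lp_fun_add: "lp_fun M p (\<lambda>x. f x + g x)"
    and lp_norm_triangle: "lp_norm M p (\<lambda>x. f x + g x) \<le> lp_norm M p f + lp_norm M p g"
proof -
  have pos: "lp_norm M p f + e > 0" "lp_norm M p g + e > 0" if "e > 0" for e
    using that by (simp_all add: add_nonneg_pos)
  have add: "lp_fun M p (\<lambda>x. f x + g x)"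
      "lp_norm M p (\<lambda>x. f x + g x) \<le> (lp_norm M p f + e) + (lp_norm M p g + e)" if "e > 0" for e
    using lp_add_positive_bounds[OF f _ g _ pos[OF that]] that by auto
  show "lp_fun M p (\<lambda>x. f x + g x)" by (rule add(1)[OF zero_less_one])
  show "lp_norm M p (\<lambda>x. f x + g x) \<le> lp_norm M p f + lp_norm M p g"
  proof (rule field_le_epsilon)
    fix e :: real assume "e > 0"
    then show "lp_norm M p (\<lambda>x. f x + g x) \<le> lp_norm M p f + lp_norm M p g + e"
      using add(2)[of "e / 2"] by simp
  qed
qed

lemma lp_fun_diff:
  assumes "lp_fun M p f" "lp_fun M p g"
  shows "lp_fun M p (\<lambda>x. f x - g x)"
  using lp_fun_add[OF assms(1) lp_fun_scaleR[OF assms(2), of "-1"]] by simp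

lemma lp_norm_triangle_diff:
  assumes "lp_fun M p f" "lp_fun M p g"
  shows "lp_norm M p (\<lambda>x. f x - g x) \<le> lp_norm M p f + lp_norm M p g"
  using lp_norm_triangle[OF assms(1) lp_fun_scaleR[OF assms(2), of "-1"]]
      lp_norm_scaleR[OF p, of M "-1" g] by simp

lemma lp_norm_triangle_dist:
  assumes "lp_fun M p f" "lp_fun M p g" "lp_fun M p h"
  shows "lp_norm M p (\<lambda>x. f x - h x) \<le> lp_norm M p (\<lambda>x. f x - g x) + lp_norm M p (\<lambda>x. g x - h x)"
  using lp_norm_triangle[OF lp_fun_diff[OF assms(1,2)] lp_fun_diff[OF assms(2,3)]] by simp

lemma abs_lp_norm_diff_le:
  assumes f: "lp_fun M p f" and g: "lp_fun M p g"
  shows "\<bar>lp_norm M p f - lp_norm M p g\<bar> \<le> lp_norm M p (\<lambda>x. f x - g x)"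
  using lp_norm_triangle[OF lp_fun_diff[OF f g] g] lp_norm_triangle[OF lp_fun_diff[OF g f] f]
    lp_norm_minus_commute[of M p f g] by simp

lemma lp_norm_diff_eq_0_iff:
  assumes "lp_fun M p f" "lp_fun M p g"
  shows "lp_norm M p (\<lambda>x. f x - g x) = 0 \<longleftrightarrow> (AE x in M. f x = g x)"
  using lp_norm_eq_0_iff[OF p lp_fun_diff[OF assms]] by simp

lemma
  assumes "finite I" "\<And>i. i \<in> I \<Longrightarrow> lp_fun M p (f i)"
  shows lp_fun_sum: "lp_fun M p (\<lambda>x. \<Sum>i\<in>I. f i x)"
    and lp_norm_sum_le: "lp_norm M p (\<lambda>x. \<Sum>i\<in>I. f i x) \<le> (\<Sum>i\<in>I. lp_norm M p (f i))"
proof -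
  have "lp_fun M p (\<lambda>x. \<Sum>i\<in>I. f i x) \<and> lp_norm M p (\<lambda>x. \<Sum>i\<in>I. f i x) \<le> (\<Sum>i\<in>I. lp_norm M p (f i))"
    using assms
  proof (induction I rule: finite_induct)
    case empty
    then show ?case using p by (simp add: lp_fun_def)
  next
    case (insert i I)
    then show ?case
      using lp_norm_triangle[of M "f i" "\<lambda>x. \<Sum>i\<in>I. f i x"] lp_fun_add[of M "f i" "\<lambda>x. \<Sum>i\<in>I. f i x"]
      by auto
  qed
  then show "lp_fun M p (\<lambda>x. \<Sum>i\<in>I. f i x)" "lp_norm M p (\<lambda>x. \<Sum>i\<in>I. f i x) \<le> (\<Sum>i\<in>I. lp_norm M p (f i))"
    by auto
qed

lemma lp_norm_limit_le:
  assumes s: "\<And>i. lp_fun M p (s i)" and f: "f \<in> borel_measurable M"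
    and lim: "AE x in M. (\<lambda>i. s i x) \<longlonglongrightarrow> f x"
    and c: "c \<ge> 0" and bound: "eventually (\<lambda>i. lp_norm M p (s i) \<le> c) sequentially"
  shows "lp_fun M p f" "lp_norm M p f \<le> c"
proof -
  have [measurable]: "s i \<in> borel_measurable M" for i using s by (simp add: lp_fun_def)
  have "(\<integral>\<^sup>+x. ennreal (norm (f x) powr p) \<partial>M) = (\<integral>\<^sup>+x. liminf (\<lambda>i. ennreal (norm (s i x) powr p)) \<partial>M)"
  proof (rule nn_integral_cong_AE)
    show "AE x in M. ennreal (norm (f x) powr p) = liminf (\<lambda>i. ennreal (norm (s i x) powr p))"
      using lim
    proof eventually_elim
      case (elim x)
      have "(\<lambda>i. norm (s i x) powr p) \<longlonglongrightarrow> norm (f x) powr p"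
        using tendsto_powr'[OF tendsto_norm[OF elim] tendsto_const, of p] p by auto
      from lim_imp_Liminf[OF _ tendsto_ennrealI[OF this]] show ?case by simp
    qed
  qed
  also have "\<dots> \<le> liminf (\<lambda>i. \<integral>\<^sup>+x. ennreal (norm (s i x) powr p) \<partial>M)"
    by (rule nn_integral_liminf) measurable
  also have "\<dots> \<le> ennreal (c powr p)"
    using bound by (intro Liminf_le[OF sequentially_bot])
      (auto elim!: eventually_mono intro: nn_integral_lp_fun_le p s)
  finally show "lp_fun M p f" "lp_norm M p f \<le> c"
    by (auto intro!: lp_fun_nn_integralI p c f)
qed

proposition lp_dominated_convergence:
  assumes g: "lp_fun M p g" and f: "f \<in> borel_measurable M" and s: "\<And>i. s i \<in> borel_measurable M"
    and lim: "AE x in M. (\<lambda>i. s i x) \<longlonglongrightarrow> f x"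
    and bound: "\<And>i. AE x in M. norm (s i x) \<le> norm (g x)"
  shows "(\<lambda>i. lp_norm M p (\<lambda>x. s i x - f x)) \<longlonglongrightarrow> 0"
proof -
  have "AE x in M. \<forall>i. norm (s i x) \<le> norm (g x)"
    using bound by (simp add: AE_all_countable)
  then have fb: "AE x in M. norm (f x) \<le> norm (g x)"
    using lim by eventually_elim (rule Lim_bounded[OF tendsto_norm, of _ _ 0], auto)
  have "(\<lambda>i. \<integral>x. norm (s i x - f x) powr p \<partial>M) \<longlonglongrightarrow> (\<integral>x. 0 \<partial>M)"
  proof (rule integral_dominated_convergence[where w = "\<lambda>x. norm (2 *\<^sub>R g x) powr p"])
    show "integrable M (\<lambda>x. norm (2 *\<^sub>R g x) powr p)"
      by (intro lp_fun_integrable lp_fun_scaleR g)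
    show "AE x in M. (\<lambda>i. norm (s i x - f x) powr p) \<longlonglongrightarrow> 0"
      using lim
    proof eventually_elim
      case (elim x)
      then have "(\<lambda>i. norm (s i x - f x)) \<longlonglongrightarrow> 0"
        by (simp add: LIM_zero tendsto_norm_zero)
      from tendsto_powr'[OF this tendsto_const, of p] show ?case using p by simp
    qed
    show "AE x in M. norm (norm (s i x - f x) powr p) \<le> norm (2 *\<^sub>R g x) powr p" for i
      using bound[of i] fb
    proof eventually_elim
      case (elim x)
      then have "norm (s i x - f x) \<le> norm (2 *\<^sub>R g x)"
        using norm_triangle_ineq4[of "s i x" "f x"] by simp
      then show ?case using p by (auto intro: powr_mono2)
    qed
  qed (use s f in auto)
  then have "(\<lambda>i. (\<integral>x. norm (s i x - f x) powr p \<partial>M) powr (1 / p)) \<longlonglongrightarrow> 0 powr (1 / p)"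
    by (intro tendsto_powr'[OF _ tendsto_const])
      (use p in \<open>auto intro!: Bochner_Integration.integral_nonneg always_eventually\<close>)
  then show ?thesis by (simp add: lp_norm_def)
qed

lemma AE_summable_norm_lp:
  assumes d: "\<And>k. lp_fun M p (d k)" and c: "\<And>n. (\<Sum>k<n. lp_norm M p (d k)) \<le> c"
  shows "AE x in M. summable (\<lambda>k. norm (d k x))"
proof -
  define g where "g n x = (\<Sum>k<n. norm (d k x))" for n :: nat and x
  have g_nonneg: "g n x \<ge> 0" for n x by (simp add: g_def sum_nonneg)
  have lpg: "lp_fun M p (g n)" "lp_norm M p (g n) \<le> c" for n
    unfolding g_def using lp_fun_sum[of "{..<n}" M "\<lambda>k x. norm (d k x)"]
      lp_norm_sum_le[of "{..<n}" M "\<lambda>k x. norm (d k x)"] c[of n]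
    by (auto simp: lp_fun_norm d lp_norm_norm)
  have [measurable]: "g n \<in> borel_measurable M" for n using lpg by (simp add: lp_fun_def)
  have "(\<integral>\<^sup>+x. (SUP n. ennreal (g n x powr p)) \<partial>M) = (SUP n. \<integral>\<^sup>+x. ennreal (g n x powr p) \<partial>M)"
  proof (rule nn_integral_monotone_convergence_SUP)
    show "incseq (\<lambda>n x. ennreal (g n x powr p))"
      using p unfolding g_def
      by (intro incseq_SucI le_funI ennreal_leI powr_mono2) (auto intro: sum_nonneg)
  qed measurable
  also have "\<dots> \<le> ennreal (c powr p)"
    using nn_integral_lp_fun_le[OF p lpg] by (intro SUP_least) (simp add: g_nonneg)
  finally have "AE x in M. (SUP n. ennreal (g n x powr p)) \<noteq> \<infinity>"
    by (intro nn_integral_PInf_AE) (auto simp: top_unique)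
  then show ?thesis
  proof eventually_elim
    case (elim x)
    then obtain B where B: "B \<ge> 0" "(SUP n. ennreal (g n x powr p)) = ennreal B"
      by (cases "SUP n. ennreal (g n x powr p)") auto
    have "g n x \<le> B powr (1 / p)" for n
    proof -
      have "g n x powr p \<le> B" using B SUP_upper[of n UNIV "\<lambda>n. ennreal (g n x powr p)"] by simp
      then have "(g n x powr p) powr (1 / p) \<le> B powr (1 / p)" using p by (intro powr_mono2) auto
      then show ?thesis using p g_nonneg[of n x] by (simp add: powr_powr)
    qed
    then show ?case
      by (intro bounded_imp_summable[where B = "B powr (1 / p)"])
        (simp_all only: g_def lessThan_Suc_atMost[symmetric] norm_ge_zero)
  qed
qed

lemma rapidly_cauchy_lp_AE_convergent:
  assumes s: "\<And>k. lp_fun M p (s k)"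
    and rapid: "\<And>k. lp_norm M p (\<lambda>x. s (Suc k) x - s k x) \<le> (1 / 2) ^ k"
  shows "AE x in M. convergent (\<lambda>k. s k x)"
proof -
  have "(\<Sum>k<n. lp_norm M p (\<lambda>x. s (Suc k) x - s k x)) \<le> 2" for n
  proof -
    have "(\<Sum>k<n. lp_norm M p (\<lambda>x. s (Suc k) x - s k x)) \<le> (\<Sum>k<n. (1 / 2) ^ k)"
      by (intro sum_mono rapid)
    also have "\<dots> \<le> 2" by (simp add: sum_gp_strict)
    finally show ?thesis .
  qed
  then have "AE x in M. summable (\<lambda>k. norm (s (Suc k) x - s k x))"
    by (intro AE_summable_norm_lp lp_fun_diff s)
  then show ?thesis
  proof eventually_elim
    case (elim x)
    then have "summable (\<lambda>k. s (Suc k) x - s k x)" by (rule summable_norm_cancel)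
    then have "convergent (\<lambda>n. (\<Sum>k<n. s (Suc k) x - s k x) + s 0 x)"
      by (intro convergent_add convergent_const) (simp add: summable_iff_convergent)
    then show ?case using sum_lessThan_telescope[of "\<lambda>k. s k x"] by simp
  qed
qed

lemma lp_cauchy_AE_subseq_limit:
  assumes s: "\<And>i. lp_fun M p (s i)"
    and cauchy: "\<And>e. e > 0 \<Longrightarrow> \<exists>N. \<forall>m\<ge>N. \<forall>n\<ge>N. lp_norm M p (\<lambda>x. s m x - s n x) < e"
    and r: "strict_mono r" and f: "f \<in> borel_measurable M" and lim: "AE x in M. (\<lambda>k. s (r k) x) \<longlonglongrightarrow> f x"
  shows "lp_fun M p f" "(\<lambda>i. lp_norm M p (\<lambda>x. s i x - f x)) \<longlonglongrightarrow> 0"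
proof -
  have [measurable]: "f \<in> borel_measurable M" "s k \<in> borel_measurable M" for k
    using s f by (auto simp: lp_fun_def)
  have close: "lp_fun M p (\<lambda>x. s i x - f x) \<and> lp_norm M p (\<lambda>x. s i x - f x) \<le> e"
    if "e > 0" and N: "\<forall>m\<ge>N. \<forall>n\<ge>N. lp_norm M p (\<lambda>x. s m x - s n x) < e" "i \<ge> N" for e N i
  proof -
    have "AE x in M. (\<lambda>k. s i x - s (r k) x) \<longlonglongrightarrow> s i x - f x"
      using lim by eventually_elim (intro tendsto_intros)
    moreover have "r k \<ge> N" if "k \<ge> N" for k
      using seq_suble[OF r, of k] that by simp
    then have "\<forall>\<^sub>F k in sequentially. lp_norm M p (\<lambda>x. s i x - s (r k) x) \<le> e"
      using N by (intro eventually_sequentiallyI[of N]) (auto intro: less_imp_le)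
    ultimately show ?thesis
      using \<open>e > 0\<close> lp_norm_limit_le[of M "\<lambda>k x. s i x - s (r k) x"
        "\<lambda>x. s i x - f x" e] lp_fun_diff[OF s s]
      by simp
  qed
  obtain N where "\<forall>m\<ge>N. \<forall>n\<ge>N. lp_norm M p (\<lambda>x. s m x - s n x) < 1" using cauchy[of 1] by auto
  then have "lp_fun M p (\<lambda>x. s N x - f x)" using close[OF zero_less_one] by blast
  from lp_fun_diff[OF s[of N] this] show "lp_fun M p f" by simp
  show "(\<lambda>i. lp_norm M p (\<lambda>x. s i x - f x)) \<longlonglongrightarrow> 0"
  proof (rule LIMSEQ_I)
    fix e :: real assume "e > 0"
    then obtain N where "\<forall>m\<ge>N. \<forall>n\<ge>N. lp_norm M p (\<lambda>x. s m x - s n x) < e / 2" using cauchy[of "e / 2"]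
      by auto
    then show "\<exists>N. \<forall>i\<ge>N. norm (lp_norm M p (\<lambda>x. s i x - f x) - 0) < e"
      using close[of "e / 2" N] \<open>e > 0\<close> by (intro exI[of _ N]) force
  qed
qed

theorem lp_complete:
  assumes s: "\<And>i. lp_fun M p (s i)"
    and cauchy: "\<And>e. e > 0 \<Longrightarrow> \<exists>N. \<forall>m\<ge>N. \<forall>n\<ge>N. lp_norm M p (\<lambda>x. s m x - s n x) < e"
  obtains f where "lp_fun M p f" "(\<lambda>i. lp_norm M p (\<lambda>x. s i x - f x)) \<longlonglongrightarrow> 0"
proof -
  let ?P = "\<lambda>k m. \<forall>n\<ge>m. lp_norm M p (\<lambda>x. s n x - s m x) \<le> (1 / 2) ^ k"
  have "\<exists>m. ?P k m \<and> j < m" for k j :: nat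
  proof -
    obtain N where N: "\<forall>m\<ge>N. \<forall>n\<ge>N. lp_norm M p (\<lambda>x. s m x - s n x) < (1 / 2) ^ k"
      using cauchy[of "(1 / 2) ^ k"] by auto
    then show ?thesis by (intro exI[of _ "max N (Suc j)"]) (auto intro: less_imp_le)
  qed
  then obtain r where rapid: "\<And>k. ?P k (r k)" and "\<And>k. r k < r (Suc k)"
    using dependent_nat_choice[of ?P "\<lambda>k. (<)"] by blast
  then have r: "strict_mono r" by (simp add: strict_mono_Suc_iff)
  have [measurable]: "s k \<in> borel_measurable M" for k
    using s by (simp add: lp_fun_def)
  define f where "f x = lim (\<lambda>k. s (r k) x)" for x
  have f: "f \<in> borel_measurable M" unfolding f_def by measurable
  have "AE x in M. convergent (\<lambda>k. s (r k) x)"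
    using rapid r by (intro rapidly_cauchy_lp_AE_convergent s) (simp add: strict_mono_less_eq)
  then have "AE x in M. (\<lambda>k. s (r k) x) \<longlonglongrightarrow> f x"
    by eventually_elim (simp add: f_def convergent_LIMSEQ_iff)
  from lp_cauchy_AE_subseq_limit[OF s cauchy r f this] show thesis by (rule that)
qed

lemma nn_integral_lp_weighted_le:
  fixes F :: "'a \<Rightarrow> 'b \<Rightarrow> 'c::{banach, second_countable_topology}"
  assumes M: "sigma_finite_measure M" and N: "sigma_finite_measure N"
    and F [measurable]: "(\<lambda>(x, u). F x u) \<in> borel_measurable (M \<Otimes>\<^sub>M N)"
    and b [measurable]: "b \<in> borel_measurable N" and b_pos: "\<And>u. u \<in> space N \<Longrightarrow> b u > 0"
    and bound: "\<And>u. u \<in> space N \<Longrightarrow> lp_fun M p (\<lambda>x. F x u) \<and> lp_norm M p (\<lambda>x. F x u) \<le> b u"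
  shows "(\<integral>\<^sup>+x. \<integral>\<^sup>+u. ennreal (norm (F x u) powr p / b u powr (p - 1)) \<partial>N \<partial>M) \<le> (\<integral>\<^sup>+u. ennreal (b u) \<partial>N)"
proof -
  interpret pair_sigma_finite M N by (rule pair_sigma_finite.intro[OF M N])
  have "(\<integral>\<^sup>+x. \<integral>\<^sup>+u. ennreal (norm (F x u) powr p / b u powr (p - 1)) \<partial>N \<partial>M)
      = (\<integral>\<^sup>+u. \<integral>\<^sup>+x. ennreal (norm (F x u) powr p / b u powr (p - 1)) \<partial>M \<partial>N)"
    by (rule Fubini'[symmetric]) measurable
  also have "\<dots> \<le> (\<integral>\<^sup>+u. ennreal (b u) \<partial>N)"
  proof (rule nn_integral_mono)
    fix u assume u: "u \<in> space N"
    then have [measurable]: "(\<lambda>x. F x u) \<in> borel_measurable M" using bound by (simp add: lp_fun_def)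
    have "(\<integral>\<^sup>+x. ennreal (norm (F x u) powr p / b u powr (p - 1)) \<partial>M)
        = (\<integral>\<^sup>+x. ennreal (norm (F x u) powr p) * ennreal (1 / b u powr (p - 1)) \<partial>M)"
      by (simp add: ennreal_mult[symmetric])
    also have "\<dots> = (\<integral>\<^sup>+x. ennreal (norm (F x u) powr p) \<partial>M) * ennreal (1 / b u powr (p - 1))"
      by (rule nn_integral_multc) measurable
    also have "\<dots> \<le> ennreal (b u powr p) * ennreal (1 / b u powr (p - 1))"
      using bound[OF u] by (intro mult_right_mono nn_integral_lp_fun_le p) auto
    also have "\<dots> = ennreal (b u)"
      using b_pos[OF u] by (simp add: ennreal_mult[symmetric] powr_diff)
    finally show "(\<integral>\<^sup>+x. ennreal (norm (F x u) powr p / b u powr (p - 1)) \<partial>M) \<le> ennreal (b u)" .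
  qed
  finally show ?thesis .
qed

lemma norm_integral_powr_weighted_le:
  fixes f :: "'b \<Rightarrow> 'c::{banach, second_countable_topology}"
  assumes b: "integrable N b" "\<And>u. u \<in> space N \<Longrightarrow> b u > 0" and f: "f \<in> borel_measurable N"
    and finite: "(\<integral>\<^sup>+u. ennreal (norm (f u) powr p / b u powr (p - 1)) \<partial>N) \<noteq> \<infinity>"
  shows "integrable N f"
    and "ennreal (norm (\<integral>u. f u \<partial>N) powr p)
      \<le> ennreal ((\<integral>u. b u \<partial>N) powr (p - 1)) * (\<integral>\<^sup>+u. ennreal (norm (f u) powr p / b u powr (p - 1)) \<partial>N)"
proof -
  let ?q = "\<lambda>u. norm (f u) powr p / b u powr (p - 1)"
  note [measurable] = f borel_measurable_integrable[OF b(1)]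
  have int: "integrable N ?q"
    using finite by (intro integrableI_nonneg) (auto simp: less_top)
  note radon = radon_inequality_integral[OF p b _ norm_ge_zero int]
  show "integrable N f" using radon(1) by (simp add: integrable_norm_iff)
  have "norm (\<integral>u. f u \<partial>N) powr p \<le> (\<integral>u. norm (f u) \<partial>N) powr p"
    using p by (intro powr_mono2 integral_norm_bound) auto
  also have "\<dots> \<le> (\<integral>u. b u \<partial>N) powr (p - 1) * (\<integral>u. ?q u \<partial>N)"
    by (rule radon(2)) auto
  finally have "ennreal (norm (\<integral>u. f u \<partial>N) powr p)
      \<le> ennreal ((\<integral>u. b u \<partial>N) powr (p - 1)) * ennreal (\<integral>u. ?q u \<partial>N)"
    by (subst ennreal_mult[symmetric]) (auto intro!: Bochner_Integration.integral_nonneg ennreal_leI)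
  also have "ennreal (\<integral>u. ?q u \<partial>N) = (\<integral>\<^sup>+u. ennreal (?q u) \<partial>N)"
    by (rule nn_integral_eq_integral[symmetric, OF int]) auto
  finally show "ennreal (norm (\<integral>u. f u \<partial>N) powr p)
      \<le> ennreal ((\<integral>u. b u \<partial>N) powr (p - 1)) * (\<integral>\<^sup>+u. ennreal (?q u) \<partial>N)" .
qed

lemma minkowski_integral_positive_bound:
  fixes F :: "'a \<Rightarrow> 'b \<Rightarrow> 'c::{banach, second_countable_topology}"
  assumes M: "sigma_finite_measure M" and N: "sigma_finite_measure N"
    and F [measurable]: "(\<lambda>(x, u). F x u) \<in> borel_measurable (M \<Otimes>\<^sub>M N)"
    and b: "integrable N b" "\<And>u. u \<in> space N \<Longrightarrow> b u > 0"
    and bound: "\<And>u. u \<in> space N \<Longrightarrow> lp_fun M p (\<lambda>x. F x u) \<and> lp_norm M p (\<lambda>x. F x u) \<le> b u"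
  shows "AE x in M. integrable N (F x)"
    and "lp_fun M p (\<lambda>x. \<integral>u. F x u \<partial>N)"
    and "lp_norm M p (\<lambda>x. \<integral>u. F x u \<partial>N) \<le> (\<integral>u. b u \<partial>N)"
proof -
  interpret pair_sigma_finite M N by (rule pair_sigma_finite.intro[OF M N])
  have [measurable]: "b \<in> borel_measurable N" using b by auto
  define B where "B = (\<integral>u. b u \<partial>N)"
  have B: "B \<ge> 0" unfolding B_def using b
    by (intro Bochner_Integration.integral_nonneg) (auto intro: less_imp_le)
  let ?R = "\<lambda>x. \<integral>\<^sup>+u. ennreal (norm (F x u) powr p / b u powr (p - 1)) \<partial>N"
  have "(\<integral>\<^sup>+u. ennreal (b u) \<partial>N) = ennreal B"
    unfolding B_def using b by (intro nn_integral_eq_integral) (auto intro!: AE_I2 less_imp_le)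
  then have R_le: "(\<integral>\<^sup>+x. ?R x \<partial>M) \<le> ennreal B"
    using nn_integral_lp_weighted_le[OF M N F _ b(2) bound] by simp
  have "AE x in M. ?R x \<noteq> \<infinity>"
    by (rule nn_integral_PInf_AE) (use R_le in \<open>auto simp: top_unique\<close>)
  then have ae: "AE x in M. integrable N (F x) \<and>
     ennreal (norm (\<integral>u. F x u \<partial>N) powr p) \<le> ennreal (B powr (p - 1)) * ?R x"
    using AE_space
  proof eventually_elim
    case (elim x)
    have Fx: "F x \<in> borel_measurable N" using measurable_compose_Pair1[OF elim(2) F] by simp
    show ?case unfolding B_def using norm_integral_powr_weighted_le[OF b Fx elim(1)] by (rule conjI)
  qed
  then show "AE x in M. integrable N (F x)" by eventually_elim simp
  have "(\<integral>\<^sup>+x. ennreal (norm (\<integral>u. F x u \<partial>N) powr p) \<partial>M) \<le> (\<integral>\<^sup>+x. ennreal (B powr (p - 1)) * ?R x \<partial>M)"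
    using ae by (intro nn_integral_mono_AE) auto
  also have "\<dots> = ennreal (B powr (p - 1)) * (\<integral>\<^sup>+x. ?R x \<partial>M)"
    by (rule nn_integral_cmult) measurable
  also have "\<dots> \<le> ennreal (B powr (p - 1)) * ennreal B"
    by (intro mult_left_mono R_le) auto
  also have "\<dots> = ennreal (B powr p)"
    using B p by (cases "B = 0") (auto simp: ennreal_mult[symmetric] powr_diff)
  finally show "lp_fun M p (\<lambda>x. \<integral>u. F x u \<partial>N)" "lp_norm M p (\<lambda>x. \<integral>u. F x u \<partial>N) \<le> B"
    by (auto intro!: lp_fun_nn_integralI[OF p B])
qed

proposition minkowski_integral:
  fixes F :: "'a \<Rightarrow> 'b \<Rightarrow> 'c::{banach, second_countable_topology}"
  assumes M: "sigma_finite_measure M" and N: "sigma_finite_measure N"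
    and F: "(\<lambda>(x, u). F x u) \<in> borel_measurable (M \<Otimes>\<^sub>M N)" and b: "integrable N b"
    and bound: "\<And>u. u \<in> space N \<Longrightarrow> lp_fun M p (\<lambda>x. F x u) \<and> lp_norm M p (\<lambda>x. F x u) \<le> b u"
  shows "AE x in M. integrable N (F x)"
    and "lp_fun M p (\<lambda>x. \<integral>u. F x u \<partial>N)"
    and "lp_norm M p (\<lambda>x. \<integral>u. F x u \<partial>N) \<le> (\<integral>u. b u \<partial>N)"
proof -
  obtain w :: "'b \<Rightarrow> real" where w: "integrable N w" "\<And>u. w u > 0"
    using sigma_finite_measure.obtain_positive_integrable_function[OF N] by metis
  have "b u \<ge> 0" if "u \<in> space N" for u
    using bound[OF that] lp_norm_nonneg order_trans by blast
  then have perturbed: "integrable N (\<lambda>u. b u + e * w u)" "\<And>u. u \<in> space N \<Longrightarrow> b u + e * w u > 0"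
      "\<And>u. u \<in> space N \<Longrightarrow> lp_fun M p (\<lambda>x. F x u) \<and> lp_norm M p (\<lambda>x. F x u) \<le> b u + e * w u"
        if "e > 0" for e
    using b w that bound by (auto intro!: add_nonneg_pos intro: add_increasing2[OF less_imp_le])
  show "AE x in M. integrable N (F x)" "lp_fun M p (\<lambda>x. \<integral>u. F x u \<partial>N)"
    using minkowski_integral_positive_bound[OF M N F perturbed[OF zero_less_one]] by auto
  have W: "(\<integral>u. w u \<partial>N) \<ge> 0"
    using w by (intro Bochner_Integration.integral_nonneg) (auto intro: less_imp_le)
  show "lp_norm M p (\<lambda>x. \<integral>u. F x u \<partial>N) \<le> (\<integral>u. b u \<partial>N)"
  proof (rule field_le_epsilon)
    fix e :: real assume "e > 0"
    define d where "d = e / (1 + (\<integral>u. w u \<partial>N))"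
    have "d > 0" "d * (\<integral>u. w u \<partial>N) \<le> e"
      using \<open>e > 0\<close> W by (auto simp: d_def field_simps)
    with minkowski_integral_positive_bound(3)[OF M N F perturbed[OF \<open>d > 0\<close>]]
      show "lp_norm M p (\<lambda>x. \<integral>u. F x u \<partial>N) \<le> (\<integral>u. b u \<partial>N) + e"
      using b w by simp
  qed
qed

end

section \<open>Kernel operators on the half-line\<close>

definition half_line :: "real measure" where
  "half_line = restrict_space lborel {0<..}"

abbreviation "hfun \<equiv> lp_fun half_line"
abbreviation "hnorm \<equiv> lp_norm half_line"

lemma space_half_line [simp]: "space half_line = {0<..}"
  by (simp add: half_line_def space_restrict_space)

lemma sigma_finite_half_line: "sigma_finite_measure half_line"
  unfolding half_line_def
  by (rule sigma_finite_measure_restrict_space) (auto simp: lborel.sigma_finite_measure_axioms)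

interpretation half_line: sigma_finite_measure half_line
  by (rule sigma_finite_half_line)

interpretation half_line_pair: pair_sigma_finite half_line half_line ..

lemma integral_half_line:
  fixes f :: "real \<Rightarrow> 'b::{banach, second_countable_topology}"
  shows "integral\<^sup>L half_line f = (LINT x:{0<..}|lborel. f x)"
  by (simp add: half_line_def integral_restrict_space set_lebesgue_integral_def)

lemma integrable_half_line:
  fixes f :: "real \<Rightarrow> 'b::{banach, second_countable_topology}"
  shows "integrable half_line f \<longleftrightarrow> set_integrable lborel {0<..} f"
  by (simp add: half_line_def integrable_restrict_space set_integrable_def)

lemma borel_measurable_half_line_iff:
  fixes f :: "real \<Rightarrow> 'b::real_normed_vector"
  shows "f \<in> borel_measurable half_line \<longleftrightarrow> (\<lambda>x. indicator {0<..} x *\<^sub>R f x) \<in> borel_measurable borel"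
  by (simp add: half_line_def borel_measurable_restrict_space_iff)

lemma Lp_iff_lp_fun: "Lp p f \<longleftrightarrow> hfun p f"
  by (simp add: Lp_def lp_fun_def borel_measurable_half_line_iff set_borel_measurable_def
    integrable_half_line)

lemma Lp_norm_eq_lp_norm: "Lp_norm p f = hnorm p f"
  by (simp add: Lp_norm_def lp_norm_def integral_half_line)

lemma borel_measurable_half_line: "f \<in> borel_measurable borel \<Longrightarrow> f \<in> borel_measurable half_line"
  by (simp add: half_line_def measurable_restrict_space1)

lemma continuous_on_borel_measurable_half_line:
  fixes f :: "real \<Rightarrow> 'b::topological_space"
  assumes "continuous_on {0<..} f"
  shows "f \<in> borel_measurable half_line"
  using borel_measurable_continuous_on_restrict[OF assms]
  by (simp add: half_line_def measurable_cong_sets[OF sets_restrict_space_cong[OF sets_lborel] refl])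

lemma AE_half_line: "(\<And>x. x > 0 \<Longrightarrow> P x) \<Longrightarrow> AE x in half_line. P x"
  by (rule AE_I2) simp

lemma AE_half_line_lborel: "AE x in lborel. P x \<Longrightarrow> AE x in half_line. P x"
  unfolding half_line_def by (subst AE_restrict_space_iff) auto

lemma measurable_half_lineI:
  assumes "f \<in> borel_measurable N" "\<And>x. x \<in> space N \<Longrightarrow> f x > 0"
  shows "f \<in> N \<rightarrow>\<^sub>M half_line"
  unfolding half_line_def using assms by (intro measurable_restrict_space2) auto

lemma measurable_half_lineD: "f \<in> N \<rightarrow>\<^sub>M half_line \<Longrightarrow> f \<in> borel_measurable N"
  unfolding half_line_def using measurable_restrict_space2_iff[of f N lborel "{0<..}"] by simp

lemma half_line_mult [measurable (raw)]:
  assumes "f \<in> N \<rightarrow>\<^sub>M half_line" "g \<in> N \<rightarrow>\<^sub>M half_line"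
  shows "(\<lambda>x. f x * g x) \<in> N \<rightarrow>\<^sub>M half_line"
  using assms[THEN measurable_half_lineD] assms[THEN measurable_space]
  by (intro measurable_half_lineI borel_measurable_times) auto

lemma half_line_divide [measurable (raw)]:
  assumes "f \<in> N \<rightarrow>\<^sub>M half_line" "g \<in> N \<rightarrow>\<^sub>M half_line"
  shows "(\<lambda>x. f x / g x) \<in> N \<rightarrow>\<^sub>M half_line"
  using assms[THEN measurable_half_lineD] assms[THEN measurable_space]
  by (intro measurable_half_lineI borel_measurable_divide) auto

lemma half_line_id_borel [measurable]: "(\<lambda>x. x) \<in> borel_measurable half_line"
  by (rule borel_measurable_half_line) simp

lemma half_line_scale [measurable]: "c > 0 \<Longrightarrow> (\<lambda>x. c * x) \<in> half_line \<rightarrow>\<^sub>M half_line"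
  by (intro half_line_mult measurable_const measurable_ident_sets) auto

lemma half_line_shift: "c \<ge> 0 \<Longrightarrow> (\<lambda>x. c + x) \<in> half_line \<rightarrow>\<^sub>M half_line"
  by (intro measurable_half_lineI borel_measurable_add measurable_const half_line_id_borel) auto

lemma has_bochner_integral_half_line_scale_iff:
  fixes f :: "real \<Rightarrow> 'b::{banach, second_countable_topology}"
  assumes "c > 0"
  shows "has_bochner_integral half_line (\<lambda>x. f (c * x)) I \<longleftrightarrow> has_bochner_integral half_line f (c *\<^sub>R I)"
proof -
  have "has_bochner_integral half_line f (c *\<^sub>R I)
      \<longleftrightarrow> has_bochner_integral lborel (\<lambda>x. indicator {0<..} x *\<^sub>R f x) (c *\<^sub>R I)"
    unfolding half_line_def by (simp add: has_bochner_integral_restrict_space)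
  also have "\<dots> \<longleftrightarrow> has_bochner_integral lborel (\<lambda>x. indicator {0<..} (0 + c * x) *\<^sub>R f (0 + c * x)) I"
    using assms by (subst lborel_has_bochner_integral_real_affine_iff[of c _ _ 0]) auto
  also have "(\<lambda>x. indicator {0<..} (0 + c * x) *\<^sub>R f (0 + c * x))
      = (\<lambda>x. indicator {0<..} x *\<^sub>R f (c * x))"
    using assms by (auto simp: indicator_def zero_less_mult_iff)
  also have "has_bochner_integral lborel \<dots> I \<longleftrightarrow> has_bochner_integral half_line (\<lambda>x. f (c * x)) I"
    unfolding half_line_def by (simp add: has_bochner_integral_restrict_space)
  finally show ?thesis ..
qed

lemma integrable_half_line_scale_iff:
  fixes f :: "real \<Rightarrow> 'b::{banach, second_countable_topology}"
  assumes "c > 0"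
  shows "integrable half_line (\<lambda>x. f (c * x)) \<longleftrightarrow> integrable half_line f"
proof
  assume "integrable half_line f"
  then have "has_bochner_integral half_line f (c *\<^sub>R ((1 / c) *\<^sub>R integral\<^sup>L half_line f))"
    using assms by (simp add: has_bochner_integral_iff)
  then show "integrable half_line (\<lambda>x. f (c * x))"
    unfolding has_bochner_integral_half_line_scale_iff[OF assms, symmetric] by (rule integrable.intros)
qed (use assms in \<open>auto simp: integrable.simps has_bochner_integral_half_line_scale_iff\<close>)

lemma integral_half_line_scale:
  fixes f :: "real \<Rightarrow> 'b::{banach, second_countable_topology}"
  assumes "c > 0"
  shows "(\<integral>x. f (c * x) \<partial>half_line) = (1 / c) *\<^sub>R (\<integral>x. f x \<partial>half_line)"
proof (cases "integrable half_line f")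
  case True
  then have "has_bochner_integral half_line f (c *\<^sub>R ((1 / c) *\<^sub>R integral\<^sup>L half_line f))"
    using assms by (simp add: has_bochner_integral_iff)
  then show ?thesis
    unfolding has_bochner_integral_half_line_scale_iff[OF assms, symmetric]
    by (rule has_bochner_integral_integral_eq)
next
  case False
  then show ?thesis
    using integrable_half_line_scale_iff[OF assms, of f] by (simp add: not_integrable_integral_eq)
qed

lemma integral_half_line_pair_scale:
  fixes P :: "real \<Rightarrow> real \<Rightarrow> 'b::{banach, second_countable_topology}"
  assumes P: "integrable (half_line \<Otimes>\<^sub>M half_line) (\<lambda>(u, v). P u v)"
  shows "(\<integral>u. \<integral>v. P u v \<partial>half_line \<partial>half_line) = (\<integral>w. \<integral>u. (1 / u) *\<^sub>R P u (w / u) \<partial>half_line \<partial>half_line)"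
proof -
  define Q where "Q u w = (1 / u) *\<^sub>R P u (w / u)" for u w
  have scale: "(\<integral>w. norm (Q u w) \<partial>half_line) = (\<integral>v. norm (P u v) \<partial>half_line)"
      "(\<integral>w. Q u w \<partial>half_line) = (\<integral>v. P u v \<partial>half_line)"
      "integrable half_line (Q u) \<longleftrightarrow> integrable half_line (\<lambda>v. (1 / u) *\<^sub>R P u v)" if "u > 0" for u
    using that integral_half_line_scale[OF that, of "\<lambda>w. norm (P u (w / u))"]
      integral_half_line_scale[OF that, of "\<lambda>w. P u (w / u)"]
        integrable_half_line_scale_iff[OF that, of "Q u"]
    by (simp_all add: Q_def[abs_def])
  have Q: "integrable (half_line \<Otimes>\<^sub>M half_line) (\<lambda>(u, w). Q u w)"
  proof (rule half_line_pair.Fubini_integrable)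
    have "(\<lambda>z. (fst z, snd z / fst z)) \<in> half_line \<Otimes>\<^sub>M half_line \<rightarrow>\<^sub>M half_line \<Otimes>\<^sub>M half_line"
      by measurable
    from measurable_compose[OF this borel_measurable_integrable[OF P]]
    show "(\<lambda>(u, w). Q u w) \<in> borel_measurable (half_line \<Otimes>\<^sub>M half_line)"
      unfolding Q_def split_beta' fst_conv snd_conv by measurable
    have "integrable half_line (\<lambda>u. \<integral>v. norm (P u v) \<partial>half_line)"
      using half_line_pair.integrable_fst'[OF integrable_norm[OF P]] by simp
    then show "integrable half_line (\<lambda>u. \<integral>w. norm (case (u, w) of (u, w) \<Rightarrow> Q u w) \<partial>half_line)"
      by (rule Bochner_Integration.integrable_cong[THEN iffD2, rotated -1]) (simp_all add: scale)
    show "AE u in half_line. integrable half_line (\<lambda>w. case (u, w) of (u, w) \<Rightarrow> Q u w)"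
      using half_line_pair.AE_integrable_fst[OF P] AE_space by eventually_elim (simp add: scale)
  qed
  have "(\<integral>u. \<integral>v. P u v \<partial>half_line \<partial>half_line) = (\<integral>u. \<integral>w. Q u w \<partial>half_line \<partial>half_line)"
    by (rule Bochner_Integration.integral_cong) (simp_all add: scale)
  also have "\<dots> = (\<integral>w. \<integral>u. Q u w \<partial>half_line \<partial>half_line)"
    by (rule half_line_pair.Fubini_integral[OF Q, symmetric])
  finally show "(\<integral>u. \<integral>v. P u v \<partial>half_line \<partial>half_line) = (\<integral>w. \<integral>u. Q u w \<partial>half_line \<partial>half_line)" .
qed

lemma lp_fun_scale:
  assumes "c > 0" "hfun p f"
  shows "hfun p (\<lambda>x. f (c * x))"
  using assms measurable_compose[OF half_line_scale[OF assms(1)], of f borel]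
    integrable_half_line_scale_iff[OF assms(1), of "\<lambda>x. norm (f x) powr p"]
  by (simp add: lp_fun_def)

lemma lp_norm_scale:
  assumes "c > 0"
  shows "hnorm p (\<lambda>x. f (c * x)) = c powr (- 1 / p) * hnorm p f"
proof -
  have "hnorm p (\<lambda>x. f (c * x)) = (1 / c * (\<integral>x. norm (f x) powr p \<partial>half_line)) powr (1 / p)"
    using integral_half_line_scale[OF assms, of "\<lambda>x. norm (f x) powr p"] by (simp add: lp_norm_def)
  also have "\<dots> = (1 / c) powr (1 / p) * hnorm p f"
    unfolding lp_norm_def by (rule powr_mult)
  finally show ?thesis
    using assms by (simp add: powr_divide powr_minus_divide)
qed

lemma lp_fun_T_grp: "hfun p f \<Longrightarrow> hfun p (T_grp p t f)"
  unfolding T_grp_def by (intro lp_fun_cmult lp_fun_scale) auto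

lemma lp_norm_T_grp: "p \<ge> 1 \<Longrightarrow> hnorm p (T_grp p t f) = hnorm p f"
  unfolding T_grp_def by (simp add: lp_norm_cmult lp_norm_scale) (simp add: powr_def flip: exp_add)

lemma T_grp_zero: "T_grp p 0 f = f"
  by (simp add: T_grp_def)

lemma T_grp_add: "T_grp p (t + u) f = T_grp p t (T_grp p u f)"
proof -
  have "exp (- (t + u) / p) = exp (- t / p) * exp (- u / p)" "exp (- (t + u)) = exp (- t) * exp (- u)"
    by (simp_all add: add_divide_distrib diff_divide_distrib flip: exp_add)
  then show ?thesis
    unfolding T_grp_def by (simp only: of_real_mult mult_ac)
qed

lemma T_grp_diff: "T_grp p t (\<lambda>s. f s - g s) = (\<lambda>s. T_grp p t f s - T_grp p t g s)"
  by (simp add: T_grp_def algebra_simps)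

lemma T_grp_cong_AE:
  assumes p: "p \<ge> 1" and f: "hfun p f" and g: "hfun p g" and ae: "AE s in half_line. f s = g s"
  shows "AE s in half_line. T_grp p t f s = T_grp p t g s"
  using ae lp_norm_T_grp[OF p, of t "\<lambda>s. f s - g s"] lp_norm_diff_eq_0_iff[OF p f g]
    lp_norm_diff_eq_0_iff[OF p lp_fun_T_grp[OF f] lp_fun_T_grp[OF g]]
  by (simp add: T_grp_diff)

definition kernel_op :: "(real \<Rightarrow> real) \<Rightarrow> (real \<Rightarrow> 'b::{banach, second_countable_topology}) \<Rightarrow> real \<Rightarrow> 'b"
  where
  "kernel_op k f t = (\<integral>u. k u *\<^sub>R f (t * u) \<partial>half_line)"

definition kernel_norm :: "real \<Rightarrow> (real \<Rightarrow> real) \<Rightarrow> real" where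
  "kernel_norm p k = (\<integral>u. k u * u powr (- 1 / p) \<partial>half_line)"

definition lp_kernel :: "real \<Rightarrow> (real \<Rightarrow> real) \<Rightarrow> bool" where
  "lp_kernel p k \<longleftrightarrow> k \<in> borel_measurable half_line \<and> (\<forall>u>0. 0 \<le> k u) \<and>
     integrable half_line (\<lambda>u. k u * u powr (- 1 / p))"

lemma lp_kernelD:
  assumes "lp_kernel p k"
  shows "k \<in> borel_measurable half_line" "\<And>u. u > 0 \<Longrightarrow> 0 \<le> k u"
    "integrable half_line (\<lambda>u. k u * u powr (- 1 / p))"
  using assms by (auto simp: lp_kernel_def)

lemma kernel_norm_nonneg: "lp_kernel p k \<Longrightarrow> 0 \<le> kernel_norm p k"
  unfolding kernel_norm_def by (intro Bochner_Integration.integral_nonneg) (auto simp: lp_kernel_def)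

lemma kernel_op_cong: "(\<And>x. x > 0 \<Longrightarrow> f x = g x) \<Longrightarrow> t > 0 \<Longrightarrow> kernel_op k f t = kernel_op k g t"
  unfolding kernel_op_def by (rule Bochner_Integration.integral_cong) auto

lemma kernel_op_cmult:
  fixes f :: "real \<Rightarrow> complex"
  shows "kernel_op k (\<lambda>x. c * f x) t = c * kernel_op k f t"
  by (simp add: kernel_op_def mult_scaleR_right[symmetric] del: mult_scaleR_right)

lemma kernel_op_T_grp: "kernel_op k (T_grp p t f) s = T_grp p t (kernel_op k f) s"
proof -
  have "kernel_op k (T_grp p t f) s = kernel_op k (\<lambda>x. exp (- t / p) * f (exp (- t) * x)) s"
    by (simp add: T_grp_def)
  also have "\<dots> = exp (- t / p) * kernel_op k (\<lambda>x. f (exp (- t) * x)) s"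
    by (rule kernel_op_cmult)
  also have "\<dots> = T_grp p t (kernel_op k f) s"
    by (simp add: T_grp_def kernel_op_def mult.assoc)
  finally show ?thesis .
qed

context
  fixes p :: real
  assumes p: "p \<ge> 1"
begin

lemma
  assumes "hfun p f" "u > 0" "a \<ge> 0"
  shows lp_fun_scaleR_scale: "hfun p (\<lambda>x. a *\<^sub>R f (x * u))"
    and lp_norm_scaleR_scale: "hnorm p (\<lambda>x. a *\<^sub>R f (x * u)) = a * u powr (- 1 / p) * hnorm p f"
proof -
  have eq: "(\<lambda>x. a *\<^sub>R f (x * u)) = (\<lambda>x. a *\<^sub>R f (u * x))" by (simp add: mult.commute)
  show "hfun p (\<lambda>x. a *\<^sub>R f (x * u))"
    unfolding eq by (intro lp_fun_scaleR lp_fun_scale assms)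
  show "hnorm p (\<lambda>x. a *\<^sub>R f (x * u)) = a * u powr (- 1 / p) * hnorm p f"
    unfolding eq using assms p by (simp add: lp_norm_scaleR lp_norm_scale)
qed

lemma
  assumes k: "lp_kernel p k" and f: "hfun p f"
  shows AE_integrable_kernel_op: "AE t in half_line. integrable half_line (\<lambda>u. k u *\<^sub>R f (t * u))"
    and lp_fun_kernel_op: "hfun p (kernel_op k f)"
    and lp_norm_kernel_op_le: "hnorm p (kernel_op k f) \<le> kernel_norm p k * hnorm p f"
proof -
  note [measurable] = lp_fun_measurable[OF f] lp_kernelD(1)[OF k]
  have measurable: "(\<lambda>(t, u). k u *\<^sub>R f (t * u)) \<in> borel_measurable (half_line \<Otimes>\<^sub>M half_line)"
    by measurable
  have integrable: "integrable half_line (\<lambda>u. k u * u powr (- 1 / p) * hnorm p f)"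
    using lp_kernelD(3)[OF k] by (rule integrable_mult_left)
  have "hfun p (\<lambda>t. k u *\<^sub>R f (t * u)) \<and> hnorm p (\<lambda>t. k u *\<^sub>R f (t * u))
      \<le> k u * u powr (- 1 / p) * hnorm p f"
    if "u \<in> space half_line" for u
    using that lp_kernelD(2)[OF k] f by (simp add: lp_fun_scaleR_scale lp_norm_scaleR_scale)
  from minkowski_integral[OF p sigma_finite_half_line sigma_finite_half_line measurable integrable this]
  show "AE t in half_line. integrable half_line (\<lambda>u. k u *\<^sub>R f (t * u))" "hfun p (kernel_op k f)"
      "hnorm p (kernel_op k f) \<le> kernel_norm p k * hnorm p f"
    by (simp_all add: kernel_op_def[abs_def] kernel_norm_def)
qed

lemma kernel_op_linear:
  fixes f g :: "real \<Rightarrow> complex"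
  assumes k: "lp_kernel p k" and f: "hfun p f" and g: "hfun p g"
  shows "AE t in half_line. kernel_op k (\<lambda>x. f x + c * g x) t = kernel_op k f t + c * kernel_op k g t"
  using AE_integrable_kernel_op[OF k f] AE_integrable_kernel_op[OF k lp_fun_cmult[OF g, of c]]
proof eventually_elim
  case (elim t)
  then have "kernel_op k (\<lambda>x. f x + c * g x) t = kernel_op k f t + kernel_op k (\<lambda>x. c * g x) t"
    by (simp add: kernel_op_def scaleR_add_right)
  then show ?case by (simp add: kernel_op_cmult)
qed

lemma kernel_op_add_kernels:
  assumes k: "lp_kernel p k" "lp_kernel p l" and f: "hfun p f"
  shows "AE t in half_line. kernel_op (\<lambda>u. k u + l u) f t = kernel_op k f t + kernel_op l f t"
  using AE_integrable_kernel_op[OF k(1) f] AE_integrable_kernel_op[OF k(2) f]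
  by eventually_elim (simp add: kernel_op_def scaleR_add_left)

lemma AE_integrable_kernel_op_pair:
  assumes k: "lp_kernel p k" and l: "lp_kernel p l" and f: "hfun p f"
  shows "AE t in half_line.
      integrable (half_line \<Otimes>\<^sub>M half_line) (\<lambda>(u, v). (k u * l v) *\<^sub>R f (t * (u * v)))"
proof (rule minkowski_integral(1)[OF p sigma_finite_half_line
  half_line_pair.sigma_finite_measure_axioms])
  note [measurable] = lp_fun_measurable[OF f] lp_kernelD(1)[OF k] lp_kernelD(1)[OF l]
  let ?k = "\<lambda>u. k u * u powr (- 1 / p)" and ?l = "\<lambda>v. l v * v powr (- 1 / p)"
  show "(\<lambda>(t, z). case z of (u, v) \<Rightarrow> (k u * l v) *\<^sub>R f (t * (u * v)))
      \<in> borel_measurable (half_line \<Otimes>\<^sub>M (half_line \<Otimes>\<^sub>M half_line))"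
    unfolding split_beta' by measurable
  show "integrable (half_line \<Otimes>\<^sub>M half_line) (\<lambda>z. ?k (fst z) * ?l (snd z) * hnorm p f)"
  proof (rule integrable_mult_left, rule half_line_pair.Fubini_integrable)
    show "integrable half_line (\<lambda>u. \<integral>v. norm (?k (fst (u, v)) * ?l (snd (u, v))) \<partial>half_line)"
      unfolding fst_conv snd_conv norm_mult[of "?k _"] integral_mult_right_zero
      by (intro integrable_mult_left integrable_norm lp_kernelD k)
    show "AE u in half_line. integrable half_line (\<lambda>v. ?k (fst (u, v)) * ?l (snd (u, v)))"
      using lp_kernelD(3)[OF l] by simp
  qed measurable
  show "hfun p (\<lambda>t. case z of (u, v) \<Rightarrow> (k u * l v) *\<^sub>R f (t * (u * v))) \<and>
      hnorm p (\<lambda>t. case z of (u, v) \<Rightarrow> (k u * l v) *\<^sub>R f (t * (u * v)))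
          \<le> ?k (fst z) * ?l (snd z) * hnorm p f"
    if pair: "z \<in> space (half_line \<Otimes>\<^sub>M half_line)" for z
  proof -
    obtain u v where z: "z = (u, v)" "u > 0" "v > 0"
      using pair by (cases z) (auto simp: space_pair_measure)
    then have "u * v > 0" "k u * l v \<ge> 0" using lp_kernelD(2)[OF k] lp_kernelD(2)[OF l] by auto
    then show ?thesis
      using z f by (simp add: lp_fun_scaleR_scale lp_norm_scaleR_scale powr_mult)
  qed
qed

lemma kernel_op_commute:
  assumes k: "lp_kernel p k" and l: "lp_kernel p l" and f: "hfun p f"
  shows "AE t in half_line. kernel_op k (kernel_op l f) t = kernel_op l (kernel_op k f) t"
  using AE_integrable_kernel_op_pair[OF k l f]
proof eventually_elim
  case (elim t)
  have "kernel_op k (kernel_op l f) t = (\<integral>u. \<integral>v. (k u * l v) *\<^sub>R f (t * (u * v)) \<partial>half_line \<partial>half_line)"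
    unfolding kernel_op_def integral_scaleR_right[symmetric] by (simp add: mult.assoc)
  also have "\<dots> = (\<integral>v. \<integral>u. (k u * l v) *\<^sub>R f (t * (u * v)) \<partial>half_line \<partial>half_line)"
    by (rule half_line_pair.Fubini_integral[OF elim, symmetric])
  also have "\<dots> = kernel_op l (kernel_op k f) t"
    unfolding kernel_op_def integral_scaleR_right[symmetric] by (simp add: mult_ac)
  finally show ?case .
qed

lemma kernel_op_compose:
  assumes k: "lp_kernel p k" and l: "lp_kernel p l" and f: "hfun p f"
    and convolution: "\<And>w. w > 0 \<Longrightarrow> has_bochner_integral half_line (\<lambda>u. k u * l (w / u) / u) (m w)"
  shows "AE t in half_line. kernel_op k (kernel_op l f) t = kernel_op m f t"
  using AE_integrable_kernel_op_pair[OF k l f]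
proof eventually_elim
  case (elim t)
  have "kernel_op k (kernel_op l f) t = (\<integral>u. \<integral>v. (k u * l v) *\<^sub>R f (t * (u * v)) \<partial>half_line \<partial>half_line)"
    unfolding kernel_op_def integral_scaleR_right[symmetric] by (simp add: mult.assoc)
  also have "\<dots> = (\<integral>w. \<integral>u. (1 / u) *\<^sub>R (k u * l (w / u)) *\<^sub>R f (t * (u * (w / u))) \<partial>half_line \<partial>half_line)"
    by (rule integral_half_line_pair_scale[OF elim])
  also have "\<dots> = (\<integral>w. \<integral>u. (k u * l (w / u) / u) *\<^sub>R f (t * w) \<partial>half_line \<partial>half_line)"
    by (intro Bochner_Integration.integral_cong refl) simp
  also have "\<dots> = kernel_op m f t"
    unfolding kernel_op_def
    by (rule Bochner_Integration.integral_cong)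
      (use convolution in \<open>auto simp: has_bochner_integral_iff\<close>)
  finally show ?case .
qed

end

section \<open>Density and strong continuity\<close>

lemma has_bochner_integral_half_lineI:
  fixes f :: "real \<Rightarrow> real"
  assumes f: "f \<in> borel_measurable borel" and nonneg: "\<And>x. x \<in> \<Omega> \<Longrightarrow> 0 \<le> f x"
    and I: "(f has_integral I) \<Omega>" and \<Omega>: "\<Omega> \<in> sets borel" "\<Omega> \<subseteq> {0..}"
  shows "has_bochner_integral half_line (\<lambda>x. indicator \<Omega> x * f x) I"
proof (rule has_bochner_integral_nn_integral)
  show "(\<lambda>x. indicator \<Omega> x * f x) \<in> borel_measurable half_line"
    using f \<Omega> by (intro borel_measurable_half_line) auto
  show "AE x in half_line. 0 \<le> indicator \<Omega> x * f x"
    using nonneg by (auto simp: indicator_def)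
  show "0 \<le> I" using has_integral_nonneg[OF I] nonneg by auto
  have "AE x in lborel. x \<noteq> (0::real)" by (rule AE_lborel_singleton)
  then have "(\<integral>\<^sup>+x. ennreal (indicator \<Omega> x * f x) * indicator {0<..} x \<partial>lborel)
      = (\<integral>\<^sup>+x. ennreal (f x) * indicator \<Omega> x \<partial>lborel)"
    by (intro nn_integral_cong_AE, eventually_elim) (use \<Omega> in \<open>auto simp: indicator_def\<close>)
  then show "(\<integral>\<^sup>+x. ennreal (indicator \<Omega> x * f x) \<partial>half_line) = ennreal I"
    using nn_integral_has_integral_lebesgue'[OF nonneg I]
    by (simp add: half_line_def nn_integral_restrict_space)
qed

lemma powr_one_plus_le:
  fixes x b :: real
  assumes "x > 0"
  shows "(1 + x) powr b \<le> max 1 (2 powr b) * max 1 x powr b"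
proof -
  define y where "y = (1 + x) / max 1 x"
  have y: "1 \<le> y" "y \<le> 2" using assms by (auto simp: y_def field_simps)
  have "y powr b \<le> max 1 (2 powr b)"
    using y powr_mono2[of b y 2] powr_mono2'[of b 1 y] by (cases "b \<ge> 0") auto
  then have "y powr b * max 1 x powr b \<le> max 1 (2 powr b) * max 1 x powr b"
    by (rule mult_right_mono) simp
  also have "y powr b * max 1 x powr b = (1 + x) powr b"
    by (simp add: y_def flip: powr_mult)
  finally show ?thesis .
qed

lemma integrable_half_line_powr_powr:
  fixes a b :: real
  assumes a: "a > - 1" and ab: "a + b < - 1"
  shows "integrable half_line (\<lambda>x. x powr a * (1 + x) powr b)"
proof -
  define C where "C = max 1 (2 powr b)"
  define g where "g x = C * (indicator {0..1} x * x powr a + indicator {1..} x * x powr (a + b))" for x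
  have "has_bochner_integral half_line (\<lambda>x. indicator {0..1} x * x powr a) (1 powr (a + 1) / (a + 1))"
    by (rule has_bochner_integral_half_lineI[OF _ _ has_integral_powr_from_0[OF a]]) auto
  moreover have "has_bochner_integral half_line (\<lambda>x. indicator {1..} x * x powr (a + b))
      (- (1 powr (a + b + 1)) / (a + b + 1))"
    by (rule has_bochner_integral_half_lineI[OF _ _ has_integral_powr_to_inf[OF ab]]) auto
  ultimately have g: "integrable half_line g"
    unfolding g_def by (intro integrable_mult_right Bochner_Integration.integrable_add)
      (auto simp: has_bochner_integral_iff)
  show ?thesis
  proof (rule Bochner_Integration.integrable_bound[OF g])
    show "AE x in half_line. norm (x powr a * (1 + x) powr b) \<le> norm (g x)"
    proof (rule AE_half_line)
      fix x :: real assume x: "x > 0"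
      have "x powr a * (1 + x) powr b \<le> x powr a * (C * max 1 x powr b)"
        unfolding C_def by (intro mult_left_mono powr_one_plus_le x) simp
      also have "\<dots> \<le> g x"
        using x by (cases "x \<le> 1") (auto simp: g_def C_def indicator_def powr_add max_def algebra_simps)
      finally show "norm (x powr a * (1 + x) powr b) \<le> norm (g x)" by simp
    qed
  qed measurable
qed

lemma lp_fun_one_plus_powr:
  assumes "p \<ge> 1" "b < - 1"
  shows "hfun p (\<lambda>x. (1 + x) powr b)"
proof -
  have "b * p \<le> b * 1" using assms by (intro mult_left_mono_neg) auto
  then have "integrable half_line (\<lambda>x. x powr 0 * (1 + x) powr (b * p))"
    using assms(2) by (intro integrable_half_line_powr_powr) linarith+
  also have "integrable half_line (\<lambda>x. x powr 0 * (1 + x) powr (b * p))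
      \<longleftrightarrow> integrable half_line (\<lambda>x. norm ((1 + x) powr b) powr p)"
    by (rule Bochner_Integration.integrable_cong) (auto simp: powr_powr)
  finally show ?thesis by (simp add: lp_fun_def)
qed

lemma bounded_continuous_compact_support:
  fixes g :: "real \<Rightarrow> 'b::real_normed_vector"
  assumes "continuous_on UNIV g" "\<And>s. s \<notin> {a..b} \<Longrightarrow> g s = 0"
  obtains M where "M \<ge> 0" "\<And>s. norm (g s) \<le> M"
proof -
  have "bounded (g ` {a..b})"
    by (intro compact_imp_bounded compact_continuous_image continuous_on_subset[OF assms(1)]) auto
  then obtain M where M: "\<And>s. s \<in> {a..b} \<Longrightarrow> norm (g s) \<le> M" unfolding bounded_iff by blast
  have "norm (g s) \<le> \<bar>M\<bar>" for s
    using M[of s] assms(2)[of s] by (cases "s \<in> {a..b}") auto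
  then show ?thesis by (intro that[of "\<bar>M\<bar>"]) auto
qed

definition cutoff :: "nat \<Rightarrow> real \<Rightarrow> real" where
  "cutoff n s = max 0 (min 1 (min (real n * s - 1) (real n + 1 - s)))"

lemma cutoff_bounds: "0 \<le> cutoff n s" "cutoff n s \<le> 1"
  by (auto simp: cutoff_def)

lemma cutoff_eq_0:
  assumes "s \<notin> {1 / (real n + 1)..real n + 1}"
  shows "cutoff n s = 0"
proof (cases "s > real n + 1")
  case False
  then have "s < 1 / (real n + 1)" using assms by auto
  then have "(real n + 1) * s \<le> 1" by (simp add: field_simps)
  then have "real n * s \<le> 1" using mult_nonneg_nonpos[of "real n" s]
    by (cases "s \<ge> 0") (auto simp: algebra_simps)
  then show ?thesis by (simp add: cutoff_def)
qed (simp add: cutoff_def)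

lemma eventually_cutoff_eq_1:
  assumes "s > 0"
  shows "\<forall>\<^sub>F n in sequentially. cutoff n s = 1"
proof -
  obtain N where N: "real N \<ge> max s (2 / s)" using real_arch_simple by blast
  have "cutoff n s = 1" if "n \<ge> N" for n
  proof -
    have "real n \<ge> s" "real n \<ge> 2 / s" using N that by auto
    then show ?thesis using assms by (simp add: cutoff_def field_simps)
  qed
  then show ?thesis by (rule eventually_sequentiallyI)
qed

definition truncation :: "nat \<Rightarrow> (real \<Rightarrow> 'b) \<Rightarrow> real \<Rightarrow> 'b::euclidean_space" where
  "truncation n f s = cutoff n s *\<^sub>R closest_point (cball 0 (real n)) (f s)"

lemma continuous_on_cutoff: "continuous_on S (cutoff n)"
  unfolding cutoff_def[abs_def] by (intro continuous_intros)

lemma continuous_on_closest_point_cball: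
  "continuous_on UNIV (closest_point (cball (0::'b::euclidean_space) (real n)))"
  by (intro continuous_on_closest_point) auto

lemma norm_truncation_le:
  shows "norm (truncation n f s) \<le> norm (f s)" "norm (truncation n f s) \<le> real n"
proof -
  have "dist (closest_point (cball 0 (real n)) (f s)) (closest_point (cball 0 (real n)) 0)
      \<le> dist (f s) 0"
    by (intro closest_point_lipschitz) auto
  then have "norm (closest_point (cball 0 (real n)) (f s)) \<le> norm (f s)"
    by (simp add: closest_point_self)
  moreover have "norm (closest_point (cball 0 (real n)) (f s)) \<le> real n"
    using closest_point_in_set[of "cball 0 (real n)" "f s"] by simp
  ultimately show "norm (truncation n f s) \<le> norm (f s)" "norm (truncation n f s) \<le> real n"
    using cutoff_bounds[of n s] by (auto simp: truncation_def intro: order_trans[OF mult_left_le_one_le])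
qed

lemma truncation_eq_0: "s \<notin> {1 / (real n + 1)..real n + 1} \<Longrightarrow> truncation n f s = 0"
  unfolding truncation_def by (drule cutoff_eq_0) simp

lemma truncation_measurable [measurable]:
  assumes [measurable]: "f \<in> borel_measurable half_line"
  shows "truncation n f \<in> borel_measurable half_line"
proof -
  have [measurable]: "cutoff n \<in> borel_measurable half_line"
    by (intro continuous_on_borel_measurable_half_line continuous_on_cutoff)
  have "(\<lambda>s. closest_point (cball 0 (real n)) (f s)) \<in> borel_measurable half_line"
    by (rule measurable_compose[OF assms
      borel_measurable_continuous_onI[OF continuous_on_closest_point_cball]])
  then show ?thesis unfolding truncation_def[abs_def] by measurable
qed

lemma continuous_on_truncation:
  assumes "continuous_on UNIV g"
  shows "continuous_on UNIV (truncation n g)"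
  unfolding truncation_def[abs_def]
  by (intro continuous_on_scaleR continuous_on_cutoff
    continuous_on_compose2[OF continuous_on_closest_point_cball assms]) auto

lemma truncation_tendsto:
  fixes f :: "real \<Rightarrow> 'b::euclidean_space"
  assumes "(\<lambda>i. g i s) \<longlonglongrightarrow> f s"
  shows "(\<lambda>i. truncation n (g i) s) \<longlonglongrightarrow> truncation n f s"
proof -
  have "isCont (closest_point (cball 0 (real n))) (f s)"
    using continuous_on_closest_point_cball[of n, where 'b = 'b]
    by (simp add: continuous_on_eq_continuous_at)
  then show ?thesis
    unfolding truncation_def by (intro tendsto_scaleR tendsto_const isCont_tendsto_compose[OF _ assms])
qed

lemma AE_half_line_limit_continuous:
  fixes f :: "real \<Rightarrow> 'b::euclidean_space"
  assumes "f \<in> borel_measurable half_line"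
  obtains g where "\<And>i::nat. continuous_on UNIV (g i)" "AE s in half_line. (\<lambda>i. g i s) \<longlonglongrightarrow> f s"
proof -
  have "(\<lambda>x. indicator {0<..} x *\<^sub>R f x) \<in> borel_measurable lebesgue"
    using assms by (auto simp: borel_measurable_half_line_iff intro: measurable_completion)
  then have "(\<lambda>x. indicator {0<..} x *\<^sub>R f x) measurable_on UNIV"
    by (rule lebesgue_measurable_imp_measurable_on) simp
  then obtain Z g where Z: "negligible Z" and g: "\<And>i. continuous_on UNIV (g i)"
    and lim: "\<And>x. x \<notin> Z \<Longrightarrow> (\<lambda>i. g i x) \<longlonglongrightarrow> indicator {0<..} x *\<^sub>R f x"
    unfolding measurable_on_def by auto
  have "AE x in lebesgue. x \<notin> Z" using Z by (intro AE_not_in) (simp add: negligible_iff_null_sets)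
  then have "AE x in half_line. x \<notin> Z" by (intro AE_half_line_lborel) (simp add: AE_completion_iff)
  then have "AE s in half_line. (\<lambda>i. g i s) \<longlonglongrightarrow> f s"
    using AE_space by eventually_elim (use lim in force)
  with g show thesis by (rule that)
qed

context
  fixes p :: real
  assumes p: "p \<ge> 1"
begin

lemma lp_fun_bounded_support:
  fixes g :: "real \<Rightarrow> 'b::{banach, second_countable_topology}"
  assumes g: "g \<in> borel_measurable half_line" and M: "\<And>s. s > 0 \<Longrightarrow> norm (g s) \<le> M"
    and A: "\<And>s. s > A \<Longrightarrow> g s = 0"
  shows "hfun p g"
proof (rule lp_fun_bound(1)[OF p _ g])
  have "integrable lborel (indicator {0<..A} :: real \<Rightarrow> real)"
    using emeasure_bounded_finite[OF bounded_Ioc[of 0 A]] by (simp add: integrable_indicator_iff)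
  moreover have "indicator {0<..A} = (\<lambda>s. indicator {0<..} s *\<^sub>R (indicator {..A} s :: real))"
    by (auto simp: indicator_def)
  ultimately have "integrable half_line (indicator {..A} :: real \<Rightarrow> real)"
    by (simp add: integrable_half_line set_integrable_def)
  then have "integrable half_line (\<lambda>s. \<bar>M\<bar> powr p * indicator {..A} s)"
    by (rule integrable_mult_right)
  moreover have "\<bar>M\<bar> powr p * indicator {..A} s = norm (M * indicator {..A} s) powr p" for s
    using p by (auto simp: indicator_def)
  moreover have "(\<lambda>s. M * indicator {..A} s) \<in> borel_measurable half_line"
    by (rule borel_measurable_half_line) measurable
  ultimately show "hfun p (\<lambda>s. M * indicator {..A} s)"
    unfolding lp_fun_def by simp
  show "AE s in half_line. norm (g s) \<le> norm (M * indicator {..A} s)"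
    using M A by (intro AE_half_line) (force simp: indicator_def intro: order_trans[OF _ abs_ge_self])
qed

lemma lp_fun_continuous_compact_support:
  fixes g :: "real \<Rightarrow> 'b::{banach, second_countable_topology}"
  assumes g: "continuous_on UNIV g" and supp: "\<And>s. s \<notin> {a..b} \<Longrightarrow> g s = 0"
  shows "hfun p g"
proof -
  obtain M where "\<And>s. norm (g s) \<le> M"
    using bounded_continuous_compact_support[OF g supp] by blast
  then show ?thesis
    using supp g by (intro lp_fun_bounded_support[where A = b])
      (auto intro: continuous_on_borel_measurable_half_line continuous_on_subset)
qed

lemma lp_norm_truncation_tendsto:
  fixes f :: "real \<Rightarrow> 'b::euclidean_space"
  assumes f: "hfun p f"
  shows "(\<lambda>n. hnorm p (\<lambda>s. truncation n f s - f s)) \<longlonglongrightarrow> 0"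
proof (rule lp_dominated_convergence[OF p f lp_fun_measurable[OF f]])
  show "AE s in half_line. (\<lambda>n. truncation n f s) \<longlonglongrightarrow> f s"
  proof (rule AE_half_line)
    fix s :: real assume s: "s > 0"
    obtain N where N: "norm (f s) \<le> real N" using real_arch_simple by blast
    have "\<forall>\<^sub>F n in sequentially. truncation n f s = f s"
      using eventually_cutoff_eq_1[OF s] eventually_ge_at_top[of N]
      by eventually_elim (use N in \<open>auto simp: truncation_def closest_point_self\<close>)
    then show "(\<lambda>n. truncation n f s) \<longlonglongrightarrow> f s" by (rule tendsto_eventually)
  qed
qed (use lp_fun_measurable[OF f] norm_truncation_le in auto)

lemma lp_norm_truncation_limit:
  fixes f :: "real \<Rightarrow> 'b::euclidean_space"
  assumes f: "f \<in> borel_measurable half_line" and g: "\<And>i. g i \<in> borel_measurable half_line"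
    and lim: "AE s in half_line. (\<lambda>i. g i s) \<longlonglongrightarrow> f s"
  shows "(\<lambda>i. hnorm p (\<lambda>s. truncation n (g i) s - truncation n f s)) \<longlonglongrightarrow> 0"
proof (rule lp_dominated_convergence[OF p, where g = "\<lambda>s. real n * indicator {..real n + 1} s"])
  show "hfun p (\<lambda>s. real n * indicator {..real n + 1} s)"
    by (rule lp_fun_bounded_support[where M = "real n" and A = "real n + 1"])
      (auto simp: indicator_def intro!: borel_measurable_half_line)
  show "AE s in half_line. (\<lambda>i. truncation n (g i) s) \<longlonglongrightarrow> truncation n f s"
    using lim by eventually_elim (rule truncation_tendsto)
  show "AE s in half_line. norm (truncation n (g i) s) \<le> norm (real n * indicator {..real n + 1} s)"
    for i
    using norm_truncation_le(2)[of n "g i"] truncation_eq_0[of _ n "g i"]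
    by (intro AE_half_line) (simp add: indicator_def)
qed (use f g in auto)

theorem lp_dense_continuous_compact_support:
  fixes f :: "real \<Rightarrow> 'b::euclidean_space"
  assumes f: "hfun p f" and e: "e > 0"
  obtains g a b where "continuous_on UNIV g" "a > 0" "\<And>s. s \<notin> {a..b} \<Longrightarrow> g s = 0"
    "hnorm p (\<lambda>s. f s - g s) < e"
proof -
  note [measurable] = lp_fun_measurable[OF f]
  obtain g where g: "\<And>i::nat. continuous_on UNIV (g i)" and lim: "AE s in half_line. (\<lambda>i. g i s) \<longlonglongrightarrow> f s"
    using AE_half_line_limit_continuous[OF lp_fun_measurable[OF f]] by blast
  have [measurable]: "g i \<in> borel_measurable half_line" for i
    by (intro continuous_on_borel_measurable_half_line continuous_on_subset[OF g]) auto
  obtain n where n: "hnorm p (\<lambda>s. truncation n f s - f s) < e / 2"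
    using order_tendstoD(2)[OF lp_norm_truncation_tendsto[OF f], of "e / 2"] e
    by (auto simp: eventually_sequentially)
  have "(\<lambda>i. hnorm p (\<lambda>s. truncation n (g i) s - truncation n f s)) \<longlonglongrightarrow> 0"
    by (intro lp_norm_truncation_limit lim) measurable
  then obtain i where i: "hnorm p (\<lambda>s. truncation n (g i) s - truncation n f s) < e / 2"
    using order_tendstoD(2)[of _ 0 sequentially "e / 2"] e by (auto simp: eventually_sequentially)
  have "hfun p (truncation n f)"
    using norm_truncation_le by (intro lp_fun_bound(1)[OF p f]) auto
  moreover have "hfun p (truncation n (g i))"
    by (rule lp_fun_continuous_compact_support[OF continuous_on_truncation[OF g] truncation_eq_0])
  ultimately have "hnorm p (\<lambda>s. f s - truncation n (g i) s) < e"
    using lp_norm_triangle_dist[OF p f, of "truncation n f" "truncation n (g i)"] n i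
      lp_norm_minus_commute[of half_line p f "truncation n f"]
      lp_norm_minus_commute[of half_line p "truncation n f" "truncation n (g i)"] by simp
  then show thesis
    by (intro that[OF continuous_on_truncation[OF g] _ truncation_eq_0]) auto
qed

lemma norm_T_grp_le:
  assumes "\<bar>t\<bar> \<le> B" and M: "\<And>s. norm (g s) \<le> M" and A: "\<And>s. s > A \<Longrightarrow> g s = 0" and s: "s > 0"
  shows "norm (T_grp p t g s) \<le> exp B * M * indicator {..A * exp B} s"
proof (cases "s \<le> A * exp B")
  case True
  have "\<bar>t\<bar> / p \<le> \<bar>t\<bar> / 1" using p by (intro divide_left_mono) auto
  then have "- t / p \<le> B" using assms(1) p abs_ge_minus_self[of "t / p"] by simp
  then have "exp (- t / p) * norm (g (exp (- t) * s)) \<le> exp B * M"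
    using M by (intro mult_mono) auto
  then show ?thesis using True by (simp add: T_grp_def norm_mult)
next
  case False
  then have "A < exp (- B) * s" by (simp add: exp_minus field_simps)
  also have "\<dots> \<le> exp (- t) * s" using assms(1) s by (intro mult_right_mono) auto
  finally show ?thesis using A False by (simp add: T_grp_def)
qed

lemma T_grp_strongly_continuous_compact_support:
  assumes g: "continuous_on UNIV g" and supp: "\<And>s. s \<notin> {a..b} \<Longrightarrow> g s = 0"
  shows "((\<lambda>t. hnorm p (\<lambda>s. T_grp p t g s - g s)) \<longlongrightarrow> 0) (at 0)"
  unfolding tendsto_at_iff_sequentially o_def
proof (intro allI impI)
  fix X :: "nat \<Rightarrow> real" assume X: "X \<longlonglongrightarrow> 0"
  then have "Bseq X" by (rule convergent_imp_Bseq[OF convergentI])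
  then obtain B where B: "\<And>n. \<bar>X n\<bar> \<le> B" by (auto simp: Bseq_def)
  obtain M where M: "M \<ge> 0" "\<And>s. norm (g s) \<le> M"
    using bounded_continuous_compact_support[OF g supp] by blast
  have lpg: "hfun p g" by (rule lp_fun_continuous_compact_support[OF g supp])
  let ?D = "\<lambda>s. exp B * M * indicator {..b * exp B} s"
  show "(\<lambda>i. hnorm p (\<lambda>s. T_grp p (X i) g s - g s)) \<longlonglongrightarrow> 0"
  proof (rule lp_dominated_convergence[OF p, where g = "\<lambda>s. complex_of_real (?D s)"])
    show "hfun p (\<lambda>s. complex_of_real (?D s))"
      using M by (intro lp_fun_bounded_support[where M = "exp B * M" and A = "b * exp B"])
        (auto simp: indicator_def norm_mult intro!: borel_measurable_half_line)
    show "AE s in half_line. (\<lambda>i. T_grp p (X i) g s) \<longlonglongrightarrow> g s"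
    proof (rule AE_half_line)
      fix s :: real
      have "(\<lambda>i. exp (- X i) * s) \<longlonglongrightarrow> exp (- 0) * s" by (intro tendsto_intros X)
      then have "(\<lambda>i. g (exp (- X i) * s)) \<longlonglongrightarrow> g s"
        using g by (intro isCont_tendsto_compose[of s g]) (auto simp: continuous_on_eq_continuous_at)
      then have "(\<lambda>i. T_grp p (X i) g s) \<longlonglongrightarrow> complex_of_real (exp (- 0 / p)) * g s"
        unfolding T_grp_def using p by (intro tendsto_intros X) auto
      then show "(\<lambda>i. T_grp p (X i) g s) \<longlonglongrightarrow> g s" by simp
    qed
    show "AE s in half_line. norm (T_grp p (X i) g s) \<le> norm (complex_of_real (?D s))" for i
      using norm_T_grp_le[OF B M(2), of b] supp M(1) by (intro AE_half_line) (auto simp: norm_mult)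
  qed (use lpg lp_fun_T_grp in \<open>auto dest: lp_fun_measurable\<close>)
qed

theorem T_grp_strongly_continuous:
  assumes f: "hfun p f"
  shows "((\<lambda>t. hnorm p (\<lambda>s. T_grp p t f s - f s)) \<longlongrightarrow> 0) (at 0)"
proof (rule tendstoI)
  fix e :: real assume e: "e > 0"
  then obtain g a b where g: "continuous_on UNIV g" "\<And>s. s \<notin> {a..b} \<Longrightarrow> g s = 0"
    and close: "hnorm p (\<lambda>s. f s - g s) < e / 3"
    using lp_dense_continuous_compact_support[OF f, of "e / 3"]
    by (metis zero_less_divide_iff zero_less_numeral)
  have lpg: "hfun p g" by (rule lp_fun_continuous_compact_support[OF g])
  have "\<forall>\<^sub>F t in at 0. hnorm p (\<lambda>s. T_grp p t g s - g s) < e / 3"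
    using T_grp_strongly_continuous_compact_support[OF g] e by (intro order_tendstoD(2)) auto
  then show "\<forall>\<^sub>F t in at 0. dist (hnorm p (\<lambda>s. T_grp p t f s - f s)) 0 < e"
  proof eventually_elim
    case (elim t)
    have "hnorm p (\<lambda>s. T_grp p t f s - T_grp p t g s) < e / 3"
      using close lp_norm_T_grp[OF p, of t "\<lambda>s. f s - g s"] by (simp add: T_grp_diff)
    then have "hnorm p (\<lambda>s. T_grp p t f s - f s) < e"
      using lp_norm_triangle_dist[OF p lp_fun_T_grp[OF f] lp_fun_T_grp[OF lpg] f, of t t]
        lp_norm_triangle_dist[OF p lp_fun_T_grp[OF lpg] lpg f, of t] elim close
          lp_norm_minus_commute[of half_line p f g]
      by simp
    then show ?case by simp
  qed
qed

end

section \<open>The generator on the Lebesgue space and its resolvents\<close>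

definition generator_error :: "real \<Rightarrow> (real \<Rightarrow> complex) \<Rightarrow> (real \<Rightarrow> complex) \<Rightarrow> real \<Rightarrow> real \<Rightarrow> complex" where
  "generator_error p f g t s = (T_grp p t f s - f s) / complex_of_real t - g s"

definition lp_generator :: "real \<Rightarrow> (real \<Rightarrow> complex) \<Rightarrow> (real \<Rightarrow> complex) \<Rightarrow> bool" where
  "lp_generator p f g \<longleftrightarrow> ((\<lambda>t. hnorm p (generator_error p f g t)) \<longlongrightarrow> 0) (at 0)"

lemma generator_error_diff:
  "generator_error p (\<lambda>s. f s - f' s) (\<lambda>s. g s - g' s) t s
      = generator_error p f g t s - generator_error p f' g' t s"
  by (simp add: generator_error_def T_grp_diff diff_divide_distrib)

lemma generator_error_uminus:
  assumes "t \<noteq> 0"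
  shows "generator_error p f g (- t)
      = (\<lambda>s. T_grp p (- t) (generator_error p f g t) s + (T_grp p (- t) g s - g s))"
proof
  fix s
  have "T_grp p (- t) (T_grp p t f) = f"
    using T_grp_add[of p "- t" t f] by (simp add: T_grp_zero)
  then have "T_grp p (- t) (T_grp p t f) s = f s" by simp
  then show "generator_error p f g (- t) s
      = T_grp p (- t) (generator_error p f g t) s + (T_grp p (- t) g s - g s)"
    using assms by (simp add: generator_error_def T_grp_def field_simps)
qed

context
  fixes p :: real
  assumes p: "p \<ge> 1"
begin

lemma lp_fun_generator_error:
  assumes "hfun p f" "hfun p g"
  shows "hfun p (generator_error p f g t)"
proof -
  have "hfun p (\<lambda>s. (1 / complex_of_real t) * (T_grp p t f s - f s) - g s)"
    by (intro lp_fun_diff p lp_fun_cmult lp_fun_T_grp assms)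
  then show ?thesis by (simp add: generator_error_def[abs_def])
qed

lemma lp_generator_cong_AE:
  assumes "hfun p f" "hfun p g" "hfun p f'" "hfun p g'"
    and "AE s in half_line. f s = f' s" "AE s in half_line. g s = g' s"
  shows "lp_generator p f g \<longleftrightarrow> lp_generator p f' g'"
proof -
  have "hnorm p (generator_error p f g t) = hnorm p (generator_error p f' g' t)" for t
  proof (rule lp_norm_cong_AE)
    show "AE s in half_line. generator_error p f g t s = generator_error p f' g' t s"
      using assms(5,6) T_grp_cong_AE[OF p assms(1,3,5), of t]
      by eventually_elim (simp add: generator_error_def)
  qed (use assms(1-4) lp_fun_generator_error in \<open>auto dest: lp_fun_measurable\<close>)
  then show ?thesis by (simp add: lp_generator_def)
qed

lemma lp_generator_diff:
  assumes f: "hfun p f" "hfun p g" "hfun p f'" "hfun p g'"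
    and gen: "lp_generator p f g" "lp_generator p f' g'"
  shows "lp_generator p (\<lambda>s. f s - f' s) (\<lambda>s. g s - g' s)"
  unfolding lp_generator_def
proof (rule tendsto_sandwich[OF _ _ tendsto_const])
  show "((\<lambda>t. hnorm p (generator_error p f g t) + hnorm p (generator_error p f' g' t)) \<longlongrightarrow> 0) (at 0)"
    using tendsto_add[OF gen[unfolded lp_generator_def]] by simp
  show "\<forall>\<^sub>F t in at 0. hnorm p (generator_error p (\<lambda>s. f s - f' s) (\<lambda>s. g s - g' s) t)
      \<le> hnorm p (generator_error p f g t) + hnorm p (generator_error p f' g' t)"
    using lp_norm_triangle_diff[OF p lp_fun_generator_error[OF f(1,2)] lp_fun_generator_error[OF f(3,4)]]
    by (simp add: generator_error_diff[abs_def])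
qed simp

lemma lp_generatorI_right:
  assumes f: "hfun p f" and g: "hfun p g"
    and lim: "((\<lambda>t. hnorm p (generator_error p f g t)) \<longlongrightarrow> 0) (at_right 0)"
  shows "lp_generator p f g"
proof -
  have "((\<lambda>t. hnorm p (generator_error p f g (- t))) \<longlongrightarrow> 0) (at_right 0)"
  proof (rule tendsto_sandwich[OF _ _ tendsto_const])
    have "((\<lambda>t. hnorm p (\<lambda>s. T_grp p t g s - g s)) \<longlongrightarrow> 0) (at_left 0)"
      by (rule tendsto_within_subset[OF T_grp_strongly_continuous[OF p g]]) simp
    then have "((\<lambda>t. hnorm p (\<lambda>s. T_grp p (- t) g s - g s)) \<longlongrightarrow> 0) (at_right 0)"
      by (simp add: filterlim_at_left_to_right)
    from tendsto_add[OF lim this]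
    show "((\<lambda>t. hnorm p (generator_error p f g t) + hnorm p (\<lambda>s. T_grp p (- t) g s - g s))
        \<longlongrightarrow> 0) (at_right 0)"
      by simp
    have "hnorm p (generator_error p f g (- t))
        \<le> hnorm p (generator_error p f g t) + hnorm p (\<lambda>s. T_grp p (- t) g s - g s)"
      if "t > 0" for t
      using lp_norm_triangle[OF p lp_fun_T_grp[OF lp_fun_generator_error[OF f g]]
        lp_fun_diff[OF p lp_fun_T_grp[OF g] g], of "- t" t "- t"]
        that by (simp add: generator_error_uminus lp_norm_T_grp[OF p])
    then show "\<forall>\<^sub>F t in at_right 0. hnorm p (generator_error p f g (- t))
        \<le> hnorm p (generator_error p f g t) + hnorm p (\<lambda>s. T_grp p (- t) g s - g s)"
      by (auto simp: eventually_at_filter)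
  qed simp
  then have "((\<lambda>t. hnorm p (generator_error p f g t)) \<longlongrightarrow> 0) (at_left 0)"
    by (simp add: filterlim_at_left_to_right)
  with lim show ?thesis unfolding lp_generator_def by (simp add: filterlim_at_split)
qed

text \<open>A group of isometries has no real spectrum off zero: backwards in time the eigenfunction
  would grow.\<close>

lemma lp_generator_no_negative_eigenvalue:
  assumes f: "hfun p f" and l: "l > 0" and gen: "lp_generator p f (\<lambda>s. - complex_of_real l * f s)"
  shows "hnorm p f = 0"
proof -
  let ?E = "generator_error p f (\<lambda>s. - complex_of_real l * f s)"
  have "((\<lambda>t. hnorm p (?E t)) \<longlongrightarrow> 0) (at_left 0)"
    by (rule tendsto_within_subset[OF gen[unfolded lp_generator_def]]) simp
  moreover have "\<forall>\<^sub>F t in at_left 0. l * hnorm p f \<le> hnorm p (?E t)"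
    unfolding eventually_at_filter
  proof (intro always_eventually allI impI)
    fix t :: real assume "t \<noteq> 0" "t \<in> {..<0}"
    then have t: "t < 0" by simp
    have E: "hfun p (?E t)" by (intro lp_fun_generator_error f lp_fun_cmult)
    have "(1 - l * t) * hnorm p f = hnorm p (\<lambda>s. complex_of_real (1 - l * t) * f s)"
      using t mult_pos_neg[OF l t] unfolding lp_norm_cmult[OF p] norm_of_real by simp
    also have "(\<lambda>s. complex_of_real (1 - l * t) * f s)
        = (\<lambda>s. T_grp p t f s - complex_of_real t * ?E t s)"
      using t by (auto simp: generator_error_def field_simps)
    also have "hnorm p \<dots> \<le> hnorm p f + \<bar>t\<bar> * hnorm p (?E t)"
      using lp_norm_triangle_diff[OF p lp_fun_T_grp[OF f]
          lp_fun_cmult[OF E, of "complex_of_real t"], of t]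
      unfolding lp_norm_cmult[OF p] lp_norm_T_grp[OF p] norm_of_real .
    finally have "\<bar>t\<bar> * (l * hnorm p f) \<le> \<bar>t\<bar> * hnorm p (?E t)"
      using t by (simp add: algebra_simps)
    then show "l * hnorm p f \<le> hnorm p (?E t)" using t by simp
  qed
  ultimately have "l * hnorm p f \<le> 0"
    by (rule tendsto_lowerbound) simp
  then show ?thesis using l lp_norm_nonneg[of half_line p f] by (simp add: mult_le_0_iff)
qed

end

lemma integral_half_line_shift:
  fixes f :: "real \<Rightarrow> 'b::{banach, second_countable_topology}"
  assumes "t \<ge> 0"
  shows "(\<integral>x. f (t + x) \<partial>half_line) = (\<integral>s. indicator {t<..} s *\<^sub>R f s \<partial>half_line)"
proof -
  have "(\<integral>s. indicator {t<..} s *\<^sub>R f s \<partial>half_line) = (\<integral>s. indicator {t<..} s *\<^sub>R f s \<partial>lborel)"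
    unfolding integral_half_line set_lebesgue_integral_def
    by (rule Bochner_Integration.integral_cong) (use assms in \<open>auto simp: indicator_def\<close>)
  also have "\<dots> = \<bar>1\<bar> *\<^sub>R (\<integral>x. indicator {t<..} (t + 1 * x) *\<^sub>R f (t + 1 * x) \<partial>lborel)"
    by (rule lborel_integral_real_affine) simp
  also have "\<dots> = (\<integral>x. f (t + x) \<partial>half_line)"
    unfolding integral_half_line set_lebesgue_integral_def by (simp add: indicator_def)
  finally show ?thesis ..
qed

lemma integrable_half_line_shift_iff:
  fixes f :: "real \<Rightarrow> 'b::{banach, second_countable_topology}"
  assumes "t \<ge> 0"
  shows "integrable half_line (\<lambda>x. f (t + x)) \<longleftrightarrow> integrable half_line (\<lambda>s. indicator {t<..} s *\<^sub>R f s)"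
proof -
  have "integrable half_line (\<lambda>s. indicator {t<..} s *\<^sub>R f s)
      \<longleftrightarrow> integrable lborel (\<lambda>s. indicator {t<..} s *\<^sub>R f s)"
    unfolding integrable_half_line set_integrable_def
    by (rule Bochner_Integration.integrable_cong) (use assms in \<open>auto simp: indicator_def\<close>)
  also have "\<dots> \<longleftrightarrow> integrable lborel (\<lambda>x. indicator {t<..} (t + 1 * x) *\<^sub>R f (t + 1 * x))"
    by (rule lborel_integrable_real_affine_iff[symmetric]) simp
  also have "\<dots> \<longleftrightarrow> integrable half_line (\<lambda>x. f (t + x))"
    unfolding integrable_half_line set_integrable_def by (simp add: indicator_def)
  finally show ?thesis ..
qed

text \<open>The Erdelyi--Kober operator with parameters \<open>b\<close> and \<open>c\<close> is \<open>t\<^sup>c W\<^bsup>-b\<^esup> t\<^bsup>-b-c\<^esup>\<close>; on \<open>L\<^sup>p\<close>,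
  the one with \<open>b = 1\<close> is the resolvent \<open>(\<Lambda> + 1/p + c)\<^bsup>-1\<^esup>\<close>.\<close>

definition ek_kernel :: "real \<Rightarrow> real \<Rightarrow> real \<Rightarrow> real" where
  "ek_kernel b c u = (if u > 1 then (u - 1) powr (b - 1) * u powr (- b - c) / Gamma b else 0)"

abbreviation "erdelyi_kober b c \<equiv> kernel_op (ek_kernel b c)"
abbreviation "resolvent \<mu> \<equiv> erdelyi_kober 1 \<mu>"

lemma ek_kernel_measurable [measurable]: "ek_kernel b c \<in> borel_measurable borel"
  unfolding ek_kernel_def[abs_def] by measurable

lemma ek_kernel_1: "ek_kernel 1 \<mu> u = (if u > 1 then u powr (- \<mu> - 1) else 0)"
  by (simp add: ek_kernel_def minus_diff_commute)

lemma lp_kernel_ek: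
  assumes b: "b > 0" and c: "c > - 1 / p"
  shows "lp_kernel p (ek_kernel b c)"
  unfolding lp_kernel_def
proof (intro conjI allI impI)
  show "ek_kernel b c \<in> borel_measurable half_line" by (rule borel_measurable_half_line) measurable
  show "0 \<le> ek_kernel b c u" for u using b by (simp add: ek_kernel_def Gamma_real_pos less_imp_le)
  have "integrable half_line (\<lambda>x. x powr (b - 1) * (1 + x) powr (- b - c - 1 / p))"
    by (rule integrable_half_line_powr_powr) (use b c in auto)
  then have "integrable half_line (\<lambda>x. (\<lambda>u. (u - 1) powr (b - 1) * u powr (- b - c - 1 / p)) (1 + x))"
    by simp
  then have "integrable half_line
      (\<lambda>u. indicator {1<..} u *\<^sub>R ((u - 1) powr (b - 1) * u powr (- b - c - 1 / p)))"
    by (subst (asm) integrable_half_line_shift_iff) auto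
  then have "integrable half_line
      (\<lambda>u. indicator {1<..} u *\<^sub>R ((u - 1) powr (b - 1) * u powr (- b - c - 1 / p)) / Gamma b)"
    by (rule integrable_divide)
  also have "(\<lambda>u. indicator {1<..} u *\<^sub>R ((u - 1) powr (b - 1) * u powr (- b - c - 1 / p)) / Gamma b)
      = (\<lambda>u. ek_kernel b c u * u powr (- 1 / p))"
    by (auto simp: ek_kernel_def indicator_def algebra_simps simp flip: powr_add)
  finally show "integrable half_line (\<lambda>u. ek_kernel b c u * u powr (- 1 / p))" .
qed

definition avg_kernel :: "real \<Rightarrow> real \<Rightarrow> real \<Rightarrow> real" where
  "avg_kernel \<mu> t u = (if exp (- t) < u \<and> u \<le> 1 then u powr (- \<mu> - 1) else 0)"

lemma avg_kernel_measurable [measurable]: "avg_kernel \<mu> t \<in> borel_measurable borel"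
  unfolding avg_kernel_def[abs_def] by measurable

lemma has_bochner_integral_avg_kernel:
  assumes nonzero: "\<mu> + 1 / p \<noteq> 0" and t: "t > 0"
  shows "has_bochner_integral half_line
      (\<lambda>u. avg_kernel \<mu> t u * u powr (- 1 / p))
      ((exp ((\<mu> + 1 / p) * t) - 1) / (\<mu> + 1 / p))"
proof -
  define l where "l = \<mu> + 1 / p"
  have "l \<noteq> 0" using nonzero by (simp add: l_def)
  have "((\<lambda>u. u powr (- l - 1))
      has_integral ((- 1 / l) * 1 powr (- l) - (- 1 / l) * exp (- t) powr (- l))) {exp (- t)..1}"
  proof (rule fundamental_theorem_of_calculus)
    fix x assume "x \<in> {exp (- t)..1}"
    then have "x > 0" by (auto intro: less_le_trans[OF exp_gt_zero])
    then show "((\<lambda>u. - 1 / l * u powr (- l))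
        has_vector_derivative x powr (- l - 1)) (at x within {exp (- t)..1})"
      unfolding has_real_derivative_iff_has_vector_derivative[symmetric] using \<open>l \<noteq> 0\<close>
      by (auto intro!: derivative_eq_intros)
  qed (use t in simp)
  also have "(- 1 / l) * 1 powr (- l) - (- 1 / l) * exp (- t) powr (- l) = (exp (l * t) - 1) / l"
    by (simp add: powr_def diff_divide_distrib)
  finally have "has_bochner_integral half_line (\<lambda>u. indicator {exp (- t)..1} u * u powr (- l - 1))
      ((exp (l * t) - 1) / l)"
    by (intro has_bochner_integral_half_lineI) (auto intro: order_trans[OF exp_ge_zero])
  moreover have "AE u in half_line. u \<noteq> exp (- t)"
    by (rule AE_half_line_lborel[OF AE_lborel_singleton])
  then have "AE u in half_line. indicator {exp (- t)..1} u * u powr (- l - 1)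
      = avg_kernel \<mu> t u * u powr (- 1 / p)"
    by eventually_elim (auto simp: avg_kernel_def indicator_def l_def algebra_simps simp flip: powr_add)
  ultimately show ?thesis
    unfolding l_def[symmetric]
    by (subst (asm) has_bochner_integral_cong_AE) (auto intro!: borel_measurable_half_line)
qed

lemma
  assumes "\<mu> + 1 / p \<noteq> 0" "t > 0"
  shows lp_kernel_avg: "lp_kernel p (avg_kernel \<mu> t)"
    and kernel_norm_avg: "kernel_norm p (avg_kernel \<mu> t) = (exp ((\<mu> + 1 / p) * t) - 1) / (\<mu> + 1 / p)"
  using has_bochner_integral_avg_kernel[OF assms]
  by (auto simp: lp_kernel_def kernel_norm_def has_bochner_integral_iff avg_kernel_def
    intro!: borel_measurable_half_line)

lemma ek_kernel_1_dilate:
  assumes "t > 0" "v > 0"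
  shows "ek_kernel 1 \<mu> (exp t * v) = exp (- (\<mu> + 1) * t) * (ek_kernel 1 \<mu> v + avg_kernel \<mu> t v)"
proof -
  have "(exp t * v) powr (- \<mu> - 1) = exp (- (\<mu> + 1) * t) * v powr (- \<mu> - 1)"
    using assms by (simp add: powr_mult exp_powr_real algebra_simps)
  moreover have "1 < exp t * v \<longleftrightarrow> exp (- t) < v"
    by (simp add: exp_minus field_simps)
  moreover have "exp (- t) < v" if "v > 1"
    using assms that by (intro less_trans[OF _ that]) simp
  ultimately show ?thesis by (auto simp: ek_kernel_1 avg_kernel_def)
qed

context
  fixes p :: real
  assumes p: "p \<ge> 1"
begin

lemma resolvent_parameter_pos: "\<mu> \<ge> 0 \<Longrightarrow> \<mu> + 1 / p > 0"
  using p by (simp add: add_nonneg_pos)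

lemma lp_kernel_resolvent: "\<mu> \<ge> 0 \<Longrightarrow> lp_kernel p (ek_kernel 1 \<mu>)"
  using resolvent_parameter_pos[of \<mu>] by (intro lp_kernel_ek) auto

lemma lp_fun_resolvent: "\<mu> \<ge> 0 \<Longrightarrow> hfun p f \<Longrightarrow> hfun p (resolvent \<mu> f)"
  by (intro lp_fun_kernel_op p lp_kernel_resolvent)

lemma T_grp_resolvent:
  fixes K :: "real \<Rightarrow> complex"
  assumes \<mu>: "\<mu> \<ge> 0" and t: "t > 0" and K: "hfun p K"
  shows "AE s in half_line. T_grp p t (resolvent \<mu> K) s =
    complex_of_real (exp (- (\<mu> + 1 / p) * t)) * (resolvent \<mu> K s + kernel_op (avg_kernel \<mu> t) K s)"
proof -
  have "lp_kernel p (avg_kernel \<mu> t)" using resolvent_parameter_pos[OF \<mu>] t by (intro lp_kernel_avg) auto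
  from kernel_op_add_kernels[OF p lp_kernel_resolvent[OF \<mu>] this K] show ?thesis
  proof eventually_elim
    case (elim s)
    have "resolvent \<mu> K (exp (- t) * s)
        = (\<integral>u. ek_kernel 1 \<mu> (exp t * (exp (- t) * u)) *\<^sub>R K (s * (exp (- t) * u)) \<partial>half_line)"
      by (simp add: kernel_op_def mult_ac flip: exp_add)
    also have "\<dots> = exp t *\<^sub>R (\<integral>v. ek_kernel 1 \<mu> (exp t * v) *\<^sub>R K (s * v) \<partial>half_line)"
      using integral_half_line_scale[of "exp (- t)" "\<lambda>v. ek_kernel 1 \<mu> (exp t * v) *\<^sub>R K (s * v)"]
      by (simp add: exp_minus divide_inverse)
    also have "(\<integral>v. ek_kernel 1 \<mu> (exp t * v) *\<^sub>R K (s * v) \<partial>half_line)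
        = (\<integral>v. exp (- (\<mu> + 1) * t) *\<^sub>R ((ek_kernel 1 \<mu> v + avg_kernel \<mu> t v) *\<^sub>R K (s * v)) \<partial>half_line)"
      by (rule Bochner_Integration.integral_cong) (use t in \<open>auto simp: ek_kernel_1_dilate\<close>)
    also have "\<dots> = exp (- (\<mu> + 1) * t) *\<^sub>R (resolvent \<mu> K s + kernel_op (avg_kernel \<mu> t) K s)"
      unfolding integral_scaleR_right elim[symmetric] by (simp add: kernel_op_def)
    finally have "T_grp p t (resolvent \<mu> K) s
        = complex_of_real (exp (- t / p) * exp t * exp (- (\<mu> + 1) * t))
        * (resolvent \<mu> K s + kernel_op (avg_kernel \<mu> t) K s)"
      by (simp add: T_grp_def scaleR_conv_of_real mult_ac)
    also have "exp (- t / p) * exp t * exp (- (\<mu> + 1) * t) = exp (- (\<mu> + 1 / p) * t)"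
      by (simp add: algebra_simps flip: exp_add)
    finally show ?case .
  qed
qed

lemma lp_norm_kernel_op_approx_le:
  fixes K :: "real \<Rightarrow> complex"
  assumes k: "lp_kernel p k" and K: "hfun p K"
    and near: "\<And>u. u > 0 \<Longrightarrow> k u \<noteq> 0 \<Longrightarrow> hnorm p (\<lambda>s. T_grp p (- ln u) K s - K s) \<le> e"
  shows "hnorm p (\<lambda>s. kernel_op k K s - complex_of_real (kernel_norm p k) * K s) \<le> kernel_norm p k * e"
proof -
  note [measurable] = lp_fun_measurable[OF K] lp_kernelD(1)[OF k]
  define w where "w u = k u * u powr (- 1 / p)" for u
  have w: "integrable half_line w" using lp_kernelD(3)[OF k] by (simp add: w_def[abs_def])
  define F where "F s u = k u *\<^sub>R K (s * u) - w u *\<^sub>R K s" for s u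
  have F_eq: "F s u = w u *\<^sub>R (T_grp p (- ln u) K s - K s)" if "u > 0" for s u
  proof -
    have "u powr (- 1 / p) * u powr (1 / p) = 1" using that by (simp flip: powr_add)
    then show ?thesis
      using that by (simp add: F_def w_def T_grp_def powr_def scaleR_conv_of_real algebra_simps
        flip: of_real_mult)
  qed
  have meas: "(\<lambda>(s, u). F s u) \<in> borel_measurable (half_line \<Otimes>\<^sub>M half_line)"
    unfolding F_def w_def by measurable
  have bound: "hfun p (\<lambda>s. F s u) \<and> hnorm p (\<lambda>s. F s u) \<le> w u * e" if u: "u \<in> space half_line" for u
  proof
    have "w u \<ge> 0" using u lp_kernelD(2)[OF k] by (simp add: w_def)
    then have "w u * hnorm p (\<lambda>s. T_grp p (- ln u) K s - K s) \<le> w u * e"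
      using near[of u] u by (cases "k u = 0") (auto simp: w_def intro: mult_left_mono)
    then show "hnorm p (\<lambda>s. F s u) \<le> w u * e"
      using u \<open>w u \<ge> 0\<close> by (simp add: F_eq lp_norm_scaleR[OF p])
    show "hfun p (\<lambda>s. F s u)"
      using u by (simp add: F_eq lp_fun_scaleR lp_fun_diff[OF p lp_fun_T_grp[OF K] K])
  qed
  note minkowski = minkowski_integral[OF p sigma_finite_half_line sigma_finite_half_line meas
    integrable_mult_left[OF w] bound]
  have "AE s in half_line. (\<integral>u. F s u \<partial>half_line)
      = kernel_op k K s - complex_of_real (kernel_norm p k) * K s"
    using AE_integrable_kernel_op[OF p k K]
  proof eventually_elim
    case (elim s)
    then have "(\<integral>u. F s u \<partial>half_line)
        = (\<integral>u. k u *\<^sub>R K (s * u) \<partial>half_line) - (\<integral>u. w u \<partial>half_line) *\<^sub>R K s"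
      using w by (simp add: F_def)
    then show ?case by (simp add: kernel_op_def kernel_norm_def w_def scaleR_conv_of_real)
  qed
  then have "hnorm p (\<lambda>s. kernel_op k K s - complex_of_real (kernel_norm p k) * K s)
      = hnorm p (\<lambda>s. \<integral>u. F s u \<partial>half_line)"
    using lp_fun_kernel_op[OF p k K] minkowski(2)
    by (intro lp_norm_cong_AE) (auto dest: lp_fun_measurable)
  also have "\<dots> \<le> kernel_norm p k * e"
    using minkowski(3) by (simp add: kernel_norm_def w_def)
  finally show ?thesis .
qed

lemma avg_kernel_tendsto:
  fixes K :: "real \<Rightarrow> complex"
  assumes l: "\<mu> + 1 / p > 0" and K: "hfun p K"
  defines "m \<equiv> \<lambda>t. complex_of_real (kernel_norm p (avg_kernel \<mu> t))"
  shows "((\<lambda>t. hnorm p (\<lambda>s. kernel_op (avg_kernel \<mu> t) K s / m t - K s)) \<longlongrightarrow> 0) (at_right 0)"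
proof (rule tendstoI)
  fix e :: real assume e: "e > 0"
  have "\<forall>\<^sub>F r in at 0. hnorm p (\<lambda>s. T_grp p r K s - K s) < e / 2"
    using T_grp_strongly_continuous[OF p K] e by (intro order_tendstoD(2)) auto
  then obtain d where d: "d > 0" "\<And>r. r \<noteq> 0 \<Longrightarrow> \<bar>r\<bar> < d \<Longrightarrow> hnorm p (\<lambda>s. T_grp p r K s - K s) < e / 2"
    unfolding eventually_at by (auto simp: dist_real_def)
  have "hnorm p (\<lambda>s. kernel_op (avg_kernel \<mu> t) K s / m t - K s) \<le> e / 2" if t: "0 < t" "t < d" for t
  proof -
    have "hnorm p (\<lambda>s. T_grp p (- ln u) K s - K s) \<le> e / 2" if "u > 0" "avg_kernel \<mu> t u \<noteq> 0" for u
    proof (cases "u = 1")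
      case True
      then show ?thesis using e p by (simp add: T_grp_zero)
    next
      case False
      then have "exp (- t) < u" "u < 1" using that by (auto simp: avg_kernel_def split: if_splits)
      then have "ln u < 0" "- t < ln u" using that(1) ln_less_cancel_iff[of "exp (- t)" u] by auto
      then show ?thesis using d(2)[of "- ln u"] t by simp
    qed
    then have "hnorm p (\<lambda>s. kernel_op (avg_kernel \<mu> t) K s - m t * K s)
        \<le> kernel_norm p (avg_kernel \<mu> t) * (e / 2)"
      unfolding m_def using l t by (intro lp_norm_kernel_op_approx_le K lp_kernel_avg) auto
    moreover have pos: "kernel_norm p (avg_kernel \<mu> t) > 0"
      using l t by (simp add: kernel_norm_avg)
    moreover have "hnorm p (\<lambda>s. kernel_op (avg_kernel \<mu> t) K s - m t * K s)
        = kernel_norm p (avg_kernel \<mu> t) * hnorm p (\<lambda>s. kernel_op (avg_kernel \<mu> t) K s / m t - K s)"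
      using pos lp_norm_cmult[OF p, of half_line "m t" "\<lambda>s. kernel_op (avg_kernel \<mu> t) K s / m t - K s"]
      by (simp add: m_def right_diff_distrib)
    ultimately show ?thesis by simp
  qed
  then have "\<forall>\<^sub>F t in at_right 0. hnorm p (\<lambda>s. kernel_op (avg_kernel \<mu> t) K s / m t - K s) \<le> e / 2"
    using d(1) eventually_at_right_real[of 0 d] by (auto elim: eventually_mono)
  then show "\<forall>\<^sub>F t in at_right 0. dist (hnorm p (\<lambda>s. kernel_op (avg_kernel \<mu> t) K s / m t - K s)) 0 < e"
    by eventually_elim (use e in simp)
qed

lemma resolvent_generator_error_AE:
  fixes K :: "real \<Rightarrow> complex"
  assumes \<mu>: "\<mu> \<ge> 0" and t: "t > 0" and K: "hfun p K"
  defines "l \<equiv> \<mu> + 1 / p" and "m \<equiv> kernel_norm p (avg_kernel \<mu> t)"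
  defines "q \<equiv> (1 - exp (- l * t)) / t"
  shows "AE s in half_line.
      generator_error p (resolvent \<mu> K) (\<lambda>s. K s - complex_of_real l * resolvent \<mu> K s) t s
    = complex_of_real (l - q) * resolvent \<mu> K s + complex_of_real (q / l - 1) * K s
      + complex_of_real (q / l) * (kernel_op (avg_kernel \<mu> t) K s / complex_of_real m - K s)"
  using T_grp_resolvent[OF \<mu> t K]
proof eventually_elim
  case (elim s)
  have l: "l > 0" unfolding l_def by (rule resolvent_parameter_pos[OF \<mu>])
  have m: "m = (exp (l * t) - 1) / l" unfolding m_def l_def using l t
    by (intro kernel_norm_avg) (auto simp: l_def)
  have "m \<noteq> 0" using l t by (simp add: m)
  have "exp (- l * t) = 1 - q * t" using t by (simp add: q_def)
  moreover have "exp (- l * t) * m = q * t / l"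
    using t l by (simp add: m q_def right_diff_distrib flip: exp_add)
  moreover have "T_grp p t (resolvent \<mu> K) s = complex_of_real (exp (- l * t)) * resolvent \<mu> K s
      + complex_of_real (exp (- l * t) * m) * (kernel_op (avg_kernel \<mu> t) K s / complex_of_real m)"
    using elim \<open>m \<noteq> 0\<close> by (simp add: l_def distrib_left)
  ultimately have T_eq: "T_grp p t (resolvent \<mu> K) s = complex_of_real (1 - q * t) * resolvent \<mu> K s
      + complex_of_real (q * t / l) * (kernel_op (avg_kernel \<mu> t) K s / complex_of_real m)"
    by (simp only:)
  then show ?case
    unfolding generator_error_def T_eq using t
    by (simp add: add_divide_distrib diff_divide_distrib algebra_simps)
qed

lemma lp_norm_resolvent_generator_error_le:
  fixes K :: "real \<Rightarrow> complex"
  assumes \<mu>: "\<mu> \<ge> 0" and t: "t > 0" and K: "hfun p K"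
  defines "l \<equiv> \<mu> + 1 / p" and "m \<equiv> kernel_norm p (avg_kernel \<mu> t)"
  defines "q \<equiv> (1 - exp (- l * t)) / t"
  shows "hnorm p (generator_error p (resolvent \<mu> K) (\<lambda>s. K s - complex_of_real l * resolvent \<mu> K s) t)
    \<le> \<bar>l - q\<bar> * hnorm p (resolvent \<mu> K) + \<bar>q / l - 1\<bar> * hnorm p K
      + \<bar>q / l\<bar> * hnorm p (\<lambda>s. kernel_op (avg_kernel \<mu> t) K s / complex_of_real m - K s)"
proof -
  define D where "D s = kernel_op (avg_kernel \<mu> t) K s / complex_of_real m - K s" for s
  note G = lp_fun_resolvent[OF \<mu> K]
  have "lp_kernel p (avg_kernel \<mu> t)" using resolvent_parameter_pos[OF \<mu>] t by (intro lp_kernel_avg) auto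
  from lp_fun_diff[OF p lp_fun_cmult[OF lp_fun_kernel_op[OF p this K], of "1 / complex_of_real m"] K]
  have D: "hfun p D" by (simp add: D_def[abs_def])
  let ?R = "\<lambda>s. complex_of_real (l - q) * resolvent \<mu> K s + complex_of_real (q / l - 1) * K s"
  let ?S = "\<lambda>s. complex_of_real (q / l) * D s"
  have R: "hfun p ?R" and S: "hfun p ?S"
    by (intro lp_fun_add p lp_fun_cmult G K D)+
  have "hfun p (generator_error p (resolvent \<mu> K) (\<lambda>s. K s - complex_of_real l * resolvent \<mu> K s) t)"
    by (intro lp_fun_generator_error lp_fun_diff p lp_fun_cmult G K)
  then have "hnorm p (generator_error p (resolvent \<mu> K)
      (\<lambda>s. K s - complex_of_real l * resolvent \<mu> K s) t)
      = hnorm p (\<lambda>s. ?R s + ?S s)"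
    using resolvent_generator_error_AE[OF \<mu> t K] lp_fun_add[OF p R S]
    unfolding D_def q_def l_def m_def by (intro lp_norm_cong_AE lp_fun_measurable)
  also have "\<dots> \<le> hnorm p ?R + hnorm p ?S"
    by (intro lp_norm_triangle p R S)
  also have "hnorm p ?R \<le> hnorm p (\<lambda>s. complex_of_real (l - q) * resolvent \<mu> K s)
      + hnorm p (\<lambda>s. complex_of_real (q / l - 1) * K s)"
    by (intro lp_norm_triangle p lp_fun_cmult G K)
  finally show ?thesis unfolding lp_norm_cmult[OF p] norm_of_real D_def by simp
qed

proposition lp_generator_resolvent:
  fixes K :: "real \<Rightarrow> complex"
  assumes \<mu>: "\<mu> \<ge> 0" and K: "hfun p K"
  shows "lp_generator p (resolvent \<mu> K) (\<lambda>s. K s - complex_of_real (\<mu> + 1 / p) * resolvent \<mu> K s)"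
proof (rule lp_generatorI_right[OF p])
  define l where "l = \<mu> + 1 / p"
  have l: "l > 0" unfolding l_def by (rule resolvent_parameter_pos[OF \<mu>])
  define q where "q t = (1 - exp (- l * t)) / t" for t
  define D where "D t s
      = kernel_op (avg_kernel \<mu> t) K s / complex_of_real (kernel_norm p (avg_kernel \<mu> t)) - K s" for t s
  show "hfun p (resolvent \<mu> K)" by (rule lp_fun_resolvent[OF \<mu> K])
  then show "hfun p (\<lambda>s. K s - complex_of_real (\<mu> + 1 / p) * resolvent \<mu> K s)"
    by (intro lp_fun_diff p K lp_fun_cmult)
  have "((\<lambda>t. exp (- l * t)) has_real_derivative - l) (at 0)"
    by (auto intro!: derivative_eq_intros)
  then have "((\<lambda>t. - ((exp (- l * t) - 1) / t)) \<longlongrightarrow> - (- l)) (at 0)"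
    by (intro tendsto_minus) (simp add: has_field_derivative_iff)
  moreover have "q = (\<lambda>t. - ((exp (- l * t) - 1) / t))"
    by (auto simp: q_def minus_divide_left)
  ultimately have "(q \<longlongrightarrow> l) (at 0)" by simp
  then have q: "(q \<longlongrightarrow> l) (at_right 0)"
    by (rule tendsto_within_subset) simp
  have D: "((\<lambda>t. hnorm p (D t)) \<longlongrightarrow> 0) (at_right 0)"
    unfolding D_def using l by (intro avg_kernel_tendsto K) (simp add: l_def)
  let ?b = "\<lambda>t. \<bar>l - q t\<bar> * hnorm p (resolvent \<mu> K) + \<bar>q t / l - 1\<bar> * hnorm p K
      + \<bar>q t / l\<bar> * hnorm p (D t)"
  show "((\<lambda>t. hnorm p (generator_error p (resolvent \<mu> K)
      (\<lambda>s. K s - complex_of_real (\<mu> + 1 / p) * resolvent \<mu> K s) t)) \<longlongrightarrow> 0) (at_right 0)"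
  proof (rule tendsto_sandwich[OF _ _ tendsto_const])
    have "(?b \<longlongrightarrow> \<bar>l - l\<bar> * hnorm p (resolvent \<mu> K) + \<bar>l / l - 1\<bar> * hnorm p K + \<bar>l / l\<bar> * 0) (at_right 0)"
      using l by (intro tendsto_intros q D) auto
    then show "(?b \<longlongrightarrow> 0) (at_right 0)" using l by simp
    show "\<forall>\<^sub>F t in at_right 0.
        hnorm p (generator_error p (resolvent \<mu> K)
            (\<lambda>s. K s - complex_of_real (\<mu> + 1 / p) * resolvent \<mu> K s) t) \<le> ?b t"
      using lp_norm_resolvent_generator_error_le[OF \<mu> _ K] unfolding q_def l_def D_def
      by (simp add: eventually_at_filter)
  qed simp
qed

lemma resolvent_injective:
  fixes K :: "real \<Rightarrow> complex"
  assumes \<mu>: "\<mu> \<ge> 0" and K: "hfun p K" and zero: "hnorm p (resolvent \<mu> K) = 0"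
  shows "hnorm p K = 0"
proof -
  note G = lp_fun_resolvent[OF \<mu> K]
  have "AE s in half_line. resolvent \<mu> K s = 0" using zero lp_norm_eq_0_iff[OF p G] by simp
  moreover from this have "AE s in half_line. K s - complex_of_real (\<mu> + 1 / p) * resolvent \<mu> K s = K s"
    by eventually_elim simp
  moreover have zero_fun: "hfun p (\<lambda>s. 0 :: complex)" using lp_fun_cmult[OF K, of 0] by simp
  ultimately have "lp_generator p (\<lambda>s. 0) K"
    using lp_generator_cong_AE[OF p G lp_fun_diff[OF p K lp_fun_cmult[OF G]] zero_fun K]
      lp_generator_resolvent[OF \<mu> K] by blast
  then have "((\<lambda>t::real. hnorm p K) \<longlongrightarrow> 0) (at 0)"
    using lp_norm_cmult[OF p, of half_line "- 1" K]
    by (simp add: lp_generator_def generator_error_def[abs_def] T_grp_def)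
  then show ?thesis by (simp add: tendsto_const_iff)
qed

theorem lp_generator_iff_resolvent:
  fixes f g :: "real \<Rightarrow> complex"
  assumes \<mu>: "\<mu> \<ge> 0" and f: "hfun p f" and g: "hfun p g"
  shows "lp_generator p f g
      \<longleftrightarrow> (AE s in half_line. f s = resolvent \<mu> (\<lambda>s. g s + complex_of_real (\<mu> + 1 / p) * f s) s)"
proof -
  define l where "l = \<mu> + 1 / p"
  define K where "K s = g s + complex_of_real l * f s" for s
  define R where "R = resolvent \<mu> K"
  have K: "hfun p K" unfolding K_def by (intro lp_fun_add p g lp_fun_cmult f)
  have R: "hfun p R" unfolding R_def by (rule lp_fun_resolvent[OF \<mu> K])
  have gR: "hfun p (\<lambda>s. K s - complex_of_real l * R s)" by (intro lp_fun_diff p K lp_fun_cmult R)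
  have gen_R: "lp_generator p R (\<lambda>s. K s - complex_of_real l * R s)"
    using lp_generator_resolvent[OF \<mu> K] by (simp add: R_def l_def)
  have "lp_generator p f g \<longleftrightarrow> (AE s in half_line. f s = R s)"
  proof
    assume "lp_generator p f g"
    from lp_generator_diff[OF p f g R gR this gen_R]
    have "lp_generator p (\<lambda>s. f s - R s) (\<lambda>s. - complex_of_real l * (f s - R s))"
      by (simp add: K_def algebra_simps)
    then have "hnorm p (\<lambda>s. f s - R s) = 0"
      using resolvent_parameter_pos[OF \<mu>] unfolding l_def
      by (intro lp_generator_no_negative_eigenvalue[OF p lp_fun_diff[OF p f R]])
    then show "AE s in half_line. f s = R s" using lp_norm_diff_eq_0_iff[OF p f R] by simp
  next
    assume ae: "AE s in half_line. f s = R s"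
    then have "AE s in half_line. g s = K s - complex_of_real l * R s"
      by eventually_elim (simp add: K_def)
    then show "lp_generator p f g"
      using lp_generator_cong_AE[OF p f g R gR ae] gen_R by simp
  qed
  then show ?thesis by (simp add: R_def K_def[abs_def] l_def)
qed

end

section \<open>The composition law of the Erdelyi--Kober operators\<close>

lemma has_integral_Beta_interval:
  fixes a b c d :: real
  assumes a: "a > 0" and b: "b > 0" and cd: "c < d"
  shows "((\<lambda>u. (u - c) powr (a - 1) * (d - u) powr (b - 1))
      has_integral (d - c) powr (a + b - 1) * Beta a b) {c..d}"
proof -
  define m where "m = 1 / (d - c)"
  have m: "m > 0" using cd by (simp add: m_def)
  have "((\<lambda>t. t powr (a - 1) * (1 - t) powr (b - 1)) has_integral Beta a b) (cbox 0 1)"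
    using has_integral_Beta_real[OF a b] by simp
  note affine = has_integral_affinity'[OF this m, of "- (c * m)"]
  have "(0 - - (c * m)) /\<^sub>R m = c" "(1 - - (c * m)) /\<^sub>R m = d"
    "Beta a b /\<^sub>R m ^ DIM(real) = (d - c) * Beta a b"
    using cd by (simp_all add: m_def field_simps)
  with affine have "((\<lambda>u. (m * u - c * m) powr (a - 1) * (1 - (m * u - c * m)) powr (b - 1))
      has_integral (d - c) * Beta a b) {c..d}"
    by (simp only: real_scaleR_def cbox_interval diff_conv_add_uminus)
  then have
      "((\<lambda>u. (d - c) powr (a + b - 2) * ((m * u - c * m) powr (a - 1) * (1 - (m * u - c * m)) powr (b - 1)))
      has_integral (d - c) powr (a + b - 2) * ((d - c) * Beta a b)) {c..d}"
    by (rule has_integral_mult_right)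
  also have "(d - c) powr (a + b - 2) * ((d - c) * Beta a b) = (d - c) powr (a + b - 1) * Beta a b"
    using cd powr_add[of "d - c" "a + b - 2" 1] by (simp flip: mult.assoc)
  finally show ?thesis
  proof (rule has_integral_eq[rotated])
    fix u assume u: "u \<in> {c..d}"
    have "m * u - c * m = (u - c) / (d - c)" by (simp add: m_def diff_divide_distrib)
    moreover from this have "1 - (m * u - c * m) = (d - u) / (d - c)"
      using cd by (simp add: field_simps)
    moreover have "(d - c) powr (a + b - 2) = (d - c) powr (a - 1) * (d - c) powr (b - 1)"
      by (simp flip: powr_add)
    ultimately show
        "(d - c) powr (a + b - 2) * ((m * u - c * m) powr (a - 1) * (1 - (m * u - c * m)) powr (b - 1))
        = (u - c) powr (a - 1) * (d - u) powr (b - 1)"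
      using u cd by (simp add: powr_divide)
  qed
qed

lemma ek_kernel_mult_dilated:
  assumes u: "u > 0" and w: "w > 0"
  shows "ek_kernel a c u * ek_kernel b (a + c) (w / u) / u
    = w powr (- b - (a + c)) / (Gamma a * Gamma b)
        * (indicator {1..w} u * ((u - 1) powr (a - 1) * (w - u) powr (b - 1)))"
proof (cases "1 < u \<and> u < w")
  case True
  define C where "C = w powr (- b - (a + c)) / (Gamma a * Gamma b)"
  have "w / u - 1 = (w - u) / u" using u by (simp add: field_simps)
  then have "ek_kernel b (a + c) (w / u)
      = (w - u) powr (b - 1) * w powr (- b - (a + c))
          / (Gamma b * (u powr (b - 1) * u powr (- b - (a + c))))"
    using True u w by (simp add: ek_kernel_def powr_divide)
  then have "ek_kernel a c u * ek_kernel b (a + c) (w / u) / u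
      = C * ((u - 1) powr (a - 1) * (w - u) powr (b - 1))
      * (u powr (- a - c) / (u powr (b - 1) * u powr (- b - (a + c)) * u powr 1))"
    using True u by (simp add: ek_kernel_def[of a] C_def mult_ac)
  also have "u powr (b - 1) * u powr (- b - (a + c)) * u powr 1 = u powr (- a - c)"
    by (simp only: flip: powr_add) simp
  finally show ?thesis using True u by (simp add: C_def)
next
  case False
  then show ?thesis using u by (auto simp: ek_kernel_def less_divide_eq indicator_def)
qed

lemma ek_kernel_convolution:
  assumes a: "a > 0" and b: "b > 0" and w: "w > 0"
  shows "has_bochner_integral half_line
      (\<lambda>u. ek_kernel a c u * ek_kernel b (a + c) (w / u) / u)
      (ek_kernel (a + b) c w)"
proof (cases "w > 1")
  case False
  have "ek_kernel a c u * ek_kernel b (a + c) (w / u) / u = 0" if "u > 0" for u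
    using False that by (auto simp: ek_kernel_def less_divide_eq)
  then show ?thesis
    using False by (subst has_bochner_integral_cong[OF refl, where g = "\<lambda>_. 0" and y = 0])
      (auto simp: ek_kernel_def)
next
  case True
  have exponent: "- (a + b) - c = - b - (a + c)" by simp
  define C where "C = w powr (- b - (a + c)) / (Gamma a * Gamma b)"
  have Gamma_pos: "Gamma a > 0" "Gamma b > 0" using a b by (auto intro: Gamma_real_pos)
  have "has_bochner_integral half_line
      (\<lambda>u. C * (indicator {1..w} u * ((u - 1) powr (a - 1) * (w - u) powr (b - 1))))
      (C * ((w - 1) powr (a + b - 1) * Beta a b))"
    using a b True
    by (intro has_bochner_integral_mult_right has_bochner_integral_half_lineI has_integral_Beta_interval)
      auto
  also have "C * ((w - 1) powr (a + b - 1) * Beta a b) = ek_kernel (a + b) c w"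
    using True Gamma_pos unfolding ek_kernel_def exponent by (simp add: C_def Beta_def)
  finally show ?thesis
    by (rule has_bochner_integral_cong[OF refl _ refl, THEN iffD1, rotated])
      (use w in \<open>simp add: ek_kernel_mult_dilated C_def\<close>)
qed

definition weyl_inverse :: "real \<Rightarrow> (real \<Rightarrow> complex) \<Rightarrow> real \<Rightarrow> complex" where
  "weyl_inverse \<alpha> f = (if \<alpha> = 0 then f else erdelyi_kober \<alpha> 0 f)"

lemma weyl_inverse_T_grp: "weyl_inverse \<alpha> (T_grp p t f) = T_grp p t (weyl_inverse \<alpha> f)"
  by (auto simp: weyl_inverse_def kernel_op_T_grp)

context
  fixes p :: real
  assumes p: "p \<ge> 1"
begin

theorem erdelyi_kober_compose:
  assumes "a > 0" "b > 0" "c > - 1 / p" "hfun p f"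
  shows "AE t in half_line. erdelyi_kober a c (erdelyi_kober b (a + c) f) t
      = erdelyi_kober (a + b) c f t"
  using assms by (intro kernel_op_compose[OF p] lp_kernel_ek ek_kernel_convolution) auto

lemma lp_kernel_ek_nonneg: "b > 0 \<Longrightarrow> c \<ge> 0 \<Longrightarrow> lp_kernel p (ek_kernel b c)"
  using p by (intro lp_kernel_ek) (auto intro: less_le_trans[of _ 0])

lemma lp_fun_erdelyi_kober: "b > 0 \<Longrightarrow> c \<ge> 0 \<Longrightarrow> hfun p f \<Longrightarrow> hfun p (erdelyi_kober b c f)"
  by (intro lp_fun_kernel_op p lp_kernel_ek_nonneg)

lemma lp_norm_erdelyi_kober_compose:
  assumes "a > 0" "b > 0" "c \<ge> 0" "hfun p f"
  shows "hnorm p (erdelyi_kober a c (erdelyi_kober b (a + c) f)) = hnorm p (erdelyi_kober (a + b) c f)"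
proof (rule lp_norm_cong_AE)
  show "AE t in half_line. erdelyi_kober a c (erdelyi_kober b (a + c) f) t = erdelyi_kober (a + b) c f t"
    using assms p by (intro erdelyi_kober_compose) (auto intro: less_le_trans[of _ 0])
qed (use assms in \<open>auto intro!: lp_fun_measurable lp_fun_erdelyi_kober\<close>)

lemma erdelyi_kober_nat_injective:
  fixes f :: "real \<Rightarrow> complex"
  assumes "hfun p f" "hnorm p (erdelyi_kober (real (Suc n)) 0 f) = 0"
  shows "hnorm p f = 0"
  using assms
proof (induction n arbitrary: f)
  case 0
  then show ?case using resolvent_injective[OF p, of 0 f] by simp
next
  case (Suc n)
  let ?g = "resolvent (real (Suc n)) f"
  have g: "hfun p ?g" using Suc.prems(1) by (intro lp_fun_resolvent p) auto
  have "hnorm p (erdelyi_kober (real (Suc n)) 0 ?g) = hnorm p (erdelyi_kober (real (Suc n) + 1) 0 f)"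
    using lp_norm_erdelyi_kober_compose[of "real (Suc n)" 1 0 f] Suc.prems(1) by simp
  also have "\<dots> = 0" using Suc.prems(2) by (simp add: add.commute)
  finally have "hnorm p ?g = 0" by (rule Suc.IH[OF g])
  then show ?case by (intro resolvent_injective[OF p _ Suc.prems(1)]) auto
qed

lemma erdelyi_kober_injective:
  fixes f :: "real \<Rightarrow> complex"
  assumes \<alpha>: "\<alpha> > 0" and f: "hfun p f" and zero: "hnorm p (erdelyi_kober \<alpha> 0 f) = 0"
  shows "hnorm p f = 0"
proof -
  obtain n where n: "real (Suc n) > \<alpha>"
    using reals_Archimedean2[of \<alpha>] by (metis less_trans lessI of_nat_less_iff)
  define b where "b = real (Suc n) - \<alpha>"
  have b: "b > 0" using n by (simp add: b_def)
  have kernels: "lp_kernel p (ek_kernel \<alpha> 0)" "lp_kernel p (ek_kernel b \<alpha>)"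
    using \<alpha> b by (simp_all add: lp_kernel_ek_nonneg)
  have "hnorm p (erdelyi_kober (real (Suc n)) 0 f) = hnorm p (erdelyi_kober \<alpha> 0 (erdelyi_kober b \<alpha> f))"
    using lp_norm_erdelyi_kober_compose[OF \<alpha> b _ f, of 0] by (simp add: b_def)
  also have "\<dots> = hnorm p (erdelyi_kober b \<alpha> (erdelyi_kober \<alpha> 0 f))"
    using kernel_op_commute[OF p kernels f] \<alpha> b f
    by (intro lp_norm_cong_AE) (auto intro!: lp_fun_measurable lp_fun_erdelyi_kober)
  also have "\<dots> = 0"
    using lp_norm_kernel_op_le[OF p kernels(2), of "erdelyi_kober \<alpha> 0 f"]
      lp_fun_erdelyi_kober[OF \<alpha> _ f, of 0] zero
    by (intro antisym) auto
  finally show ?thesis by (rule erdelyi_kober_nat_injective[OF f])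
qed

context
  fixes \<alpha> :: real
  assumes \<alpha>: "\<alpha> \<ge> 0"
begin

lemma lp_fun_weyl_inverse: "hfun p f \<Longrightarrow> hfun p (weyl_inverse \<alpha> f)"
  using \<alpha> by (auto simp: weyl_inverse_def intro: lp_fun_erdelyi_kober)

lemma weyl_inverse_linear:
  assumes "hfun p f" "hfun p g"
  shows "AE s in half_line. weyl_inverse \<alpha> (\<lambda>s. f s + c * g s) s
      = weyl_inverse \<alpha> f s + c * weyl_inverse \<alpha> g s"
proof (cases "\<alpha> = 0")
  case False
  then have "lp_kernel p (ek_kernel \<alpha> 0)" using \<alpha> by (simp add: lp_kernel_ek_nonneg)
  from kernel_op_linear[OF p this assms] False show ?thesis by (simp add: weyl_inverse_def)
qed (simp add: weyl_inverse_def)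

lemma weyl_inverse_bounded:
  obtains B where "B \<ge> 0" "\<And>f. hfun p f \<Longrightarrow> hnorm p (weyl_inverse \<alpha> f) \<le> B * hnorm p f"
proof (cases "\<alpha> = 0")
  case True
  then show ?thesis by (intro that[of 1]) (auto simp: weyl_inverse_def)
next
  case False
  then have k: "lp_kernel p (ek_kernel \<alpha> 0)" using \<alpha> by (simp add: lp_kernel_ek_nonneg)
  show ?thesis
    using False kernel_norm_nonneg[OF k] lp_norm_kernel_op_le[OF p k]
    by (intro that[of "kernel_norm p (ek_kernel \<alpha> 0)"]) (auto simp: weyl_inverse_def)
qed

lemma weyl_inverse_injective: "hfun p f \<Longrightarrow> hnorm p (weyl_inverse \<alpha> f) = 0 \<Longrightarrow> hnorm p f = 0"
  using \<alpha> erdelyi_kober_injective[of \<alpha> f] by (auto simp: weyl_inverse_def split: if_splits)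

lemma weyl_inverse_erdelyi_kober:
  assumes "b > 0" "hfun p f"
  shows "AE s in half_line. weyl_inverse \<alpha> (erdelyi_kober b \<alpha> f) s = weyl_inverse (\<alpha> + b) f s"
proof (cases "\<alpha> = 0")
  case False
  have "1 / p > 0" using p by simp
  then have "AE s in half_line. erdelyi_kober \<alpha> 0 (erdelyi_kober b (\<alpha> + 0) f) s
      = erdelyi_kober (\<alpha> + b) 0 f s"
    using assms \<alpha> False by (intro erdelyi_kober_compose) auto
  then show ?thesis using assms(1) \<alpha> False by (simp add: weyl_inverse_def)
qed (use assms in \<open>simp add: weyl_inverse_def\<close>)

end

end

section \<open>Weighted Weyl derivatives in the Lebesgue space\<close>

definition has_weyl_deriv :: "real \<Rightarrow> real \<Rightarrow> (real \<Rightarrow> complex) \<Rightarrow> (real \<Rightarrow> complex) \<Rightarrow> bool" where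
  "has_weyl_deriv p \<alpha> f G \<longleftrightarrow> hfun p f \<and> hfun p G \<and> (AE s in half_line. f s = weyl_inverse \<alpha> G s)"

context
  fixes p \<alpha> :: real
  assumes p: "p \<ge> 1" and \<alpha>: "\<alpha> \<ge> 0"
begin

lemma has_weyl_deriv_lp_fun:
  assumes "has_weyl_deriv p \<alpha> f G"
  shows "hfun p f" "hfun p G"
  using assms by (auto simp: has_weyl_deriv_def)

lemma has_weyl_deriv_weyl_inverse: "hfun p G \<Longrightarrow> has_weyl_deriv p \<alpha> (weyl_inverse \<alpha> G) G"
  using lp_fun_weyl_inverse[OF p \<alpha>] by (simp add: has_weyl_deriv_def)

lemma has_weyl_deriv_linear:
  assumes "has_weyl_deriv p \<alpha> f F" "has_weyl_deriv p \<alpha> g G"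
  shows "has_weyl_deriv p \<alpha> (\<lambda>s. f s + c * g s) (\<lambda>s. F s + c * G s)"
proof -
  have "AE s in half_line. f s = weyl_inverse \<alpha> F s" "AE s in half_line. g s = weyl_inverse \<alpha> G s"
    using assms by (auto simp: has_weyl_deriv_def)
  then have "AE s in half_line. f s + c * g s = weyl_inverse \<alpha> (\<lambda>s. F s + c * G s) s"
    using weyl_inverse_linear[OF p \<alpha> has_weyl_deriv_lp_fun(2)[OF assms(1)]
      has_weyl_deriv_lp_fun(2)[OF assms(2)], of c]
    by eventually_elim simp
  then show ?thesis
    using assms by (auto simp: has_weyl_deriv_def intro: lp_fun_add p lp_fun_cmult)
qed

lemma has_weyl_deriv_diff:
  assumes "has_weyl_deriv p \<alpha> f F" "has_weyl_deriv p \<alpha> g G"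
  shows "has_weyl_deriv p \<alpha> (\<lambda>s. f s - g s) (\<lambda>s. F s - G s)"
  using has_weyl_deriv_linear[OF assms, of "- 1"] by simp

lemma has_weyl_deriv_T_grp:
  assumes "has_weyl_deriv p \<alpha> f G"
  shows "has_weyl_deriv p \<alpha> (T_grp p t f) (T_grp p t G)"
  using assms T_grp_cong_AE[OF p _ lp_fun_weyl_inverse[OF p \<alpha>], of f G t]
  by (auto simp: has_weyl_deriv_def weyl_inverse_T_grp intro: lp_fun_T_grp)

lemma has_weyl_deriv_generator_error:
  assumes "has_weyl_deriv p \<alpha> f F" "has_weyl_deriv p \<alpha> g G"
  shows "has_weyl_deriv p \<alpha> (generator_error p f g t) (generator_error p F G t)"
proof -
  have "has_weyl_deriv p \<alpha> (\<lambda>s. g s + - (1 / complex_of_real t) * (T_grp p t f s - f s))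
      (\<lambda>s. G s + - (1 / complex_of_real t) * (T_grp p t F s - F s))"
    by (intro has_weyl_deriv_linear has_weyl_deriv_diff has_weyl_deriv_T_grp assms)
  from has_weyl_deriv_linear[OF has_weyl_deriv_diff[OF this this] this, of "- 1"] show ?thesis
    by (simp add: generator_error_def[abs_def])
qed

lemma has_weyl_deriv_norm_le:
  obtains B where "B \<ge> 0" "\<And>f G. has_weyl_deriv p \<alpha> f G \<Longrightarrow> hnorm p f \<le> B * hnorm p G"
proof -
  obtain B where B: "B \<ge> 0" "\<And>G. hfun p G \<Longrightarrow> hnorm p (weyl_inverse \<alpha> G) \<le> B * hnorm p G"
    by (rule weyl_inverse_bounded[OF p \<alpha>]) blast
  have "hnorm p f \<le> B * hnorm p G" if G: "has_weyl_deriv p \<alpha> f G" for f G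
  proof -
    have "hnorm p f = hnorm p (weyl_inverse \<alpha> G)"
      using G lp_fun_weyl_inverse[OF p \<alpha>, of G]
      by (intro lp_norm_cong_AE) (auto simp: has_weyl_deriv_def dest: lp_fun_measurable)
    then show ?thesis using B(2) has_weyl_deriv_lp_fun[OF G] by simp
  qed
  with B(1) show thesis by (rule that)
qed

lemma has_weyl_deriv_unique:
  assumes F: "has_weyl_deriv p \<alpha> f F" and G: "has_weyl_deriv p \<alpha> f G"
  shows "AE s in half_line. F s = G s"
proof -
  note lp = has_weyl_deriv_lp_fun[OF F] has_weyl_deriv_lp_fun[OF G]
  have zero: "AE s in half_line. 0 = weyl_inverse \<alpha> (\<lambda>s. F s - G s) s"
    using has_weyl_deriv_diff[OF F G] by (simp add: has_weyl_deriv_def)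
  have "hnorm p (weyl_inverse \<alpha> (\<lambda>s. F s - G s)) = 0"
    using zero lp_norm_eq_0_iff[OF p lp_fun_weyl_inverse[OF p \<alpha> lp_fun_diff[OF p lp(2,4)]]] by simp
  then have "hnorm p (\<lambda>s. F s - G s) = 0"
    by (rule weyl_inverse_injective[OF p \<alpha> lp_fun_diff[OF p lp(2,4)]])
  then show ?thesis using lp_norm_diff_eq_0_iff[OF p lp(2,4)] by simp
qed

lemma has_weyl_deriv_limit:
  assumes \<phi>: "\<And>n. has_weyl_deriv p \<alpha> (\<phi> n) (\<Phi> n)" and f: "hfun p f" and G: "hfun p G"
    and lim: "(\<lambda>n. hnorm p (\<lambda>s. \<phi> n s - f s)) \<longlonglongrightarrow> 0" "(\<lambda>n. hnorm p (\<lambda>s. \<Phi> n s - G s)) \<longlonglongrightarrow> 0"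
  shows "has_weyl_deriv p \<alpha> f G"
proof -
  obtain B where B: "B \<ge> 0" "\<And>f G. has_weyl_deriv p \<alpha> f G \<Longrightarrow> hnorm p f \<le> B * hnorm p G"
    using has_weyl_deriv_norm_le by blast
  note G' = has_weyl_deriv_weyl_inverse[OF G]
  have "hnorm p (\<lambda>s. f s - weyl_inverse \<alpha> G s)
      \<le> hnorm p (\<lambda>s. \<phi> n s - f s) + B * hnorm p (\<lambda>s. \<Phi> n s - G s)" for n
    using B(2)[OF has_weyl_deriv_diff[OF \<phi>[of n] G']] lp_norm_minus_commute[of half_line p f "\<phi> n"]
      lp_norm_triangle_dist[OF p f has_weyl_deriv_lp_fun(1)[OF \<phi>[of n]] has_weyl_deriv_lp_fun(1)[OF G']]
        by simp
  moreover have "(\<lambda>n. hnorm p (\<lambda>s. \<phi> n s - f s) + B * hnorm p (\<lambda>s. \<Phi> n s - G s)) \<longlonglongrightarrow> 0 + B * 0"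
    by (intro tendsto_intros lim)
  ultimately have "hnorm p (\<lambda>s. f s - weyl_inverse \<alpha> G s) \<le> 0"
    by (intro LIMSEQ_le_const) auto
  then have "hnorm p (\<lambda>s. f s - weyl_inverse \<alpha> G s) = 0"
    using lp_norm_nonneg by (simp add: antisym)
  then show ?thesis
    using lp_norm_diff_eq_0_iff[OF p f has_weyl_deriv_lp_fun(1)[OF G']] f G
    by (simp add: has_weyl_deriv_def)
qed

lemma has_weyl_deriv_cong_AE:
  assumes "hfun p G" "hfun p G'" "AE s in half_line. G s = G' s"
  shows "has_weyl_deriv p \<alpha> f G \<longleftrightarrow> has_weyl_deriv p \<alpha> f G'"
proof -
  have "AE s in half_line. 0 = weyl_inverse \<alpha> (\<lambda>s. G s - G' s) s"
  proof -
    obtain B where B: "\<And>f. hfun p f \<Longrightarrow> hnorm p (weyl_inverse \<alpha> f) \<le> B * hnorm p f"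
      using weyl_inverse_bounded[OF p \<alpha>] by blast
    have "hnorm p (weyl_inverse \<alpha> (\<lambda>s. G s - G' s)) \<le> 0"
      using B[OF lp_fun_diff[OF p assms(1,2)]] lp_norm_diff_eq_0_iff[OF p assms(1,2)] assms(3) by simp
    then show ?thesis
      using lp_norm_eq_0_iff[OF p lp_fun_weyl_inverse[OF p \<alpha> lp_fun_diff[OF p assms(1,2)]]]
        lp_norm_nonneg
      by (force simp: antisym)
  qed
  then have "AE s in half_line. weyl_inverse \<alpha> G s = weyl_inverse \<alpha> G' s"
    using weyl_inverse_linear[OF p \<alpha> assms(1,2), of "- 1"] by eventually_elim simp
  then have "(AE s in half_line. f s = weyl_inverse \<alpha> G s)
      \<longleftrightarrow> (AE s in half_line. f s = weyl_inverse \<alpha> G' s)"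
    by (intro eventually_subst) (auto elim: eventually_mono)
  then show ?thesis using assms by (simp add: has_weyl_deriv_def)
qed

lemma has_weyl_deriv_add_order_iff:
  assumes "b > 0" "hfun p K"
  shows "has_weyl_deriv p (\<alpha> + b) f K \<longleftrightarrow> has_weyl_deriv p \<alpha> f (erdelyi_kober b \<alpha> K)"
proof -
  have "(AE s in half_line. f s = weyl_inverse (\<alpha> + b) K s)
      \<longleftrightarrow> (AE s in half_line. f s = weyl_inverse \<alpha> (erdelyi_kober b \<alpha> K) s)"
    using weyl_inverse_erdelyi_kober[OF p \<alpha> assms]
    by (intro eventually_subst) (auto elim: eventually_mono)
  then show ?thesis
    using assms \<alpha> lp_fun_erdelyi_kober[OF p assms(1) \<alpha> assms(2)] by (simp add: has_weyl_deriv_def)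
qed

end

section \<open>Schwartz functions on the half-line\<close>

lemma vderiv_cong_pos:
  assumes "\<And>s. s > 0 \<Longrightarrow> f s = g s" "t > 0"
  shows "vderiv f t = vderiv g t"
  unfolding vderiv_def
proof (rule vector_derivative_cong_eq)
  show "\<forall>\<^sub>F x in nhds t. x \<in> UNIV \<longrightarrow> f x = g x"
    using assms by (intro eventually_mono[OF eventually_nhds_in_open[of "{0<..}"]]) auto
qed auto

lemma vderiv_funpow_eqI:
  assumes F: "\<And>n t. t > 0 \<Longrightarrow> (F n has_vector_derivative F (Suc n) t) (at t)"
    and f: "\<And>t. t > 0 \<Longrightarrow> f t = F 0 t" and t: "t > 0"
  shows "(vderiv ^^ n) f t = F n t"
  using t
proof (induction n arbitrary: t)
  case (Suc n)
  have "(vderiv ^^ Suc n) f t = vderiv (F n) t"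
    using vderiv_cong_pos[of "(vderiv ^^ n) f" "F n" t] Suc by simp
  also have "\<dots> = F (Suc n) t" unfolding vderiv_def using F[OF Suc.prems] by (rule vector_derivative_at)
  finally show ?case .
qed (use f in simp)

lemma schwartz_plusI:
  assumes F: "\<And>n t. t > 0 \<Longrightarrow> (F n has_vector_derivative F (Suc n) t) (at t)"
    and f: "\<And>t. t > 0 \<Longrightarrow> f t = F 0 t"
    and lim: "\<And>n. \<exists>L. (F n \<longlongrightarrow> L) (at_right 0)"
    and bound: "\<And>n m. \<exists>C. \<forall>t>0. t ^ m * norm (F n t) \<le> C"
  shows "schwartz_plus f"
proof -
  have eq: "(vderiv ^^ n) f t = F n t" if "t > 0" for n t
    by (rule vderiv_funpow_eqI[OF F f that])
  have "((vderiv ^^ n) f has_vector_derivative (vderiv ^^ Suc n) f t) (at t)" if "t > 0" for n t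
    unfolding eq[OF that, of "Suc n"]
    by (rule has_vector_derivative_transform_within_open[OF F[OF that], of "{0<..}"])
      (use that eq in auto)
  moreover have "\<exists>L. ((vderiv ^^ n) f \<longlongrightarrow> L) (at_right 0)" for n
  proof -
    obtain L where "(F n \<longlongrightarrow> L) (at_right 0)" using lim by blast
    moreover have "\<forall>\<^sub>F t in at_right 0. F n t = (vderiv ^^ n) f t"
      by (rule eventually_mono[OF eventually_at_right_less[of "0::real"]]) (simp add: eq)
    ultimately show ?thesis using Lim_transform_eventually by blast
  qed
  ultimately show ?thesis using bound eq unfolding schwartz_plus_def by simp
qed

lemma schwartz_plus_has_vector_derivative:
  assumes "schwartz_plus f" "t > 0"
  shows "((vderiv ^^ n) f has_vector_derivative (vderiv ^^ Suc n) f t) (at t)"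
  using assms by (simp add: schwartz_plus_def)

lemma schwartz_plus_limit:
  assumes "schwartz_plus f" obtains L where "((vderiv ^^ n) f \<longlongrightarrow> L) (at_right 0)"
  using assms unfolding schwartz_plus_def by blast

lemma schwartz_plus_bound:
  assumes "schwartz_plus f" obtains C where "\<And>t. t > 0 \<Longrightarrow> t ^ m * norm ((vderiv ^^ n) f t) \<le> C"
  using assms unfolding schwartz_plus_def by blast

lemma schwartz_plus_vderiv_funpow:
  assumes "schwartz_plus f"
  shows "schwartz_plus ((vderiv ^^ k) f)"
proof (rule schwartz_plusI[where F = "\<lambda>n. (vderiv ^^ (n + k)) f"])
  show "((vderiv ^^ (n + k)) f has_vector_derivative (vderiv ^^ (Suc n + k)) f t) (at t)"
    if "t > 0" for n t
    using schwartz_plus_has_vector_derivative[OF assms that, of "n + k"] by simp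
  show "\<exists>L. ((vderiv ^^ (n + k)) f \<longlongrightarrow> L) (at_right 0)" for n
    using schwartz_plus_limit[OF assms] by blast
  show "\<exists>C. \<forall>t>0. t ^ m * norm ((vderiv ^^ (n + k)) f t) \<le> C" for n m
    using schwartz_plus_bound[OF assms, of m "n + k"] by blast
qed simp

lemma
  assumes f: "schwartz_plus f" and g: "schwartz_plus g"
  shows schwartz_plus_linear: "schwartz_plus (\<lambda>t. f t + c * g t)"
    and vderiv_funpow_linear: "t > 0 \<Longrightarrow> (vderiv ^^ n) (\<lambda>t. f t + c * g t) t
        = (vderiv ^^ n) f t + c * (vderiv ^^ n) g t"
proof -
  define F where "F n t = (vderiv ^^ n) f t + c * (vderiv ^^ n) g t" for n t
  have deriv: "(F n has_vector_derivative F (Suc n) t) (at t)" if "t > 0" for n t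
    unfolding F_def
    by (intro has_vector_derivative_add has_vector_derivative_mult_right
      schwartz_plus_has_vector_derivative f g that)
  have F_0: "f t + c * g t = F 0 t" for t by (simp add: F_def)
  show "(vderiv ^^ n) (\<lambda>t. f t + c * g t) t = (vderiv ^^ n) f t + c * (vderiv ^^ n) g t"
    if "t > 0" for t n
    using vderiv_funpow_eqI[OF deriv F_0 that] by (simp add: F_def)
  show "schwartz_plus (\<lambda>t. f t + c * g t)"
  proof (rule schwartz_plusI[where F = F])
    show "\<exists>L. (F n \<longlongrightarrow> L) (at_right 0)" for n
    proof -
      obtain L M where "((vderiv ^^ n) f \<longlongrightarrow> L) (at_right 0)" "((vderiv ^^ n) g \<longlongrightarrow> M) (at_right 0)"
        using schwartz_plus_limit[OF f] schwartz_plus_limit[OF g] by metis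
      then have "(F n \<longlongrightarrow> L + c * M) (at_right 0)" unfolding F_def by (intro tendsto_intros)
      then show ?thesis ..
    qed
    show "\<exists>C. \<forall>t>0. t ^ m * norm (F n t) \<le> C" for n m
    proof -
      obtain A B where A: "\<And>t. t > 0 \<Longrightarrow> t ^ m * norm ((vderiv ^^ n) f t) \<le> A"
        and B: "\<And>t. t > 0 \<Longrightarrow> t ^ m * norm ((vderiv ^^ n) g t) \<le> B"
        using schwartz_plus_bound[OF f, of m n] schwartz_plus_bound[OF g, of m n] by metis
      have "t ^ m * norm (F n t) \<le> A + norm c * B" if t: "t > 0" for t
      proof -
        have "norm (F n t) \<le> norm ((vderiv ^^ n) f t) + norm c * norm ((vderiv ^^ n) g t)"
          unfolding F_def by (rule order_trans[OF norm_triangle_ineq]) (simp add: norm_mult)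
        then have "t ^ m * norm (F n t)
            \<le> t ^ m * (norm ((vderiv ^^ n) f t) + norm c * norm ((vderiv ^^ n) g t))"
          using t by (intro mult_left_mono) auto
        also have "\<dots> = t ^ m * norm ((vderiv ^^ n) f t) + norm c * (t ^ m * norm ((vderiv ^^ n) g t))"
          by (simp add: algebra_simps)
        also have "\<dots> \<le> A + norm c * B" by (intro add_mono mult_left_mono A B t) simp
        finally show ?thesis .
      qed
      then show ?thesis by blast
    qed
  qed (use deriv F_0 in auto)
qed

lemma power_times_exp_le:
  fixes a t :: real
  assumes a: "a > 0" and t: "t \<ge> 0"
  shows "t ^ m * exp (- a * t) \<le> fact m / a ^ m"
proof -
  have "(a * t) ^ m /\<^sub>R fact m \<le> exp (a * t)"
    using summable_exp_generic[of "a * t"] a t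
    unfolding exp_def by (intro sum_le_suminf[of _ "{m}", simplified]) auto
  then have "t ^ m * a ^ m \<le> fact m * exp (a * t)"
    by (simp add: field_simps)
  then show ?thesis using a by (simp add: exp_minus field_simps)
qed

lemma exp_scaled_has_vector_derivative:
  "((\<lambda>t. complex_of_real (c * exp (- a * t)))
      has_vector_derivative complex_of_real ((- a) * c * exp (- a * t))) (at t)"
proof -
  have "((\<lambda>t. c * exp (- a * t)) has_real_derivative (- a) * c * exp (- a * t)) (at t)"
    by (auto intro!: derivative_eq_intros)
  then show ?thesis
    by (simp only: has_real_derivative_iff_has_vector_derivative has_vector_derivative_of_real)
qed

lemma
  shows vderiv_funpow_exp:
      "t > 0 \<Longrightarrow> (vderiv ^^ n) (\<lambda>t. complex_of_real (exp (- a * t))) t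
          = complex_of_real ((- a) ^ n * exp (- a * t))"
    and schwartz_plus_exp: "a > 0 \<Longrightarrow> schwartz_plus (\<lambda>t. complex_of_real (exp (- a * t)))"
proof -
  define F where "F n t = complex_of_real ((- a) ^ n * exp (- a * t))" for n t
  have deriv: "(F n has_vector_derivative F (Suc n) t) (at t)" for n t
    unfolding F_def power_Suc by (rule exp_scaled_has_vector_derivative)
  have F_0: "complex_of_real (exp (- a * t)) = F 0 t" for t by (simp add: F_def)
  show "(vderiv ^^ n) (\<lambda>t. complex_of_real (exp (- a * t))) t
      = complex_of_real ((- a) ^ n * exp (- a * t))" if "t > 0" for t n
    using vderiv_funpow_eqI[OF deriv F_0 that] by (simp only: F_def)
  show "schwartz_plus (\<lambda>t. complex_of_real (exp (- a * t)))" if a: "a > 0"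
  proof (rule schwartz_plusI[OF deriv F_0])
    have "(F n \<longlongrightarrow> F n 0) (at_right 0)" for n
      unfolding F_def by (intro tendsto_intros)
    then show "\<exists>L. (F n \<longlongrightarrow> L) (at_right 0)" for n by blast
    have "t ^ m * norm (F n t) \<le> a ^ n * (fact m / a ^ m)" if "t > 0" for n m t
      using mult_left_mono[OF power_times_exp_le[OF a, of t m], of "a ^ n"] a that
      unfolding F_def norm_of_real by (simp add: abs_mult power_abs mult_ac)
    then show "\<exists>C. \<forall>t>0. t ^ m * norm (F n t) \<le> C" for n m by blast
  qed
qed

lemma schwartz_plus_decay:
  assumes "schwartz_plus f"
  obtains C where "C \<ge> 0" "\<And>t. t > 0 \<Longrightarrow> norm (f t) \<le> C * (1 + t) powr (- real m)"
proof -
  obtain A B where A: "\<And>t. t > 0 \<Longrightarrow> t ^ 0 * norm ((vderiv ^^ 0) f t) \<le> A"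
    and B: "\<And>t. t > 0 \<Longrightarrow> t ^ m * norm ((vderiv ^^ 0) f t) \<le> B"
    using schwartz_plus_bound[OF assms, of 0 0] schwartz_plus_bound[OF assms, of m 0] by metis
  have "norm (f t) \<le> (2 ^ m * \<bar>A + B\<bar>) * (1 + t) powr (- real m)" if t: "t > 0" for t
  proof -
    have "(1 + t) ^ m \<le> (2 * max 1 t) ^ m" using t by (intro power_mono) auto
    also have "\<dots> \<le> 2 ^ m * (1 + t ^ m)"
      using t by (auto simp: power_mult_distrib max_def)
    finally have "(1 + t) ^ m * norm (f t) \<le> 2 ^ m * (1 + t ^ m) * norm (f t)"
      by (rule mult_right_mono) simp
    also have "\<dots> = 2 ^ m * (norm (f t) + t ^ m * norm (f t))" by (simp add: algebra_simps)
    also have "\<dots> \<le> 2 ^ m * \<bar>A + B\<bar>"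
      using A[OF t] B[OF t] by (intro mult_left_mono) auto
    finally show ?thesis using t by (simp add: powr_minus powr_realpow field_simps)
  qed
  then show ?thesis by (intro that[of "2 ^ m * \<bar>A + B\<bar>"]) auto
qed

lemma schwartz_plus_isCont: "schwartz_plus f \<Longrightarrow> t > 0 \<Longrightarrow> isCont f t"
  using has_vector_derivative_continuous[OF schwartz_plus_has_vector_derivative[of f t 0]] by simp

lemma schwartz_plus_measurable: "schwartz_plus f \<Longrightarrow> f \<in> borel_measurable half_line"
  using schwartz_plus_isCont
  by (intro continuous_on_borel_measurable_half_line continuous_at_imp_continuous_on) auto

lemma schwartz_plus_tendsto_0:
  assumes "schwartz_plus f" shows "(f \<longlongrightarrow> 0) at_top"
proof -
  obtain C where C: "C \<ge> 0" "\<And>t. t > 0 \<Longrightarrow> norm (f t) \<le> C * (1 + t) powr (- real 1)"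
    using schwartz_plus_decay[OF assms] by blast
  show ?thesis
  proof (rule Lim_null_comparison)
    show "\<forall>\<^sub>F t in at_top. norm (f t) \<le> C * (1 + t) powr (- real 1)"
      using C(2) by (intro eventually_mono[OF eventually_gt_at_top[of 0]])
    have "filterlim (\<lambda>t::real. 1 + t) at_top at_top"
      by (intro filterlim_tendsto_add_at_top[OF tendsto_const] filterlim_ident)
    from tendsto_neg_powr[OF _ this, of "- real 1"]
    show "((\<lambda>t. C * (1 + t) powr (- real 1)) \<longlongrightarrow> 0) at_top"
      by (intro tendsto_mult_right_zero) simp
  qed
qed

lemma lp_fun_power_times_schwartz_plus:
  assumes p: "p \<ge> 1" and f: "schwartz_plus f"
  shows "hfun p (\<lambda>s. complex_of_real ((- s) ^ m) * f s)"
proof -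
  obtain C where C: "C \<ge> 0" "\<And>t. t > 0 \<Longrightarrow> norm (f t) \<le> C * (1 + t) powr (- real (m + 2))"
    using schwartz_plus_decay[OF f] by blast
  show ?thesis
  proof (rule lp_fun_bound(1)[OF p])
    show "hfun p (\<lambda>s. C *\<^sub>R (1 + s) powr (- 2))"
      by (intro lp_fun_scaleR lp_fun_one_plus_powr p) simp
    show "(\<lambda>s. complex_of_real ((- s) ^ m) * f s) \<in> borel_measurable half_line"
      using schwartz_plus_measurable[OF f] by measurable
    show "AE s in half_line. norm (complex_of_real ((- s) ^ m) * f s) \<le> norm (C *\<^sub>R (1 + s) powr (- 2))"
    proof (rule AE_half_line)
      fix s :: real assume s: "s > 0"
      have "norm (complex_of_real ((- s) ^ m) * f s) \<le> (1 + s) ^ m * (C * (1 + s) powr (- real (m + 2)))"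
        using s C by (auto simp: norm_mult norm_power intro!: mult_mono power_mono)
      also have "\<dots> = C * ((1 + s) powr real m * (1 + s) powr (- real (m + 2)))"
        using s by (simp add: powr_realpow)
      also have "(1 + s) powr real m * (1 + s) powr (- real (m + 2)) = (1 + s) powr (- 2)"
        by (simp flip: powr_add)
      finally show "norm (complex_of_real ((- s) ^ m) * f s) \<le> norm (C *\<^sub>R (1 + s) powr (- 2))"
        using C by simp
    qed
  qed
qed

lemma lp_fun_schwartz_plus: "p \<ge> 1 \<Longrightarrow> schwartz_plus \<phi> \<Longrightarrow> hfun p \<phi>"
  using lp_fun_power_times_schwartz_plus[of p \<phi> 0] by simp

section \<open>Weyl integrals and derivatives of Schwartz functions\<close>

lemma has_vector_derivative_iff_quotient:
  "(f has_vector_derivative D) (at t within S) \<longleftrightarrow> ((\<lambda>s. (f s - f t) /\<^sub>R (s - t)) \<longlongrightarrow> D) (at t within S)"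
proof -
  have "(f has_vector_derivative D) (at t within S)
      \<longleftrightarrow> ((\<lambda>s. norm (f s - f t - (s - t) *\<^sub>R D) / norm (s - t)) \<longlongrightarrow> 0) (at t within S)"
    by (simp add: has_vector_derivative_def has_derivative_iff_norm bounded_linear_scaleR_left)
  also have "\<dots> \<longleftrightarrow> ((\<lambda>s. norm ((f s - f t) /\<^sub>R (s - t) - D)) \<longlongrightarrow> 0) (at t within S)"
  proof (rule filterlim_cong[OF refl refl])
    have "norm (f s - f t - (s - t) *\<^sub>R D) / norm (s - t) = norm ((f s - f t) /\<^sub>R (s - t) - D)"
      if "s \<noteq> t" for s
    proof -
      have "(f s - f t) /\<^sub>R (s - t) - D = (f s - f t - (s - t) *\<^sub>R D) /\<^sub>R (s - t)"
        using that by (simp add: scaleR_diff_right)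
      then show ?thesis by (simp only: norm_scaleR abs_inverse divide_inverse mult.commute real_norm_def)
    qed
    then show "\<forall>\<^sub>F s in at t within S. norm (f s - f t - (s - t) *\<^sub>R D) / norm (s - t)
        = norm ((f s - f t) /\<^sub>R (s - t) - D)"
      by (simp add: eventually_at_filter)
  qed
  also have "\<dots> \<longleftrightarrow> ((\<lambda>s. (f s - f t) /\<^sub>R (s - t)) \<longlongrightarrow> D) (at t within S)"
    unfolding tendsto_norm_zero_iff LIM_zero_iff ..
  finally show ?thesis .
qed

lemma norm_difference_quotient_le:
  assumes S: "convex S" "s \<in> S" "t \<in> S" "s \<noteq> t"
    and deriv: "\<And>r. r \<in> S \<Longrightarrow> (f has_vector_derivative f' r) (at r within S)"
    and bound: "\<And>r. r \<in> S \<Longrightarrow> norm (f' r) \<le> B"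
  shows "norm ((f s - f t) /\<^sub>R (s - t)) \<le> B"
proof -
  have "norm (f s - f t) \<le> B * norm (s - t)"
  proof (rule differentiable_bound[OF S(1), where f = f and f' = "\<lambda>r h. h *\<^sub>R f' r"])
    show "(f has_derivative (\<lambda>h. h *\<^sub>R f' r)) (at r within S)" if "r \<in> S" for r
      using deriv[OF that] by (simp add: has_vector_derivative_def)
    show "onorm (\<lambda>h. h *\<^sub>R f' r) \<le> B" if "r \<in> S" for r
    proof (rule onorm_bound)
      show "0 \<le> B" using norm_ge_zero bound[OF that] by (rule order_trans)
      show "norm (h *\<^sub>R f' r) \<le> B * norm h" for h
        using mult_left_mono[OF bound[OF that], of "\<bar>h\<bar>"] by (simp add: mult.commute)
    qed
  qed (use S in auto)
  moreover have "norm ((f s - f t) /\<^sub>R (s - t)) = norm (f s - f t) / norm (s - t)"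
    by (simp only: norm_scaleR abs_inverse divide_inverse mult.commute real_norm_def)
  ultimately show ?thesis using S(4) by (simp add: divide_le_eq)
qed

lemma has_vector_derivative_integral:
  fixes f :: "real \<Rightarrow> 'a \<Rightarrow> 'b::{banach, second_countable_topology}"
  assumes S: "open S" "convex S" "t \<in> S"
    and int: "\<And>s. s \<in> S \<Longrightarrow> integrable M (f s)"
    and deriv: "\<And>s x. s \<in> S \<Longrightarrow> x \<in> space M \<Longrightarrow> ((\<lambda>s. f s x) has_vector_derivative f' s x) (at s)"
    and bound: "\<And>s x. s \<in> S \<Longrightarrow> x \<in> space M \<Longrightarrow> norm (f' s x) \<le> g x"
    and g: "integrable M g"
  shows "((\<lambda>s. \<integral>x. f s x \<partial>M) has_vector_derivative (\<integral>x. f' t x \<partial>M)) (at t)"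
proof -
  define q where "q s x = (f s x - f t x) /\<^sub>R (s - t)" for s x
  have q_int: "integrable M (q s)" if "s \<in> S" for s
    unfolding q_def using Bochner_Integration.integrable_diff[OF int[OF that] int[OF S(3)]] by simp
  have q_lim: "((\<lambda>s. q s x) \<longlongrightarrow> f' t x) (at t within S)" if "x \<in> space M" for x
    using has_vector_derivative_at_within[OF deriv[OF S(3) that], of S]
    by (simp add: has_vector_derivative_iff_quotient q_def)
  have q_bound: "norm (q s x) \<le> g x" if "s \<in> S - {t}" "x \<in> space M" for s x
    unfolding q_def using that S
    by (intro norm_difference_quotient_le[of S s t "\<lambda>s. f s x"
      "\<lambda>s. f' s x"] bound has_vector_derivative_at_within[OF deriv])
      auto
  have "((\<lambda>s. \<integral>x. q s x \<partial>M) \<longlongrightarrow> (\<integral>x. f' t x \<partial>M)) (at t within S)"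
    unfolding tendsto_at_iff_sequentially o_def
  proof (intro allI impI)
    fix X :: "nat \<Rightarrow> real" assume X_in: "\<forall>i. X i \<in> S - {t}" and X_lim: "X \<longlonglongrightarrow> t"
    have X: "X i \<in> S - {t}" for i using X_in by simp
    have lim: "(\<lambda>i. q (X i) x) \<longlonglongrightarrow> f' t x" if "x \<in> space M" for x
      using q_lim[OF that, unfolded tendsto_at_iff_sequentially o_def] X_in X_lim by simp
    have meas: "q (X i) \<in> borel_measurable M" for i
      using X[of i] by (intro borel_measurable_integrable q_int) simp
    show "(\<lambda>i. \<integral>x. q (X i) x \<partial>M) \<longlonglongrightarrow> (\<integral>x. f' t x \<partial>M)"
    proof (rule integral_dominated_convergence[where f = "f' t" and s = "\<lambda>i. q (X i)", OF _ meas g])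
      show "f' t \<in> borel_measurable M" by (rule borel_measurable_LIMSEQ_metric[OF meas lim])
      show "AE x in M. (\<lambda>i. q (X i) x) \<longlonglongrightarrow> f' t x" using lim by (rule AE_I2)
      show "AE x in M. norm (q (X i) x) \<le> g x" for i by (intro AE_I2 q_bound X)
    qed
  qed
  moreover have "(\<integral>x. q s x \<partial>M) = ((\<integral>x. f s x \<partial>M) - (\<integral>x. f t x \<partial>M)) /\<^sub>R (s - t)" if "s \<in> S" for s
    unfolding q_def using int[OF that] int[OF S(3)] by simp
  then have "\<forall>\<^sub>F s in at t within S. (\<integral>x. q s x \<partial>M) = ((\<integral>x. f s x \<partial>M) - (\<integral>x. f t x \<partial>M)) /\<^sub>R (s - t)"
    by (simp add: eventually_at_filter)
  ultimately have "((\<lambda>s. ((\<integral>x. f s x \<partial>M) - (\<integral>x. f t x \<partial>M)) /\<^sub>R (s - t))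
      \<longlongrightarrow> (\<integral>x. f' t x \<partial>M)) (at t within S)"
    by (rule Lim_transform_eventually)
  then show ?thesis
    unfolding has_vector_derivative_iff_quotient at_within_open[OF S(3,1)] .
qed

lemma integral_half_line_FTC:
  fixes F f :: "real \<Rightarrow> 'b::euclidean_space"
  assumes F: "\<And>s. s \<ge> t \<Longrightarrow> (F has_vector_derivative f s) (at s)" and f: "\<And>s. s > t \<Longrightarrow> isCont f s"
    and int: "integrable half_line (\<lambda>x. f (t + x))" and lim: "(F \<longlongrightarrow> 0) at_top" and t: "t \<ge> 0"
  shows "(\<integral>x. f (t + x) \<partial>half_line) = - F t"
proof -
  have eq: "(\<lambda>s. indicator {0<..} s *\<^sub>R indicator {t<..} s *\<^sub>R f s) = (\<lambda>s. indicator {t<..} s *\<^sub>R f s)"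
    using t by (auto simp: indicator_def)
  have "(LBINT s=ereal t..\<infinity>. f s) = 0 - F t"
  proof (rule interval_integral_FTC_integrable)
    have "integrable half_line (\<lambda>s. indicator {t<..} s *\<^sub>R f s)"
      using int t by (subst (asm) integrable_half_line_shift_iff) auto
    then show "set_integrable lborel (einterval (ereal t) \<infinity>) f"
      by (simp add: integrable_half_line set_integrable_def eq del: scaleR_scaleR)
    have "(F \<longlongrightarrow> F t) (at t)"
      using has_vector_derivative_continuous[OF F[OF order_refl]] by (simp add: continuous_at)
    then have "(F \<longlongrightarrow> F t) (at_right t)"
      by (rule tendsto_within_subset) simp
    then show "((F \<circ> real_of_ereal) \<longlongrightarrow> F t) (at_right (ereal t))"
      by (simp add: ereal_tendsto_simps)
    show "((F \<circ> real_of_ereal) \<longlongrightarrow> 0) (at_left \<infinity>)"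
      using lim by (simp add: ereal_tendsto_simps)
  qed (use F f in auto)
  moreover have "(LBINT s=ereal t..\<infinity>. f s) = (\<integral>x. f (t + x) \<partial>half_line)"
    unfolding integral_half_line_shift[OF t] integral_half_line
    by (simp add: interval_lebesgue_integral_def set_lebesgue_integral_def eq del: scaleR_scaleR)
  ultimately show ?thesis by simp
qed

lemma weyl_int_half_line: "weyl_int \<beta> \<psi> t
    = (1 / Gamma \<beta>) *\<^sub>R (\<integral>x. x powr (\<beta> - 1) *\<^sub>R \<psi> (t + x) \<partial>half_line)"
proof -
  have "(LINT s:{t..}|lborel. complex_of_real ((s - t) powr (\<beta> - 1)) * \<psi> s) =
     \<bar>1\<bar> *\<^sub>R (\<integral>x. indicator {t..} (t + 1 * x)
         *\<^sub>R (complex_of_real ((t + 1 * x - t) powr (\<beta> - 1)) * \<psi> (t + 1 * x)) \<partial>lborel)"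
    unfolding set_lebesgue_integral_def by (rule lborel_integral_real_affine) simp
  also have "\<dots> = (\<integral>x. indicator {0<..} x *\<^sub>R (x powr (\<beta> - 1) *\<^sub>R \<psi> (t + x)) \<partial>lborel)"
    unfolding abs_one scaleR_one
    by (rule Bochner_Integration.integral_cong) (auto simp: indicator_def scaleR_conv_of_real)
  finally show ?thesis
    by (simp add: weyl_int_def integral_half_line set_lebesgue_integral_def scaleR_conv_of_real)
qed

lemma weyl_int_cong_pos:
  assumes "\<And>s. s > 0 \<Longrightarrow> f s = g s" "t \<ge> 0"
  shows "weyl_int \<beta> f t = weyl_int \<beta> g t"
  unfolding weyl_int_half_line
  by (intro arg_cong2[where f = scaleR] refl Bochner_Integration.integral_cong) (use assms in auto)

lemma weyl_int_cmult: "weyl_int \<beta> (\<lambda>s. c * \<psi> s) t = c * weyl_int \<beta> \<psi> t"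
  by (simp add: weyl_int_half_line mult_scaleR_right[symmetric] del: mult_scaleR_right)

lemma weyl_int_erdelyi_kober:
  assumes t: "t > 0"
  shows "t powr c *\<^sub>R weyl_int b \<psi> t = erdelyi_kober b c (\<lambda>s. s powr (b + c) *\<^sub>R \<psi> s) t"
proof -
  define h where "h s = ek_kernel b c (s / t) *\<^sub>R s powr (b + c) *\<^sub>R \<psi> s" for s
  have "erdelyi_kober b c (\<lambda>s. s powr (b + c) *\<^sub>R \<psi> s) t = (\<integral>u. h (t * u) \<partial>half_line)"
    unfolding kernel_op_def h_def by (rule Bochner_Integration.integral_cong) (use t in auto)
  also have "\<dots> = (1 / t) *\<^sub>R (\<integral>s. h s \<partial>half_line)"
    by (rule integral_half_line_scale[OF t])
  also have "(\<integral>s. h s \<partial>half_line) = (\<integral>s. indicator {t<..} s *\<^sub>R h s \<partial>half_line)"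
    by (rule Bochner_Integration.integral_cong)
      (use t in \<open>auto simp: h_def ek_kernel_def indicator_def less_divide_eq\<close>)
  also have "\<dots> = (\<integral>x. h (t + x) \<partial>half_line)"
    using t by (intro integral_half_line_shift[symmetric]) simp
  also have "\<dots> = (\<integral>x. (t powr (c + 1) / Gamma b) *\<^sub>R x powr (b - 1) *\<^sub>R \<psi> (t + x) \<partial>half_line)"
  proof (rule Bochner_Integration.integral_cong[OF refl])
    fix x assume "x \<in> space half_line"
    then have x: "x > 0" by simp
    have "(t + x) / t - 1 = x / t" using t by (simp add: field_simps)
    then have "ek_kernel b c ((t + x) / t) * (t + x) powr (b + c)
        = (x / t) powr (b - 1) * (((t + x) / t) powr (- b - c) * (t + x) powr (b + c)) / Gamma b"
      using t x by (simp add: ek_kernel_def)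
    also have "((t + x) / t) powr (- b - c) * (t + x) powr (b + c) = t powr (b + c)"
      using t x powr_minus[of "t + x" "b + c"] powr_minus[of t "b + c"]
      by (simp add: powr_divide) (simp add: field_simps)
    also have "(x / t) powr (b - 1) * t powr (b + c) / Gamma b
        = t powr (c + 1) / Gamma b * x powr (b - 1)"
      using t x powr_add[of t "b - 1" "c + 1"] by (simp add: powr_divide)
    finally show "h (t + x) = (t powr (c + 1) / Gamma b) *\<^sub>R x powr (b - 1) *\<^sub>R \<psi> (t + x)"
      by (simp only: h_def scaleR_scaleR)
  qed
  also have "(1 / t) *\<^sub>R \<dots> = (t powr c / Gamma b) *\<^sub>R (\<integral>x. x powr (b - 1) *\<^sub>R \<psi> (t + x) \<partial>half_line)"
    using t unfolding integral_scaleR_right by (simp add: powr_add)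
  finally show ?thesis
    by (simp add: weyl_int_half_line)
qed

lemma weyl_int_integrand_dominated:
  assumes \<beta>: "\<beta> > 0" and \<psi>: "schwartz_plus \<psi>"
  obtains g where "integrable half_line g"
    "\<And>t x. t \<ge> 0 \<Longrightarrow> x > 0 \<Longrightarrow> norm (x powr (\<beta> - 1) *\<^sub>R \<psi> (t + x)) \<le> g x"
proof -
  obtain m :: nat where m: "\<beta> < real m" using reals_Archimedean2 by blast
  obtain C where C: "C \<ge> 0" "\<And>t. t > 0 \<Longrightarrow> norm (\<psi> t) \<le> C * (1 + t) powr (- real m)"
    using schwartz_plus_decay[OF \<psi>] by blast
  show thesis
  proof
    show "integrable half_line (\<lambda>x. C * (x powr (\<beta> - 1) * (1 + x) powr (- real m)))"
      by (intro integrable_mult_right integrable_half_line_powr_powr) (use \<beta> m in auto)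
    fix t x :: real assume t: "t \<ge> 0" and x: "x > 0"
    have "norm (\<psi> (t + x)) \<le> C * (1 + (t + x)) powr (- real m)" using C(2)[of "t + x"] x t by simp
    also have "\<dots> \<le> C * (1 + x) powr (- real m)"
      using C x t by (intro mult_left_mono powr_mono2') auto
    finally have "x powr (\<beta> - 1) * norm (\<psi> (t + x)) \<le> x powr (\<beta> - 1) * (C * (1 + x) powr (- real m))"
      by (rule mult_left_mono) simp
    then show "norm (x powr (\<beta> - 1) *\<^sub>R \<psi> (t + x)) \<le> C * (x powr (\<beta> - 1) * (1 + x) powr (- real m))"
      by (simp add: mult_ac)
  qed
qed

lemma integrable_weyl_int:
  assumes \<beta>: "\<beta> > 0" and \<psi>: "schwartz_plus \<psi>" and t: "t \<ge> 0"
  shows "integrable half_line (\<lambda>x. x powr (\<beta> - 1) *\<^sub>R \<psi> (t + x))"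
proof -
  obtain g where g: "integrable half_line g"
    "\<And>t x. t \<ge> 0 \<Longrightarrow> x > 0 \<Longrightarrow> norm (x powr (\<beta> - 1) *\<^sub>R \<psi> (t + x)) \<le> g x"
    by (rule weyl_int_integrand_dominated[OF \<beta> \<psi>]) blast
  have [measurable]: "(\<lambda>x. \<psi> (t + x)) \<in> borel_measurable half_line"
    by (rule measurable_compose[OF half_line_shift[OF t] schwartz_plus_measurable[OF \<psi>]])
  show ?thesis
    by (rule Bochner_Integration.integrable_bound[OF g(1)])
      (use g(2)[OF t] in \<open>auto intro!: AE_half_line intro: order_trans[OF _ abs_ge_self]\<close>)
qed

lemma weyl_int_linear:
  assumes "\<beta> > 0" "schwartz_plus \<phi>" "schwartz_plus \<psi>" "t \<ge> 0"
  shows "weyl_int \<beta> (\<lambda>s. \<phi> s + c * \<psi> s) t = weyl_int \<beta> \<phi> t + c * weyl_int \<beta> \<psi> t"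
proof -
  have "(\<integral>x. x powr (\<beta> - 1) *\<^sub>R (\<phi> (t + x) + c * \<psi> (t + x)) \<partial>half_line)
      = (\<integral>x. x powr (\<beta> - 1) *\<^sub>R \<phi> (t + x) + c * (x powr (\<beta> - 1) *\<^sub>R \<psi> (t + x)) \<partial>half_line)"
    by (simp add: scaleR_add_right)
  also have "\<dots> = (\<integral>x. x powr (\<beta> - 1) *\<^sub>R \<phi> (t + x) \<partial>half_line)
      + c * (\<integral>x. x powr (\<beta> - 1) *\<^sub>R \<psi> (t + x) \<partial>half_line)"
    using integrable_weyl_int[OF assms(1,2,4)] integrable_weyl_int[OF assms(1,3,4)]
    by (subst Bochner_Integration.integral_add) (auto simp del: mult_scaleR_right)
  finally show ?thesis by (simp add: weyl_int_half_line scaleR_add_right)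
qed

lemma weyl_int_has_vector_derivative:
  assumes \<beta>: "\<beta> > 0" and \<psi>: "schwartz_plus \<psi>" and t: "t > 0"
  shows "(weyl_int \<beta> \<psi> has_vector_derivative weyl_int \<beta> (vderiv \<psi>) t) (at t)"
proof -
  have \<psi>': "schwartz_plus (vderiv \<psi>)" using schwartz_plus_vderiv_funpow[OF \<psi>, of 1] by simp
  obtain g where g: "integrable half_line g"
    "\<And>t x. t \<ge> 0 \<Longrightarrow> x > 0 \<Longrightarrow> norm (x powr (\<beta> - 1) *\<^sub>R vderiv \<psi> (t + x)) \<le> g x"
    by (rule weyl_int_integrand_dominated[OF \<beta> \<psi>']) blast
  have "((\<lambda>s. \<integral>x. x powr (\<beta> - 1) *\<^sub>R \<psi> (s + x) \<partial>half_line)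
      has_vector_derivative (\<integral>x. x powr (\<beta> - 1) *\<^sub>R vderiv \<psi> (t + x) \<partial>half_line)) (at t)"
  proof (rule has_vector_derivative_integral[where S = "{0<..}" and g = g])
    show "((\<lambda>s. x powr (\<beta> - 1) *\<^sub>R \<psi> (s + x))
        has_vector_derivative x powr (\<beta> - 1) *\<^sub>R vderiv \<psi> (s + x)) (at s)"
      if "s \<in> {0<..}" "x \<in> space half_line" for s x
    proof -
      have "(\<psi> has_vector_derivative vderiv \<psi> (s + x)) (at (s + x))"
        using schwartz_plus_has_vector_derivative[OF \<psi>, of "s + x" 0] that by simp
      moreover have "((\<lambda>s. s + x) has_vector_derivative 1) (at s)"
        by (auto intro!: derivative_eq_intros)
      ultimately have "((\<lambda>s. \<psi> (s + x)) has_vector_derivative vderiv \<psi> (s + x)) (at s)"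
        using vector_diff_chain_at[of "\<lambda>s. s + x" 1 s \<psi>] by (simp add: o_def)
      then show ?thesis by (rule bounded_linear.has_vector_derivative[OF bounded_linear_scaleR_right])
    qed
  qed (use integrable_weyl_int[OF \<beta> \<psi>] g t in auto)
  then show ?thesis
    unfolding weyl_int_half_line[abs_def]
    by (rule bounded_linear.has_vector_derivative[OF bounded_linear_scaleR_right])
qed

lemma vderiv_funpow_weyl_int:
  assumes \<beta>: "\<beta> > 0" and \<psi>: "schwartz_plus \<psi>" and t: "t > 0"
  shows "(vderiv ^^ n) (weyl_int \<beta> \<psi>) t = weyl_int \<beta> ((vderiv ^^ n) \<psi>) t"
proof (rule vderiv_funpow_eqI[where F = "\<lambda>n. weyl_int \<beta> ((vderiv ^^ n) \<psi>)"])
  show "(weyl_int \<beta> ((vderiv ^^ n) \<psi>) has_vector_derivative weyl_int \<beta> ((vderiv ^^ Suc n) \<psi>) s) (at s)"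
    if "s > 0" for n s
    unfolding funpow.simps(2) comp_apply
    by (intro weyl_int_has_vector_derivative \<beta> schwartz_plus_vderiv_funpow \<psi> that)
qed (use t in simp_all)

lemma weyl_int_1_vderiv:
  assumes \<psi>: "schwartz_plus \<psi>" and t: "t > 0"
  shows "weyl_int 1 (vderiv \<psi>) t = - \<psi> t"
proof -
  have \<psi>': "schwartz_plus (vderiv \<psi>)" using schwartz_plus_vderiv_funpow[OF \<psi>, of 1] by simp
  have one: "x powr (1 - 1) *\<^sub>R vderiv \<psi> (t + x) = vderiv \<psi> (t + x)" if "x \<in> space half_line" for x
    using that by simp
  have int: "integrable half_line (\<lambda>x. vderiv \<psi> (t + x))"
    using integrable_weyl_int[OF _ \<psi>', of 1 t] t one
    by (subst Bochner_Integration.integrable_cong[OF refl one[symmetric]]) auto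
  have "weyl_int 1 (vderiv \<psi>) t = (\<integral>x. vderiv \<psi> (t + x) \<partial>half_line)"
    unfolding weyl_int_half_line by (subst Bochner_Integration.integral_cong[OF refl one]) auto
  also have "\<dots> = - \<psi> t"
  proof (rule integral_half_line_FTC[OF _ _ int schwartz_plus_tendsto_0[OF \<psi>]])
    show "(\<psi> has_vector_derivative vderiv \<psi> s) (at s)" if "s \<ge> t" for s
      using schwartz_plus_has_vector_derivative[OF \<psi>, of s 0] t that by simp
    show "isCont (vderiv \<psi>) s" if "s > t" for s
      using schwartz_plus_isCont[OF \<psi>'] t that by simp
  qed (use t in simp)
  finally show ?thesis .
qed

definition weyl_order :: "real \<Rightarrow> nat" where
  "weyl_order \<alpha> = nat \<lfloor>\<alpha>\<rfloor> + 1"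

lemma weyl_order_bounds:
  assumes "\<alpha> \<ge> 0"
  shows "\<alpha> < real (weyl_order \<alpha>)" "0 < weyl_order \<alpha>"
proof -
  have "real (nat \<lfloor>\<alpha>\<rfloor>) = real_of_int \<lfloor>\<alpha>\<rfloor>" using assms by simp
  then show "\<alpha> < real (weyl_order \<alpha>)" "0 < weyl_order \<alpha>"
    unfolding weyl_order_def by linarith+
qed

lemma weyl_deriv_eq_weyl_int:
  assumes \<alpha>: "\<alpha> \<ge> 0" and \<phi>: "schwartz_plus \<phi>" and t: "t > 0"
  shows "weyl_deriv \<alpha> \<phi> t
      = (- 1) ^ weyl_order \<alpha> * weyl_int (real (weyl_order \<alpha>) - \<alpha>) ((vderiv ^^ weyl_order \<alpha>) \<phi>) t"
proof (cases "\<alpha> = 0")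
  case True
  then show ?thesis using weyl_int_1_vderiv[OF \<phi> t] by (simp add: weyl_deriv_def weyl_order_def)
next
  case False
  then show ?thesis
    using weyl_order_bounds(1)[OF \<alpha>] unfolding weyl_deriv_def Let_def weyl_order_def[symmetric]
    by (simp add: vderiv_funpow_weyl_int[OF _ \<phi> t])
qed

lemma weyl_int_exp:
  assumes \<beta>: "\<beta> > 0" and a: "a > 0"
  shows "weyl_int \<beta> (\<lambda>s. complex_of_real (exp (- a * s))) t
      = complex_of_real (a powr (- \<beta>) * exp (- a * t))"
proof -
  have "has_bochner_integral half_line (\<lambda>x. indicator {0..} x * (x powr (\<beta> - 1) / exp x))
      (a *\<^sub>R (Gamma \<beta> / a))"
    using a has_bochner_integral_half_lineI[OF _ _ Gamma_integral_real[OF \<beta>]] by simp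
  then have "has_bochner_integral half_line
      (\<lambda>x. indicator {0..} (a * x) * ((a * x) powr (\<beta> - 1) / exp (a * x)))
      (Gamma \<beta> / a)"
    using a by (subst has_bochner_integral_half_line_scale_iff)
  from has_bochner_integral_integral_eq[OF has_bochner_integral_mult_right[OF this, of "a powr (1 - \<beta>)"]]
  have "Gamma \<beta> * (a powr (1 - \<beta>) / a)
      = (\<integral>x. a powr (1 - \<beta>) * (indicator {0..} (a * x) * ((a * x) powr (\<beta> - 1) / exp (a * x))) \<partial>half_line)"
    by (simp add: mult_ac)
  also have "\<dots> = (\<integral>x. x powr (\<beta> - 1) * exp (- a * x) \<partial>half_line)"
  proof (rule Bochner_Integration.integral_cong[OF refl])
    fix x assume "x \<in> space half_line"
    moreover have "a powr (1 - \<beta>) * a powr (\<beta> - 1) = 1" using a by (simp flip: powr_add)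
    ultimately show "a powr (1 - \<beta>) * (indicator {0..} (a * x) * ((a * x) powr (\<beta> - 1) / exp (a * x)))
        = x powr (\<beta> - 1) * exp (- a * x)"
      using a by (simp add: powr_mult exp_minus divide_inverse flip: mult.assoc)
  qed
  finally have gamma: "(\<integral>x. x powr (\<beta> - 1) * exp (- a * x) \<partial>half_line) = Gamma \<beta> * a powr (- \<beta>)"
    using a by (simp add: powr_diff powr_minus_divide)
  have "exp (- a * (t + x)) = exp (- a * t) * exp (- a * x)" for x
    by (simp add: distrib_left flip: exp_add)
  then have "(\<integral>x. x powr (\<beta> - 1) *\<^sub>R complex_of_real (exp (- a * (t + x))) \<partial>half_line)
      = (\<integral>x. complex_of_real (exp (- a * t) * (x powr (\<beta> - 1) * exp (- a * x))) \<partial>half_line)"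
    by (intro Bochner_Integration.integral_cong refl)
      (simp only: scaleR_conv_of_real of_real_mult mult_ac)
  also have "\<dots> = complex_of_real (exp (- a * t) * (Gamma \<beta> * a powr (- \<beta>)))"
    by (simp only: integral_complex_of_real integral_mult_right_zero gamma)
  finally show ?thesis
    using Gamma_real_pos[OF \<beta>] by (simp add: weyl_int_half_line scaleR_conv_of_real)
qed

lemma weyl_deriv_exp:
  assumes \<alpha>: "\<alpha> \<ge> 0" and a: "a > 0" and t: "t > 0"
  shows "weyl_deriv \<alpha> (\<lambda>s. complex_of_real (exp (- a * s))) t
      = complex_of_real (a powr \<alpha> * exp (- a * t))"
proof -
  define n where "n = weyl_order \<alpha>"
  have n: "\<alpha> < real n" using weyl_order_bounds[OF \<alpha>] by (simp add: n_def)
  have "weyl_deriv \<alpha> (\<lambda>s. complex_of_real (exp (- a * s))) t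
      = (- 1) ^ n * weyl_int (real n - \<alpha>)
          (\<lambda>s. complex_of_real ((- a) ^ n) * complex_of_real (exp (- a * s))) t"
    unfolding weyl_deriv_eq_weyl_int[OF \<alpha> schwartz_plus_exp[OF a] t] n_def[symmetric]
    by (intro arg_cong2[where f = "(*)"] refl weyl_int_cong_pos) (use t vderiv_funpow_exp in auto)
  also have "\<dots> = complex_of_real (((- 1) ^ n * (- a) ^ n) * (a powr (- (real n - \<alpha>)) * exp (- a * t)))"
    using weyl_int_exp[of "real n - \<alpha>" a t] n a by (simp add: weyl_int_cmult)
  also have "(- 1) ^ n * (- a) ^ n = a powr real n"
    using a by (simp add: powr_realpow flip: power_mult_distrib)
  also have "a powr real n * (a powr (- (real n - \<alpha>)) * exp (- a * t)) = a powr \<alpha> * exp (- a * t)"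
    by (simp flip: powr_add mult.assoc)
  finally show ?thesis .
qed

section \<open>Weighted Weyl derivatives of Schwartz functions\<close>

definition weighted_weyl_deriv :: "real \<Rightarrow> (real \<Rightarrow> complex) \<Rightarrow> real \<Rightarrow> complex" where
  "weighted_weyl_deriv \<alpha> \<phi> t = t powr \<alpha> *\<^sub>R weyl_deriv \<alpha> \<phi> t"

lemma T_norm_eq: "T_norm \<alpha> p \<phi> = hnorm p (weighted_weyl_deriv \<alpha> \<phi>) / Gamma (\<alpha> + 1)"
proof -
  have "(\<integral>t. (norm (weyl_deriv \<alpha> \<phi> t) * t powr \<alpha>) powr p \<partial>half_line)
      = (\<integral>t. norm (weighted_weyl_deriv \<alpha> \<phi> t) powr p \<partial>half_line)"
    by (simp add: weighted_weyl_deriv_def mult.commute)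
  then show ?thesis by (simp add: T_norm_def lp_norm_def integral_half_line)
qed

lemma weighted_weyl_deriv_linear:
  assumes \<alpha>: "\<alpha> \<ge> 0" and \<phi>: "schwartz_plus \<phi>" and \<psi>: "schwartz_plus \<psi>" and t: "t > 0"
  shows "weighted_weyl_deriv \<alpha> (\<lambda>s. \<phi> s + c * \<psi> s) t
      = weighted_weyl_deriv \<alpha> \<phi> t + c * weighted_weyl_deriv \<alpha> \<psi> t"
proof -
  define n where "n = weyl_order \<alpha>"
  have n: "real n - \<alpha> > 0" using weyl_order_bounds[OF \<alpha>] by (simp add: n_def)
  have "weyl_int (real n - \<alpha>) ((vderiv ^^ n) (\<lambda>s. \<phi> s + c * \<psi> s)) t
      = weyl_int (real n - \<alpha>) (\<lambda>s. (vderiv ^^ n) \<phi> s + c * (vderiv ^^ n) \<psi> s) t"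
    using vderiv_funpow_linear[OF \<phi> \<psi>] t by (intro weyl_int_cong_pos) auto
  also have "\<dots> = weyl_int (real n - \<alpha>) ((vderiv ^^ n) \<phi>) t
      + c * weyl_int (real n - \<alpha>) ((vderiv ^^ n) \<psi>) t"
    using n t by (intro weyl_int_linear schwartz_plus_vderiv_funpow \<phi> \<psi>) auto
  finally show ?thesis
    unfolding weighted_weyl_deriv_def weyl_deriv_eq_weyl_int[OF \<alpha> schwartz_plus_linear[OF \<phi> \<psi>] t]
      weyl_deriv_eq_weyl_int[OF \<alpha> \<phi> t] weyl_deriv_eq_weyl_int[OF \<alpha> \<psi> t] n_def[symmetric]
    by (simp add: scaleR_conv_of_real algebra_simps)
qed

lemma weighted_weyl_deriv_exp:
  assumes "\<alpha> \<ge> 0" "a > 0" "t > 0"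
  shows "weighted_weyl_deriv \<alpha> (\<lambda>s. complex_of_real (exp (- a * s))) t
      = complex_of_real (a powr \<alpha> * (t powr \<alpha> * exp (- a * t)))"
  using weyl_deriv_exp[OF assms] by (simp add: weighted_weyl_deriv_def scaleR_conv_of_real)

lemma weighted_weyl_deriv_erdelyi_kober:
  assumes \<alpha>: "\<alpha> \<ge> 0" and \<phi>: "schwartz_plus \<phi>" and t: "t > 0"
  defines "n \<equiv> weyl_order \<alpha>"
  shows "weighted_weyl_deriv \<alpha> \<phi> t
    = erdelyi_kober (real n - \<alpha>) \<alpha> (\<lambda>s. complex_of_real ((- s) ^ n) * (vderiv ^^ n) \<phi> s) t"
proof -
  have "weighted_weyl_deriv \<alpha> \<phi> t = (- 1) ^ n * (t powr \<alpha> *\<^sub>R weyl_int (real n - \<alpha>) ((vderiv ^^ n) \<phi>) t)"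
    by (simp add: weighted_weyl_deriv_def weyl_deriv_eq_weyl_int[OF \<alpha> \<phi> t] n_def)
  also have "\<dots> = erdelyi_kober (real n - \<alpha>) \<alpha>
      (\<lambda>s. (- 1) ^ n * (s powr (real n - \<alpha> + \<alpha>) *\<^sub>R (vderiv ^^ n) \<phi> s)) t"
    by (simp only: weyl_int_erdelyi_kober[OF t] kernel_op_cmult)
  also have "\<dots> = erdelyi_kober (real n - \<alpha>) \<alpha> (\<lambda>s. complex_of_real ((- s) ^ n) * (vderiv ^^ n) \<phi> s) t"
    by (rule kernel_op_cong[OF _ t])
      (simp add: powr_realpow scaleR_conv_of_real power_minus[of "complex_of_real _"] mult.assoc)
  finally show ?thesis .
qed

context
  fixes p \<alpha> :: real
  assumes p: "p \<ge> 1" and \<alpha>: "\<alpha> \<ge> 0"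
begin

lemma lp_fun_weighted_weyl_deriv:
  assumes \<phi>: "schwartz_plus \<phi>"
  shows "hfun p (weighted_weyl_deriv \<alpha> \<phi>)"
proof -
  have "hfun p (erdelyi_kober (real (weyl_order \<alpha>) - \<alpha>) \<alpha>
      (\<lambda>s. complex_of_real ((- s) ^ weyl_order \<alpha>) * (vderiv ^^ weyl_order \<alpha>) \<phi> s))"
    using weyl_order_bounds[OF \<alpha>] \<alpha>
    by (intro lp_fun_erdelyi_kober p lp_fun_power_times_schwartz_plus schwartz_plus_vderiv_funpow \<phi>) auto
  then show ?thesis
    by (subst lp_fun_cong[OF weighted_weyl_deriv_erdelyi_kober[OF \<alpha> \<phi>]]) auto
qed

lemma resolvent_power_times_vderiv:
  assumes \<phi>: "schwartz_plus \<phi>" and t: "t > 0"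
  shows "resolvent (real k) (\<lambda>s. complex_of_real ((- s) ^ Suc k) * (vderiv ^^ Suc k) \<phi> s) t
    = complex_of_real ((- t) ^ k) * (vderiv ^^ k) \<phi> t"
proof -
  have "resolvent (real k) (\<lambda>s. complex_of_real ((- s) ^ Suc k) * (vderiv ^^ Suc k) \<phi> s) t
      = resolvent (real k) (\<lambda>s. (- 1) ^ Suc k * (s powr (1 + real k) *\<^sub>R (vderiv ^^ Suc k) \<phi> s)) t"
  proof (rule kernel_op_cong[OF _ t])
    fix s :: real assume "s > 0"
    then have "s powr (1 + real k) = s ^ Suc k" using powr_realpow[of s "Suc k"] by simp
    then show "complex_of_real ((- s) ^ Suc k) * (vderiv ^^ Suc k) \<phi> s
        = (- 1) ^ Suc k * (s powr (1 + real k) *\<^sub>R (vderiv ^^ Suc k) \<phi> s)"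
      by (simp only: power_minus[of s] of_real_mult of_real_power of_real_minus of_real_1
        scaleR_conv_of_real mult.assoc)
  qed
  also have "\<dots> = (- 1) ^ Suc k * (t powr real k *\<^sub>R weyl_int 1 (vderiv ((vderiv ^^ k) \<phi>)) t)"
    by (simp only: weyl_int_erdelyi_kober[OF t] kernel_op_cmult funpow.simps(2) comp_apply)
  also have "\<dots> = complex_of_real ((- t) ^ k) * (vderiv ^^ k) \<phi> t"
    using t by (simp add: weyl_int_1_vderiv[OF schwartz_plus_vderiv_funpow[OF \<phi>] t] powr_realpow
      scaleR_conv_of_real power_minus[of t] mult.assoc)
  finally show ?thesis .
qed

lemma has_weyl_deriv_schwartz_plus_nat:
  assumes \<phi>: "schwartz_plus \<phi>"
  shows "has_weyl_deriv p (real k) \<phi> (\<lambda>s. complex_of_real ((- s) ^ k) * (vderiv ^^ k) \<phi> s)"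
proof (induction k)
  case 0
  then show ?case using lp_fun_schwartz_plus[OF p \<phi>] by (simp add: has_weyl_deriv_def weyl_inverse_def)
next
  case (Suc k)
  have lp: "hfun p (\<lambda>s. complex_of_real ((- s) ^ j) * (vderiv ^^ j) \<phi> s)" for j
    by (intro lp_fun_power_times_schwartz_plus p schwartz_plus_vderiv_funpow \<phi>)
  have "has_weyl_deriv p (real k) \<phi> (resolvent (real k)
      (\<lambda>s. complex_of_real ((- s) ^ Suc k) * (vderiv ^^ Suc k) \<phi> s))"
    using Suc.IH resolvent_power_times_vderiv[OF \<phi>]
    by (subst has_weyl_deriv_cong_AE[OF p _ lp_fun_resolvent[OF p _ lp] lp[of k]])
      (auto intro: AE_half_line)
  then have "has_weyl_deriv p (real k + 1) \<phi>
      (\<lambda>s. complex_of_real ((- s) ^ Suc k) * (vderiv ^^ Suc k) \<phi> s)"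
    by (subst has_weyl_deriv_add_order_iff[OF p of_nat_0_le_iff zero_less_one lp])
  then show ?case by (simp only: of_nat_Suc add.commute)
qed

theorem has_weyl_deriv_schwartz_plus:
  assumes \<phi>: "schwartz_plus \<phi>"
  shows "has_weyl_deriv p \<alpha> \<phi> (weighted_weyl_deriv \<alpha> \<phi>)"
proof -
  define n where "n = weyl_order \<alpha>"
  define K where "K s = complex_of_real ((- s) ^ n) * (vderiv ^^ n) \<phi> s" for s
  have n: "real n - \<alpha> > 0" using weyl_order_bounds[OF \<alpha>] by (simp add: n_def)
  have K: "hfun p K"
    unfolding K_def by (intro lp_fun_power_times_schwartz_plus p schwartz_plus_vderiv_funpow \<phi>)
  have "has_weyl_deriv p (\<alpha> + (real n - \<alpha>)) \<phi> K"
    using has_weyl_deriv_schwartz_plus_nat[OF \<phi>, of n] by (simp add: K_def[abs_def])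
  then have "has_weyl_deriv p \<alpha> \<phi> (erdelyi_kober (real n - \<alpha>) \<alpha> K)"
    using has_weyl_deriv_add_order_iff[OF p \<alpha> n K] by simp
  moreover have "AE t in half_line. erdelyi_kober (real n - \<alpha>) \<alpha> K t = weighted_weyl_deriv \<alpha> \<phi> t"
    unfolding K_def n_def by (intro AE_half_line weighted_weyl_deriv_erdelyi_kober[OF \<alpha> \<phi>, symmetric])
  ultimately show ?thesis
    using has_weyl_deriv_cong_AE[OF p \<alpha> lp_fun_erdelyi_kober[OF p n \<alpha> K]
      lp_fun_weighted_weyl_deriv[OF \<phi>]] by simp
qed

end

section \<open>Density of the weighted Weyl derivatives\<close>

lemma weighted_weyl_deriv_exp_polynomial_real:
  assumes \<alpha>: "\<alpha> \<ge> 0"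
  shows "\<exists>\<phi>. schwartz_plus \<phi> \<and>
    (\<forall>t>0. weighted_weyl_deriv \<alpha> \<phi> t
        = complex_of_real ((\<Sum>i<n. a i * exp (- t) ^ i) * (t powr \<alpha> * exp (- t))))"
proof (induction n)
  case 0
  have exp: "schwartz_plus (\<lambda>s. complex_of_real (exp (- 1 * s)))" by (rule schwartz_plus_exp) simp
  show ?case
    using schwartz_plus_linear[OF exp exp, of "- 1"] weighted_weyl_deriv_linear[OF \<alpha> exp exp, of _ "- 1"]
    by auto
next
  case (Suc n)
  then obtain \<phi> where \<phi>: "schwartz_plus \<phi>"
    and eq: "\<And>t. t > 0 \<Longrightarrow> weighted_weyl_deriv \<alpha> \<phi> t
        = complex_of_real ((\<Sum>i<n. a i * exp (- t) ^ i) * (t powr \<alpha> * exp (- t)))"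
    by blast
  define b where "b = real (Suc n)"
  have b: "b > 0" by (simp add: b_def)
  have exp: "schwartz_plus (\<lambda>s. complex_of_real (exp (- b * s)))" by (rule schwartz_plus_exp[OF b])
  let ?c = "complex_of_real (a n * b powr (- \<alpha>))"
  have "weighted_weyl_deriv \<alpha> (\<lambda>s. \<phi> s + ?c * complex_of_real (exp (- b * s))) t
      = complex_of_real ((\<Sum>i<Suc n. a i * exp (- t) ^ i) * (t powr \<alpha> * exp (- t)))" if t: "t > 0" for t
  proof -
    have exp_b: "exp (- b * t) = exp (- t) ^ n * exp (- t)"
      using exp_of_nat_mult[of "Suc n" "- t"] unfolding b_def
      by (simp only: power_Suc2 mult_minus_left mult_minus_right)
    have "b powr (- \<alpha>) * b powr \<alpha> = 1" using b by (simp flip: powr_add)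
    then have "a n * b powr (- \<alpha>) * (b powr \<alpha> * (t powr \<alpha> * exp (- b * t)))
        = a n * exp (- t) ^ n * (t powr \<alpha> * exp (- t))"
      unfolding exp_b by (simp add: mult_ac)
    then have "?c * complex_of_real (b powr \<alpha> * (t powr \<alpha> * exp (- b * t)))
        = complex_of_real (a n * exp (- t) ^ n * (t powr \<alpha> * exp (- t)))"
      by (simp only: flip: of_real_mult)
    then show ?thesis
      by (simp only: weighted_weyl_deriv_linear[OF \<alpha> \<phi> exp t] weighted_weyl_deriv_exp[OF \<alpha> b t] eq[OF t]
        sum.lessThan_Suc distrib_right of_real_add)
  qed
  then show ?case using schwartz_plus_linear[OF \<phi> exp] by blast
qed

lemma weighted_weyl_deriv_exp_polynomial:
  fixes q :: "real \<Rightarrow> complex"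
  assumes \<alpha>: "\<alpha> \<ge> 0" and q: "polynomial_function q"
  obtains \<phi> where "schwartz_plus \<phi>"
    "\<And>t. t > 0 \<Longrightarrow> weighted_weyl_deriv \<alpha> \<phi> t = q (exp (- t)) * complex_of_real (t powr \<alpha> * exp (- t))"
proof -
  have real_case: "\<exists>\<phi>. schwartz_plus \<phi>
      \<and> (\<forall>t>0. weighted_weyl_deriv \<alpha> \<phi> t = complex_of_real (r (exp (- t)) * (t powr \<alpha> * exp (- t))))"
    if "real_polynomial_function r" for r :: "real \<Rightarrow> real"
  proof -
    obtain a n where "r = (\<lambda>x. \<Sum>i\<le>n. a i * x ^ i)"
      using \<open>real_polynomial_function r\<close> real_polynomial_function_iff_sum by blast
    then show ?thesis
      using weighted_weyl_deriv_exp_polynomial_real[OF \<alpha>, where n = "Suc n" and a = a]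
      by (simp add: lessThan_Suc_atMost)
  qed
  have "real_polynomial_function (\<lambda>x. Re (q x))" "real_polynomial_function (\<lambda>x. Im (q x))"
    using q bounded_linear_Re bounded_linear_Im by (auto simp: polynomial_function_def o_def)
  then obtain \<phi> \<psi> where \<phi>: "schwartz_plus \<phi>" "\<And>t. t > 0 \<Longrightarrow> weighted_weyl_deriv \<alpha> \<phi> t
      = complex_of_real (Re (q (exp (- t))) * (t powr \<alpha> * exp (- t)))"
    and \<psi>: "schwartz_plus \<psi>" "\<And>t. t > 0 \<Longrightarrow> weighted_weyl_deriv \<alpha> \<psi> t
        = complex_of_real (Im (q (exp (- t))) * (t powr \<alpha> * exp (- t)))"
    using real_case[of "\<lambda>x. Re (q x)"] real_case[of "\<lambda>x. Im (q x)"] by blast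
  show thesis
  proof
    show "schwartz_plus (\<lambda>t. \<phi> t + \<i> * \<psi> t)" by (rule schwartz_plus_linear[OF \<phi>(1) \<psi>(1)])
    show "weighted_weyl_deriv \<alpha> (\<lambda>t. \<phi> t + \<i> * \<psi> t) t
        = q (exp (- t)) * complex_of_real (t powr \<alpha> * exp (- t))" if t: "t > 0" for t
      unfolding weighted_weyl_deriv_linear[OF \<alpha> \<phi>(1) \<psi>(1) t] \<phi>(2)[OF t] \<psi>(2)[OF t]
      by (simp add: complex_eq_iff)
  qed
qed

text \<open>The substitution \<open>x = exp (- s)\<close> turns approximation by polynomials in \<open>exp (- s)\<close> into the
  Weierstrass theorem on \<open>{0..1}\<close>.\<close>

lemma continuous_exp_substitution:
  fixes k :: "real \<Rightarrow> 'b::real_normed_vector"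
  assumes k: "continuous_on UNIV k" and supp: "\<And>s. s > b \<Longrightarrow> k s = 0"
  obtains h where "continuous_on UNIV h" "\<And>s. h (exp (- s)) = k s"
proof -
  define l where "l x = - ln (max x (exp (- (b + 1))))" for x
  have "max x (exp (- (b + 1))) \<noteq> 0" for x
    using exp_gt_zero[of "- (b + 1)"] by linarith
  then have l: "continuous_on UNIV l"
    unfolding l_def by (intro continuous_intros) blast
  have kl: "k (l (exp (- s))) = k s" for s
  proof (cases "s \<le> b + 1")
    case True
    then have "max (exp (- s)) (exp (- (b + 1))) = exp (- s)" by (intro max_absorb1) simp
    then have "l (exp (- s)) = s" by (simp only: l_def ln_exp minus_minus)
    then show ?thesis by simp
  next
    case False
    then have "max (exp (- s)) (exp (- (b + 1))) = exp (- (b + 1))" by (intro max_absorb2) simp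
    then have "l (exp (- s)) = b + 1" by (simp only: l_def ln_exp minus_minus)
    then show ?thesis using False supp[of s] supp[of "b + 1"] by simp
  qed
  have "continuous_on UNIV (\<lambda>x. k (l x))" using continuous_on_compose2[OF k l] by simp
  then show thesis using kl by (rule that)
qed

lemma continuous_compact_support_exp_factor:
  fixes g :: "real \<Rightarrow> complex"
  assumes g: "continuous_on UNIV g" and a: "a > 0" and supp: "\<And>s. s \<notin> {a..b} \<Longrightarrow> g s = 0"
  obtains h where "continuous_on UNIV h" "\<And>s. s > 0 \<Longrightarrow> g s
      = h (exp (- s)) * complex_of_real (s powr \<alpha> * exp (- s))"
proof -
  define k where "k s = g s * complex_of_real (max a s powr (- \<alpha>) * exp s)" for s
  have "max a s \<noteq> 0" for s using a by linarith
  then have k: "continuous_on UNIV k"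
    unfolding k_def by (intro continuous_intros g) blast
  obtain h where h: "continuous_on UNIV h" "\<And>s. h (exp (- s)) = k s"
    by (rule continuous_exp_substitution[OF k, of b]) (use supp in \<open>auto simp: k_def\<close>)
  have "g s = h (exp (- s)) * complex_of_real (s powr \<alpha> * exp (- s))" if s: "s > 0" for s
  proof (cases "s \<in> {a..b}")
    case True
    have "s powr (- \<alpha>) * s powr \<alpha> = 1" "exp s * exp (- s) = 1"
      using s by (simp_all flip: powr_add exp_add)
    moreover have "s powr (- \<alpha>) * exp s * (s powr \<alpha> * exp (- s))
        = (s powr (- \<alpha>) * s powr \<alpha>) * (exp s * exp (- s))"
      by (simp only: mult_ac)
    ultimately have "s powr (- \<alpha>) * exp s * (s powr \<alpha> * exp (- s)) = 1"
      by (simp only: mult_1_right)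
    then have weight: "complex_of_real (s powr (- \<alpha>) * exp s) *
        complex_of_real (s powr \<alpha> * exp (- s)) = 1"
      by (simp only: of_real_1 flip: of_real_mult)
    have "max a s = s" using True by simp
    then show ?thesis
      unfolding h(2) k_def mult.assoc[of "g s"] by (simp only: weight mult_1_right)
  qed (use supp in \<open>simp add: h(2) k_def\<close>)
  with h(1) show thesis by (rule that)
qed

context
  fixes p \<alpha> :: real
  assumes p: "p \<ge> 1" and \<alpha>: "\<alpha> \<ge> 0"
begin

lemma weighted_weyl_deriv_approx_continuous:
  assumes g: "continuous_on UNIV g" and a: "a > 0" and supp: "\<And>s. s \<notin> {a..b} \<Longrightarrow> g s = 0" and e: "e > 0"
  obtains \<phi> where "schwartz_plus \<phi>" "hnorm p (\<lambda>s. g s - weighted_weyl_deriv \<alpha> \<phi> s) < e"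
proof -
  define E where "E s = complex_of_real (s powr \<alpha> * exp (- s))" for s
  have "hfun p (weighted_weyl_deriv \<alpha> (\<lambda>s. complex_of_real (exp (- 1 * s))))"
    by (intro lp_fun_weighted_weyl_deriv p \<alpha> schwartz_plus_exp) simp
  then have E: "hfun p E"
    by (subst lp_fun_cong[where g = "weighted_weyl_deriv \<alpha> (\<lambda>s. complex_of_real (exp (- 1 * s)))"])
      (use weighted_weyl_deriv_exp[OF \<alpha> zero_less_one] in \<open>auto simp: E_def\<close>)
  define \<epsilon> where "\<epsilon> = e / (1 + hnorm p E)"
  have \<epsilon>: "\<epsilon> > 0" "\<epsilon> * hnorm p E < e"
    using e lp_norm_nonneg[of half_line p E] by (simp_all add: \<epsilon>_def add_pos_nonneg divide_less_eq)
  obtain h where h: "continuous_on UNIV h" and gh: "\<And>s. s > 0 \<Longrightarrow> g s = h (exp (- s)) * E s"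
    using continuous_compact_support_exp_factor[OF g a, of b \<alpha>] supp unfolding E_def by blast
  obtain q where q: "polynomial_function q" "\<And>x. x \<in> {0..1} \<Longrightarrow> norm (h x - q x) < \<epsilon>"
    using Stone_Weierstrass_polynomial_function[OF compact_Icc[of 0 1] continuous_on_subset[OF h] \<epsilon>(1)]
    by auto
  obtain \<phi> where \<phi>: "schwartz_plus \<phi>"
    and \<phi>_eq: "\<And>t. t > 0 \<Longrightarrow> weighted_weyl_deriv \<alpha> \<phi> t = q (exp (- t)) * E t"
    using weighted_weyl_deriv_exp_polynomial[OF \<alpha> q(1)] unfolding E_def by blast
  have "hnorm p (\<lambda>s. g s - weighted_weyl_deriv \<alpha> \<phi> s) \<le> hnorm p (\<lambda>s. complex_of_real \<epsilon> * E s)"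
  proof (rule lp_fun_bound(2)[OF p lp_fun_cmult[OF E]])
    show "(\<lambda>s. g s - weighted_weyl_deriv \<alpha> \<phi> s) \<in> borel_measurable half_line"
      using lp_fun_measurable[OF lp_fun_weighted_weyl_deriv[OF p \<alpha> \<phi>]]
        borel_measurable_half_line[OF borel_measurable_continuous_onI[OF g]]
      by measurable
    show "AE s in half_line. norm (g s - weighted_weyl_deriv \<alpha> \<phi> s) \<le> norm (complex_of_real \<epsilon> * E s)"
    proof (rule AE_half_line)
      fix s :: real assume s: "s > 0"
      have "g s - weighted_weyl_deriv \<alpha> \<phi> s = (h (exp (- s)) - q (exp (- s))) * E s"
        by (simp add: gh[OF s] \<phi>_eq[OF s] algebra_simps)
      moreover have "norm (h (exp (- s)) - q (exp (- s))) \<le> \<epsilon>"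
        using q(2)[of "exp (- s)"] s by (simp add: less_imp_le)
      ultimately show "norm (g s - weighted_weyl_deriv \<alpha> \<phi> s) \<le> norm (complex_of_real \<epsilon> * E s)"
        using \<epsilon>(1) by (simp add: norm_mult mult_right_mono)
    qed
  qed
  also have "\<dots> = \<epsilon> * hnorm p E" using \<epsilon> by (simp add: lp_norm_cmult[OF p])
  finally show thesis using \<phi> \<epsilon>(2) by (intro that[of \<phi>]) auto
qed

theorem weighted_weyl_deriv_dense:
  assumes G: "hfun p G" and e: "e > 0"
  obtains \<phi> where "schwartz_plus \<phi>" "hnorm p (\<lambda>s. weighted_weyl_deriv \<alpha> \<phi> s - G s) < e"
proof -
  have e2: "e / 2 > 0" using e by simp
  obtain g a b where g: "continuous_on UNIV g" "a > 0" "\<And>s. s \<notin> {a..b} \<Longrightarrow> g s = 0"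
    "hnorm p (\<lambda>s. G s - g s) < e / 2"
    using lp_dense_continuous_compact_support[OF p G e2] by metis
  obtain \<phi> where \<phi>: "schwartz_plus \<phi>" "hnorm p (\<lambda>s. g s - weighted_weyl_deriv \<alpha> \<phi> s) < e / 2"
    using weighted_weyl_deriv_approx_continuous[OF g(1,2) _ e2] g(3) by blast
  have "hfun p g" by (rule lp_fun_continuous_compact_support[OF p g(1,3)])
  have "hnorm p (\<lambda>s. G s - weighted_weyl_deriv \<alpha> \<phi> s) < e"
    using g(4) \<phi>(2) lp_norm_triangle_dist[OF p G \<open>hfun p g\<close> lp_fun_weighted_weyl_deriv[OF p \<alpha> \<phi>(1)]]
    by simp
  then show thesis using \<phi>(1) by (intro that[of \<phi>]) (simp_all add: lp_norm_minus_commute)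
qed

end

section \<open>The completion as a space of weighted Weyl derivatives\<close>

context
  fixes p \<alpha> :: real
  assumes p: "p \<ge> 1" and \<alpha>: "\<alpha> \<ge> 0"
begin

lemma Gamma_add_1_pos: "Gamma (\<alpha> + 1) > 0"
  using \<alpha> by (intro Gamma_real_pos) simp

lemma T_norm_diff:
  assumes "schwartz_plus \<phi>" "schwartz_plus \<psi>"
  shows "T_norm \<alpha> p (\<lambda>s. \<phi> s - \<psi> s)
    = hnorm p (\<lambda>s. weighted_weyl_deriv \<alpha> \<phi> s - weighted_weyl_deriv \<alpha> \<psi> s) / Gamma (\<alpha> + 1)"
  unfolding T_norm_eq using weighted_weyl_deriv_linear[OF \<alpha> assms, of _ "- 1"]
  by (intro arg_cong2[where f = "(/)"] lp_norm_cong refl) simp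

lemma T_approx_iff:
  "T_approx \<alpha> p \<phi> f \<longleftrightarrow> (\<forall>n. schwartz_plus (\<phi> n)) \<and>
    (\<forall>e>0. \<exists>N. \<forall>m\<ge>N. \<forall>n\<ge>N.
        hnorm p (\<lambda>s. weighted_weyl_deriv \<alpha> (\<phi> m) s - weighted_weyl_deriv \<alpha> (\<phi> n) s) < e) \<and>
    (\<lambda>n. hnorm p (\<lambda>s. \<phi> n s - f s)) \<longlonglongrightarrow> 0"
proof (cases "\<forall>n. schwartz_plus (\<phi> n)")
  case True
  let ?d = "\<lambda>m n. hnorm p (\<lambda>s. weighted_weyl_deriv \<alpha> (\<phi> m) s - weighted_weyl_deriv \<alpha> (\<phi> n) s)"
  have eq: "T_norm \<alpha> p (\<lambda>s. \<phi> m s - \<phi> n s) < e \<longleftrightarrow> ?d m n < e * Gamma (\<alpha> + 1)" for m n e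
    using True Gamma_add_1_pos by (simp add: T_norm_diff divide_less_eq)
  have "(\<forall>e>0. \<exists>N. \<forall>m\<ge>N. \<forall>n\<ge>N. ?d m n < e * Gamma (\<alpha> + 1)) \<longleftrightarrow> (\<forall>e>0. \<exists>N. \<forall>m\<ge>N. \<forall>n\<ge>N. ?d m n < e)"
    (is "?scaled \<longleftrightarrow> ?unscaled")
  proof
    assume scaled: ?scaled
    show ?unscaled
    proof (intro allI impI)
      fix e :: real assume "e > 0"
      then show "\<exists>N. \<forall>m\<ge>N. \<forall>n\<ge>N. ?d m n < e"
        using scaled[rule_format, of "e / Gamma (\<alpha> + 1)"] Gamma_add_1_pos by simp
    qed
  qed (use Gamma_add_1_pos in simp)
  then show ?thesis using True by (simp add: T_approx_def eq Lp_norm_eq_lp_norm)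
qed (auto simp: T_approx_def)

lemma T_approx_limit:
  assumes f: "hfun p f" and approx: "T_approx \<alpha> p \<phi> f"
  obtains G where "has_weyl_deriv p \<alpha> f G" "(\<lambda>n. hnorm p (\<lambda>s. weighted_weyl_deriv \<alpha> (\<phi> n) s - G s)) \<longlonglongrightarrow> 0"
proof -
  have \<phi>: "schwartz_plus (\<phi> n)" for n using approx by (simp add: T_approx_iff)
  have cauchy: "\<exists>N. \<forall>m\<ge>N. \<forall>n\<ge>N.
      hnorm p (\<lambda>s. weighted_weyl_deriv \<alpha> (\<phi> m) s - weighted_weyl_deriv \<alpha> (\<phi> n) s) < e" if "e > 0" for e
    using approx that by (simp add: T_approx_iff)
  obtain G where G: "hfun p G" and lim: "(\<lambda>n. hnorm p (\<lambda>s. weighted_weyl_deriv \<alpha> (\<phi> n) s - G s)) \<longlonglongrightarrow> 0"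
    by (rule lp_complete[OF p lp_fun_weighted_weyl_deriv[OF p \<alpha> \<phi>] cauchy])
  have "has_weyl_deriv p \<alpha> f G"
    using approx by (intro has_weyl_deriv_limit[OF p \<alpha> has_weyl_deriv_schwartz_plus[OF p \<alpha> \<phi>] f G _ lim])
      (simp add: T_approx_iff)
  then show thesis using lim by (rule that)
qed

lemma T_approx_exists:
  assumes f: "has_weyl_deriv p \<alpha> f G"
  obtains \<phi> where "T_approx \<alpha> p \<phi> f"
proof -
  note G = has_weyl_deriv_lp_fun(2)[OF p \<alpha> f]
  have "\<exists>\<phi>. schwartz_plus \<phi> \<and> hnorm p (\<lambda>s. weighted_weyl_deriv \<alpha> \<phi> s - G s) < inverse (real (Suc n))"
    for n
    using weighted_weyl_deriv_dense[OF p \<alpha> G, of "inverse (real (Suc n))"]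
    by (metis of_nat_0_less_iff positive_imp_inverse_positive zero_less_Suc)
  then obtain \<phi> where \<phi>: "\<And>n. schwartz_plus (\<phi> n)"
    and close: "\<And>n. hnorm p (\<lambda>s. weighted_weyl_deriv \<alpha> (\<phi> n) s - G s) < inverse (real (Suc n))"
    by metis
  have lim: "(\<lambda>n. hnorm p (\<lambda>s. weighted_weyl_deriv \<alpha> (\<phi> n) s - G s)) \<longlonglongrightarrow> 0"
    by (rule tendsto_sandwich[OF _ _ tendsto_const LIMSEQ_inverse_real_of_nat])
      (use close in \<open>auto intro: always_eventually less_imp_le\<close>)
  note lp = lp_fun_weighted_weyl_deriv[OF p \<alpha> \<phi>]
  have "T_approx \<alpha> p \<phi> f"
    unfolding T_approx_iff
  proof (intro conjI allI impI \<phi>)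
    fix e :: real assume "e > 0"
    then have "\<forall>\<^sub>F n in sequentially. hnorm p (\<lambda>s. weighted_weyl_deriv \<alpha> (\<phi> n) s - G s) < e / 2"
      by (intro order_tendstoD(2)[OF lim]) simp
    then obtain N where N: "\<And>n. n \<ge> N \<Longrightarrow> hnorm p (\<lambda>s. weighted_weyl_deriv \<alpha> (\<phi> n) s - G s) < e / 2"
      by (auto simp: eventually_sequentially)
    have "hnorm p (\<lambda>s. weighted_weyl_deriv \<alpha> (\<phi> m) s - weighted_weyl_deriv \<alpha> (\<phi> n) s) < e"
      if "m \<ge> N" "n \<ge> N" for m n
      using lp_norm_triangle_dist[OF p lp[of m] G lp[of n]] N[OF that(1)] N[OF that(2)]
        lp_norm_minus_commute[of half_line p G "weighted_weyl_deriv \<alpha> (\<phi> n)"] by simp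
    then show "\<exists>N. \<forall>m\<ge>N. \<forall>n\<ge>N.
        hnorm p (\<lambda>s. weighted_weyl_deriv \<alpha> (\<phi> m) s - weighted_weyl_deriv \<alpha> (\<phi> n) s) < e"
      by blast
  next
    obtain B where B: "B \<ge> 0" "\<And>f G. has_weyl_deriv p \<alpha> f G \<Longrightarrow> hnorm p f \<le> B * hnorm p G"
      by (rule has_weyl_deriv_norm_le[OF p \<alpha>]) blast
    have "hnorm p (\<lambda>s. \<phi> n s - f s) \<le> B * hnorm p (\<lambda>s. weighted_weyl_deriv \<alpha> (\<phi> n) s - G s)" for n
      by (intro B(2) has_weyl_deriv_diff p \<alpha> has_weyl_deriv_schwartz_plus \<phi> f)
    then show "(\<lambda>n. hnorm p (\<lambda>s. \<phi> n s - f s)) \<longlonglongrightarrow> 0"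
      by (intro tendsto_sandwich[OF _ _ tendsto_const tendsto_mult_right_zero[OF lim, of B]]) auto
  qed
  then show thesis by (rule that)
qed

theorem T_space_iff_has_weyl_deriv: "f \<in> T_space \<alpha> p \<longleftrightarrow> (\<exists>G. has_weyl_deriv p \<alpha> f G)"
proof (cases "\<alpha> = 0")
  case True
  then show ?thesis by (auto simp: T_space_def Lp_iff_lp_fun has_weyl_deriv_def weyl_inverse_def)
next
  case False
  then have "f \<in> T_space \<alpha> p \<longleftrightarrow> hfun p f \<and> (\<exists>\<phi>. T_approx \<alpha> p \<phi> f)"
    by (simp add: T_space_def Lp_iff_lp_fun)
  also have "\<dots> \<longleftrightarrow> (\<exists>G. has_weyl_deriv p \<alpha> f G)"
    using T_approx_limit T_approx_exists has_weyl_deriv_lp_fun(1)[OF p \<alpha>] by metis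
  finally show ?thesis .
qed

theorem T_space_norm_eq:
  assumes f: "has_weyl_deriv p \<alpha> f G"
  shows "T_space_norm \<alpha> p f = hnorm p G / Gamma (\<alpha> + 1)"
proof (cases "\<alpha> = 0")
  case True
  then have "hnorm p f = hnorm p G"
    using f by (intro lp_norm_cong_AE)
      (auto simp: has_weyl_deriv_def weyl_inverse_def dest: lp_fun_measurable)
  then show ?thesis using True by (simp add: T_space_norm_def Lp_norm_eq_lp_norm)
next
  case False
  define \<phi> where "\<phi> = (SOME \<phi>. T_approx \<alpha> p \<phi> f)"
  have approx: "T_approx \<alpha> p \<phi> f" unfolding \<phi>_def using T_approx_exists[OF f] by (metis someI_ex)
  obtain G' where G': "has_weyl_deriv p \<alpha> f G'"
    and lim: "(\<lambda>n. hnorm p (\<lambda>s. weighted_weyl_deriv \<alpha> (\<phi> n) s - G' s)) \<longlonglongrightarrow> 0"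
    using T_approx_limit[OF has_weyl_deriv_lp_fun(1)[OF p \<alpha> f] approx] by blast
  note lpG = has_weyl_deriv_lp_fun(2)[OF p \<alpha> f] has_weyl_deriv_lp_fun(2)[OF p \<alpha> G']
  have lp: "hfun p (weighted_weyl_deriv \<alpha> (\<phi> n))" for n
    using approx by (intro lp_fun_weighted_weyl_deriv p \<alpha>) (simp add: T_approx_iff)
  have "(\<lambda>n. hnorm p (weighted_weyl_deriv \<alpha> (\<phi> n)) - hnorm p G') \<longlonglongrightarrow> 0"
    using abs_lp_norm_diff_le[OF p lp lpG(2)]
    by (intro Lim_null_comparison[OF _ lim] always_eventually) simp
  then have "(\<lambda>n. T_norm \<alpha> p (\<phi> n)) \<longlonglongrightarrow> hnorm p G' / Gamma (\<alpha> + 1)"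
    unfolding T_norm_eq LIM_zero_iff divide_inverse by (rule tendsto_mult_right)
  moreover have "hnorm p G' = hnorm p G"
    using has_weyl_deriv_unique[OF p \<alpha> G' f] lpG by (intro lp_norm_cong_AE lp_fun_measurable)
  ultimately show ?thesis using False by (simp add: T_space_norm_def \<phi>_def limI)
qed

section \<open>The dilation group on the completion\<close>

lemma T_space_T_grp:
  assumes "f \<in> T_space \<alpha> p"
  shows "T_grp p t f \<in> T_space \<alpha> p" "T_space_norm \<alpha> p (T_grp p t f) = T_space_norm \<alpha> p f"
proof -
  obtain G where G: "has_weyl_deriv p \<alpha> f G" using assms T_space_iff_has_weyl_deriv by blast
  note TG = has_weyl_deriv_T_grp[OF p \<alpha> G, of t]
  show "T_grp p t f \<in> T_space \<alpha> p" using TG T_space_iff_has_weyl_deriv by blast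
  show "T_space_norm \<alpha> p (T_grp p t f) = T_space_norm \<alpha> p f"
    by (simp add: T_space_norm_eq[OF G] T_space_norm_eq[OF TG] lp_norm_T_grp[OF p])
qed

lemma T_space_strongly_continuous:
  assumes "f \<in> T_space \<alpha> p"
  shows "((\<lambda>t. T_space_norm \<alpha> p (\<lambda>s. T_grp p t f s - f s)) \<longlongrightarrow> 0) (at 0)"
proof -
  obtain G where G: "has_weyl_deriv p \<alpha> f G" using assms T_space_iff_has_weyl_deriv by blast
  have "T_space_norm \<alpha> p (\<lambda>s. T_grp p t f s - f s) = hnorm p (\<lambda>s. T_grp p t G s - G s) / Gamma (\<alpha> + 1)"
    for t
    by (intro T_space_norm_eq has_weyl_deriv_diff has_weyl_deriv_T_grp p \<alpha> G)
  then show ?thesis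
    using tendsto_divide_zero[OF T_grp_strongly_continuous[OF p has_weyl_deriv_lp_fun(2)[OF p \<alpha> G]]]
    by simp
qed

lemma is_generator_value_iff:
  assumes f: "has_weyl_deriv p \<alpha> f G"
  shows "is_generator_value \<alpha> p f g \<longleftrightarrow> (\<exists>Q. has_weyl_deriv p \<alpha> g Q \<and> lp_generator p G Q)"
proof -
  have "((\<lambda>t. T_space_norm \<alpha> p (\<lambda>s. (T_grp p t f s - f s) / complex_of_real t - g s)) \<longlongrightarrow> 0) (at 0)
      \<longleftrightarrow> lp_generator p G Q"
    if g: "has_weyl_deriv p \<alpha> g Q" for Q
  proof -
    have "T_space_norm \<alpha> p (\<lambda>s. (T_grp p t f s - f s) / complex_of_real t - g s)
        = hnorm p (generator_error p G Q t) / Gamma (\<alpha> + 1)" for t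
      using T_space_norm_eq[OF has_weyl_deriv_generator_error[OF p \<alpha> f g, of t]]
      by (simp add: generator_error_def[abs_def])
    then show ?thesis
      unfolding lp_generator_def
        using Gamma_add_1_pos tendsto_mult_right_iff[of "1 / Gamma (\<alpha> + 1)" _ 0 "at (0::real)"]
      by (simp add: divide_inverse)
  qed
  then show ?thesis
    unfolding is_generator_value_def T_space_iff_has_weyl_deriv by blast
qed

lemma lp_generator_of_is_generator_value:
  assumes f: "f \<in> T_space \<alpha> p" and g: "is_generator_value \<alpha> p f g"
  shows "hfun p f" "hfun p g" "lp_generator p f g"
proof -
  obtain F where F: "has_weyl_deriv p \<alpha> f F" using f T_space_iff_has_weyl_deriv by blast
  then obtain G where G: "has_weyl_deriv p \<alpha> g G" and FG: "lp_generator p F G"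
    using g is_generator_value_iff by blast
  obtain B where B: "B \<ge> 0" "\<And>f G. has_weyl_deriv p \<alpha> f G \<Longrightarrow> hnorm p f \<le> B * hnorm p G"
    by (rule has_weyl_deriv_norm_le[OF p \<alpha>]) blast
  show "hfun p f" "hfun p g" using has_weyl_deriv_lp_fun(1)[OF p \<alpha>] F G by blast+
  show "lp_generator p f g"
    unfolding lp_generator_def
  proof (rule tendsto_sandwich[OF _ _ tendsto_const])
    show "((\<lambda>t. B * hnorm p (generator_error p F G t)) \<longlongrightarrow> 0) (at 0)"
      by (rule tendsto_mult_right_zero[OF FG[unfolded lp_generator_def]])
    show "\<forall>\<^sub>F t in at 0. hnorm p (generator_error p f g t) \<le> B * hnorm p (generator_error p F G t)"
      by (intro always_eventually allI B(2) has_weyl_deriv_generator_error p \<alpha> F G)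
  qed simp
qed

end

theorem generator_domain:
  assumes p: "p \<ge> 1" and \<alpha>: "\<alpha> \<ge> 0"
  shows "{f \<in> T_space \<alpha> p. \<exists>g. is_generator_value \<alpha> p f g} = T_space (\<alpha> + 1) p"
proof (intro set_eqI iffI)
  fix f assume "f \<in> {f \<in> T_space \<alpha> p. \<exists>g. is_generator_value \<alpha> p f g}"
  then obtain F G where F: "has_weyl_deriv p \<alpha> f F" and G: "hfun p G" and gen: "lp_generator p F G"
    using T_space_iff_has_weyl_deriv[OF p \<alpha>] is_generator_value_iff[OF p \<alpha>]
      has_weyl_deriv_lp_fun(2)[OF p \<alpha>] by blast
  define K where "K s = G s + complex_of_real (\<alpha> + 1 / p) * F s" for s
  have lpF: "hfun p F" by (rule has_weyl_deriv_lp_fun(2)[OF p \<alpha> F])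
  have K: "hfun p K" unfolding K_def by (intro lp_fun_add lp_fun_cmult p G lpF)
  have "AE s in half_line. F s = resolvent \<alpha> K s"
    using lp_generator_iff_resolvent[OF p \<alpha> lpF G] gen by (simp add: K_def[abs_def])
  then have "has_weyl_deriv p \<alpha> f (resolvent \<alpha> K)"
    using has_weyl_deriv_cong_AE[OF p \<alpha> lpF lp_fun_resolvent[OF p \<alpha> K]] F by blast
  then show "f \<in> T_space (\<alpha> + 1) p"
    using has_weyl_deriv_add_order_iff[OF p \<alpha> zero_less_one K] \<alpha>
    by (auto simp: T_space_iff_has_weyl_deriv[OF p])
next
  fix f assume "f \<in> T_space (\<alpha> + 1) p"
  moreover have \<alpha>1: "\<alpha> + 1 \<ge> 0" using \<alpha> by simp
  ultimately obtain K where fK: "has_weyl_deriv p (\<alpha> + 1) f K"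
    using T_space_iff_has_weyl_deriv[OF p \<alpha>1] by blast
  then have K: "hfun p K" by (rule has_weyl_deriv_lp_fun(2)[OF p \<alpha>1])
  have f: "has_weyl_deriv p \<alpha> f (resolvent \<alpha> K)"
    using fK has_weyl_deriv_add_order_iff[OF p \<alpha> zero_less_one K] by blast
  let ?Q = "\<lambda>s. K s - complex_of_real (\<alpha> + 1 / p) * resolvent \<alpha> K s"
  have "hfun p ?Q" by (intro lp_fun_diff lp_fun_cmult lp_fun_resolvent p \<alpha> K)
  then have "is_generator_value \<alpha> p f (weyl_inverse \<alpha> ?Q)"
    using lp_generator_resolvent[OF p \<alpha> K] has_weyl_deriv_weyl_inverse[OF p \<alpha>]
    unfolding is_generator_value_iff[OF p \<alpha> f] by blast
  then show "f \<in> {f \<in> T_space \<alpha> p. \<exists>g. is_generator_value \<alpha> p f g}"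
    using f T_space_iff_has_weyl_deriv[OF p \<alpha>] by blast
qed

section \<open>The generator in the sense of distributions\<close>

lemma lp_fun_1_iff: "lp_fun M 1 f \<longleftrightarrow> integrable M f"
  by (auto simp: lp_fun_def intro: integrable_norm_cancel)

lemma integrable_bounded_support:
  fixes h :: "real \<Rightarrow> 'b::{banach, second_countable_topology}"
  assumes "h \<in> borel_measurable half_line" "\<And>s. s > 0 \<Longrightarrow> norm (h s) \<le> M" "\<And>s. s > A \<Longrightarrow> h s = 0"
  shows "integrable half_line h"
  using lp_fun_bounded_support[of 1 h M A] assms by (simp add: lp_fun_1_iff)

lemma integrable_lp_fun_mult_bounded_support:
  fixes f h :: "real \<Rightarrow> 'b::{real_normed_algebra, banach, second_countable_topology}"
  assumes p: "p \<ge> 1" and f: "hfun p f"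
    and h: "h \<in> borel_measurable half_line" "\<And>s. s > 0 \<Longrightarrow> norm (h s) \<le> M" "\<And>s. s > A \<Longrightarrow> h s = 0"
  shows "integrable half_line (\<lambda>s. f s * h s)"
proof (rule Bochner_Integration.integrable_bound)
  show "integrable half_line (\<lambda>s. norm (h s) + M * norm (f s) powr p)"
    using integrable_bounded_support[OF h] lp_fun_integrable[OF f] by simp
  show "(\<lambda>s. f s * h s) \<in> borel_measurable half_line"
    using h(1) lp_fun_measurable[OF f] by measurable
  show "AE s in half_line. norm (f s * h s) \<le> norm (norm (h s) + M * norm (f s) powr p)"
  proof (rule AE_half_line)
    fix s :: real assume s: "s > 0"
    have "norm (f s) \<le> 1 + norm (f s) powr p"
      using powr_mono[of 1 p "norm (f s)"] p by (cases "norm (f s) \<le> 1") (simp_all add: add_increasing2)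
    then have "norm (f s) * norm (h s) \<le> (1 + norm (f s) powr p) * norm (h s)"
      by (rule mult_right_mono) simp
    also have "\<dots> \<le> norm (h s) + norm (f s) powr p * M"
      using mult_left_mono[OF h(2)[OF s], of "norm (f s) powr p"] by (simp add: distrib_right)
    finally show "norm (f s * h s) \<le> norm (norm (h s) + M * norm (f s) powr p)"
      using norm_mult_ineq[of "f s" "h s"] by (simp add: mult.commute)
  qed
qed

lemma integral_kernel_op_mult:
  fixes f h :: "real \<Rightarrow> complex"
  assumes p: "p \<ge> 1" and k: "lp_kernel p k" and f: "hfun p f"
    and h: "h \<in> borel_measurable half_line" "\<And>s. s > 0 \<Longrightarrow> norm (h s) \<le> M" "\<And>s. s > A \<Longrightarrow> h s = 0"
  shows "(\<integral>t. kernel_op k f t * h t \<partial>half_line)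
      = (\<integral>s. f s * (\<integral>u. (k u / u) *\<^sub>R h (s / u) \<partial>half_line) \<partial>half_line)"
proof -
  note [measurable] = lp_kernelD(1)[OF k] lp_fun_measurable[OF f] h(1)
  define P where "P t u = k u *\<^sub>R f (t * u) * h t" for t u
  have P: "integrable (half_line \<Otimes>\<^sub>M half_line) (\<lambda>(t, u). P t u)"
  proof (rule half_line_pair.Fubini_integrable)
    show "(\<lambda>(t, u). P t u) \<in> borel_measurable (half_line \<Otimes>\<^sub>M half_line)"
      unfolding P_def by measurable
    show "AE t in half_line. integrable half_line (\<lambda>u. case (t, u) of (t, u) \<Rightarrow> P t u)"
      using AE_integrable_kernel_op[OF p k f]
      by eventually_elim (simp add: P_def integrable_mult_left del: mult_scaleR_left)
    have "integrable half_line (\<lambda>t. kernel_op k (\<lambda>s. norm (f s)) t * norm (h t))"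
      by (rule integrable_lp_fun_mult_bounded_support[OF p lp_fun_kernel_op[OF p k lp_fun_norm[OF f]]])
        (use h in auto)
    moreover have "(\<integral>u. norm (P t u) \<partial>half_line) = kernel_op k (\<lambda>s. norm (f s)) t * norm (h t)" for t
    proof -
      have "norm (P t u) = (k u *\<^sub>R norm (f (t * u))) * norm (h t)" if "u \<in> space half_line" for u
        using that lp_kernelD(2)[OF k] by (simp add: P_def norm_mult)
      then show ?thesis
        unfolding kernel_op_def by (subst Bochner_Integration.integral_cong[OF refl]) auto
    qed
    ultimately show "integrable half_line (\<lambda>t. \<integral>u. norm (case (t, u) of (t, u) \<Rightarrow> P t u) \<partial>half_line)"
      by simp
  qed
  have "(\<integral>t. kernel_op k f t * h t \<partial>half_line) = (\<integral>t. \<integral>u. P t u \<partial>half_line \<partial>half_line)"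
    by (simp add: kernel_op_def P_def del: mult_scaleR_left)
  also have "\<dots> = (\<integral>u. \<integral>t. P t u \<partial>half_line \<partial>half_line)"
    by (rule half_line_pair.Fubini_integral[OF P, symmetric])
  also have "\<dots> = (\<integral>s. \<integral>u. (1 / u) *\<^sub>R P (s / u) u \<partial>half_line \<partial>half_line)"
    using half_line_pair.integrable_product_swap[OF P]
    by (intro integral_half_line_pair_scale) (simp add: split_beta)
  also have "\<dots> = (\<integral>s. f s * (\<integral>u. (k u / u) *\<^sub>R h (s / u) \<partial>half_line) \<partial>half_line)"
  proof (rule Bochner_Integration.integral_cong[OF refl])
    fix s
    have "(\<integral>u. (1 / u) *\<^sub>R P (s / u) u \<partial>half_line) = (\<integral>u. f s * ((k u / u) *\<^sub>R h (s / u)) \<partial>half_line)"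
      by (rule Bochner_Integration.integral_cong) (auto simp: P_def)
    then show "(\<integral>u. (1 / u) *\<^sub>R P (s / u) u \<partial>half_line) = f s * (\<integral>u. (k u / u) *\<^sub>R h (s / u) \<partial>half_line)"
      by (simp del: mult_scaleR_right)
  qed
  finally show ?thesis .
qed

lemma test_fun_vderiv:
  assumes "test_fun \<psi>"
  obtains a b where "0 < a" "\<And>s. s \<notin> {a..b} \<Longrightarrow> \<psi> s = 0" "\<And>s. s \<notin> {a..b} \<Longrightarrow> vderiv \<psi> s = 0"
    "\<And>s. (\<psi> has_vector_derivative vderiv \<psi> s) (at s)" "continuous_on UNIV (vderiv \<psi>)"
proof -
  have deriv: "((vderiv ^^ n) \<psi> has_vector_derivative (vderiv ^^ Suc n) \<psi> s) (at s)" for n s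
    using assms by (simp add: test_fun_def)
  obtain a b where a: "0 < a" and supp: "\<And>s. s \<notin> {a..b} \<Longrightarrow> \<psi> s = 0"
    using assms unfolding test_fun_def by blast
  show thesis
  proof (rule that[OF a supp])
    show "vderiv \<psi> s = 0" if s: "s \<notin> {a..b}" for s
    proof -
      have "((\<lambda>s. 0) has_vector_derivative vderiv \<psi> s) (at s)"
        by (rule has_vector_derivative_transform_within_open[of \<psi> _ _ "- {a..b}"])
          (use deriv[of 0 s] s supp in auto)
      then show ?thesis by (rule vector_derivative_unique_at) (rule has_vector_derivative_const)
    qed
    show "(\<psi> has_vector_derivative vderiv \<psi> s) (at s)" for s using deriv[of 0 s] by simp
    show "continuous_on UNIV (vderiv \<psi>)"
      using has_vector_derivative_continuous[OF deriv[of 1]]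
      by (auto intro!: continuous_at_imp_continuous_on)
  qed
qed

lemma integrable_dilated_reciprocal:
  fixes \<theta> :: "real \<Rightarrow> complex"
  assumes \<theta>: "continuous_on UNIV \<theta>" and a: "0 < a" and supp: "\<And>s. s \<notin> {a..b} \<Longrightarrow> \<theta> s = 0" and s: "s > 0"
  shows "integrable half_line (\<lambda>x. (1 / (1 + x)\<^sup>2) *\<^sub>R \<theta> (s / (1 + x)))"
proof -
  obtain M where M: "\<And>s. norm (\<theta> s) \<le> M"
    using bounded_continuous_compact_support[OF \<theta> supp] by blast
  show ?thesis
  proof (rule integrable_bounded_support)
    have "continuous_on {0<..} (\<lambda>x. \<theta> (s / (1 + x)))"
      by (rule continuous_on_compose2[OF \<theta>]) (auto intro!: continuous_intros)
    then show "(\<lambda>x. (1 / (1 + x)\<^sup>2) *\<^sub>R \<theta> (s / (1 + x))) \<in> borel_measurable half_line"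
      by (intro continuous_on_borel_measurable_half_line continuous_intros) auto
    show "norm ((1 / (1 + x)\<^sup>2) *\<^sub>R \<theta> (s / (1 + x))) \<le> M" if "x > 0" for x
    proof -
      have "norm (\<theta> (s / (1 + x))) \<le> M * (1 + x)\<^sup>2"
        using M[of "s / (1 + x)"] mult_left_mono[of 1
          "(1 + x)\<^sup>2" M] order_trans[OF norm_ge_zero M[of 0]] that
        by (simp add: one_le_power)
      then show ?thesis using that by (simp add: divide_le_eq)
    qed
    show "(1 / (1 + x)\<^sup>2) *\<^sub>R \<theta> (s / (1 + x)) = 0" if "x > max 1 (s / a)" for x
    proof -
      have "s / (1 + x) < a" using that a s by (auto simp: field_simps)
      then show ?thesis using supp by simp
    qed
  qed
qed

lemma integral_ek_kernel_dilated_derivative: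
  fixes \<theta> \<theta>' :: "real \<Rightarrow> complex"
  assumes \<theta>: "\<And>s. (\<theta> has_vector_derivative \<theta>' s) (at s)" and \<theta>': "continuous_on UNIV \<theta>'"
    and a: "0 < a" and supp: "\<And>s. s \<notin> {a..b} \<Longrightarrow> \<theta> s = 0" "\<And>s. s \<notin> {a..b} \<Longrightarrow> \<theta>' s = 0" and s: "s > 0"
  shows "(\<integral>u. (ek_kernel 1 0 u / u) *\<^sub>R \<theta>' (s / u) \<partial>half_line) = \<theta> s /\<^sub>R s"
proof -
  define f where "f u = (1 / u\<^sup>2) *\<^sub>R \<theta>' (s / u)" for u
  define F where "F u = - (1 / s) *\<^sub>R \<theta> (s / u)" for u
  have "(\<integral>u. (ek_kernel 1 0 u / u) *\<^sub>R \<theta>' (s / u) \<partial>half_line)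
      = (\<integral>u. indicator {1<..} u *\<^sub>R f u \<partial>half_line)"
    by (rule Bochner_Integration.integral_cong)
      (auto simp: f_def ek_kernel_1 powr_minus power2_eq_square divide_inverse)
  also have "\<dots> = (\<integral>x. f (1 + x) \<partial>half_line)"
    by (rule integral_half_line_shift[symmetric]) simp
  also have "\<dots> = - F 1"
  proof (rule integral_half_line_FTC)
    show "(F has_vector_derivative f u) (at u)" if "u \<ge> 1" for u
    proof -
      have "((\<lambda>u. s / u) has_vector_derivative - s / u\<^sup>2) (at u)"
        unfolding has_real_derivative_iff_has_vector_derivative[symmetric] using that
        by (auto intro!: derivative_eq_intros simp: power2_eq_square)
      from vector_diff_chain_at[OF this \<theta>]
      have "((\<lambda>u. \<theta> (s / u)) has_vector_derivative (- s / u\<^sup>2) *\<^sub>R \<theta>' (s / u)) (at u)"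
        by (simp add: o_def)
      then have "(F has_vector_derivative - (1 / s) *\<^sub>R (- s / u\<^sup>2) *\<^sub>R \<theta>' (s / u)) (at u)"
        unfolding F_def by (rule bounded_linear.has_vector_derivative[OF bounded_linear_scaleR_right])
      then show ?thesis using s by (simp add: f_def)
    qed
    show "isCont f u" if "u > 1" for u
    proof -
      have "isCont (\<lambda>u. \<theta>' (s / u)) u"
        using that \<theta>' by (intro isCont_o2[where f = "\<lambda>u. s / u" and g = \<theta>'] continuous_intros)
          (auto simp: continuous_on_eq_continuous_at)
      then show ?thesis unfolding f_def using that by (intro continuous_intros) auto
    qed
    show "integrable half_line (\<lambda>x. f (1 + x))"
      unfolding f_def by (rule integrable_dilated_reciprocal[OF \<theta>' a supp(2) s])
    have "F u = 0" if "u > max 1 (s / a)" for u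
      unfolding F_def using that a s by (subst supp(1)) (auto simp: field_simps)
    then have "\<forall>\<^sub>F u in at_top. 0 = F u"
      by (intro eventually_mono[OF eventually_gt_at_top[of "max 1 (s / a)"]]) simp
    then show "(F \<longlongrightarrow> 0) at_top" by (rule Lim_transform_eventually[OF tendsto_const])
  qed simp
  also have "- F 1 = \<theta> s /\<^sub>R s" by (simp add: F_def divide_inverse)
  finally show ?thesis .
qed

lemma integral_resolvent_0_mult_test_fun:
  assumes p: "p \<ge> 1" and K: "hfun p K" and \<psi>: "test_fun \<psi>"
  shows "(\<integral>s. resolvent 0 K s * (\<psi> s + complex_of_real s * vderiv \<psi> s) \<partial>half_line)
      = (\<integral>s. K s * \<psi> s \<partial>half_line)"
proof -
  obtain a b where a: "0 < a" and supp: "\<And>s. s \<notin> {a..b} \<Longrightarrow> \<psi> s = 0" "\<And>s. s \<notin> {a..b} \<Longrightarrow> vderiv \<psi> s = 0"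
    and deriv: "\<And>s. (\<psi> has_vector_derivative vderiv \<psi> s) (at s)"
      and cont: "continuous_on UNIV (vderiv \<psi>)"
    using test_fun_vderiv[OF \<psi>] by metis
  define \<theta> where "\<theta> s = s *\<^sub>R \<psi> s" for s
  define \<theta>' where "\<theta>' s = \<psi> s + complex_of_real s * vderiv \<psi> s" for s
  have \<theta>: "(\<theta> has_vector_derivative \<theta>' s) (at s)" for s
    unfolding \<theta>_def[abs_def] \<theta>'_def using has_vector_derivative_scaleR[OF DERIV_ident deriv, of s]
    by (simp add: scaleR_conv_of_real add.commute)
  have \<theta>'_cont: "continuous_on UNIV \<theta>'"
    unfolding \<theta>'_def using has_vector_derivative_continuous[OF deriv]
    by (intro continuous_intros cont continuous_at_imp_continuous_on) auto
  have \<theta>_supp: "\<theta> s = 0" "\<theta>' s = 0" if "s \<notin> {a..b}" for s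
    using supp[OF that] by (simp_all add: \<theta>_def \<theta>'_def)
  obtain M where M: "\<And>s. norm (\<theta>' s) \<le> M"
    using bounded_continuous_compact_support[OF \<theta>'_cont \<theta>_supp(2)] by blast
  have "(\<integral>s. resolvent 0 K s * \<theta>' s \<partial>half_line)
      = (\<integral>s. K s * (\<integral>u. (ek_kernel 1 0 u / u) *\<^sub>R \<theta>' (s / u) \<partial>half_line) \<partial>half_line)"
    using M \<theta>_supp(2)
    by (intro integral_kernel_op_mult[OF p lp_kernel_resolvent[OF p order_refl] K, where M = M and A = b]
        borel_measurable_half_line borel_measurable_continuous_onI \<theta>'_cont) auto
  also have "\<dots> = (\<integral>s. K s * \<psi> s \<partial>half_line)"
  proof (rule Bochner_Integration.integral_cong[OF refl])
    fix s assume "s \<in> space half_line"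
    then have "s > 0" by simp
    then show "K s * (\<integral>u. (ek_kernel 1 0 u / u) *\<^sub>R \<theta>' (s / u) \<partial>half_line) = K s * \<psi> s"
      by (subst integral_ek_kernel_dilated_derivative[OF \<theta> \<theta>'_cont a \<theta>_supp]) (simp_all add: \<theta>_def)
  qed
  finally show ?thesis by (simp add: \<theta>'_def)
qed

theorem lp_generator_weak_derivative:
  assumes p: "p \<ge> 1" and f: "hfun p f" and g: "hfun p g" and gen: "lp_generator p f g"
    and \<psi>: "test_fun \<psi>"
  shows "(\<integral>s. g s * \<psi> s \<partial>half_line)
    = (\<integral>s. f s * (\<psi> s + complex_of_real s * vderiv \<psi> s) \<partial>half_line)
        - complex_of_real (1 / p) * (\<integral>s. f s * \<psi> s \<partial>half_line)"
proof -
  define K where "K s = g s + complex_of_real (1 / p) * f s" for s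
  have K: "hfun p K" unfolding K_def by (intro lp_fun_add lp_fun_cmult p f g)
  have fK: "AE s in half_line. f s = resolvent 0 K s"
    using lp_generator_iff_resolvent[OF p order_refl f g] gen by (simp add: K_def[abs_def])
  obtain a b where supp: "\<And>s. s \<notin> {a..b} \<Longrightarrow> \<psi> s = 0"
    and deriv: "\<And>s. (\<psi> has_vector_derivative vderiv \<psi> s) (at s)"
      and deriv_cont: "continuous_on UNIV (vderiv \<psi>)"
    using test_fun_vderiv[OF \<psi>] by metis
  have cont: "continuous_on UNIV \<psi>"
    using has_vector_derivative_continuous[OF deriv] by (auto intro: continuous_at_imp_continuous_on)
  obtain M where M: "\<And>s. norm (\<psi> s) \<le> M"
    using bounded_continuous_compact_support[OF cont supp] by blast
  have int: "integrable half_line (\<lambda>s. h s * \<psi> s)" if "hfun p h" for h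
    by (rule integrable_lp_fun_mult_bounded_support[OF p that, of _ M b])
      (use M supp cont in \<open>auto intro: borel_measurable_half_line borel_measurable_continuous_onI\<close>)
  have "(\<lambda>s. \<psi> s + complex_of_real s * vderiv \<psi> s) \<in> borel_measurable half_line"
    using cont deriv_cont by (intro borel_measurable_half_line borel_measurable_continuous_onI
      continuous_intros)
  then have "(\<integral>s. f s * (\<psi> s + complex_of_real s * vderiv \<psi> s) \<partial>half_line)
      = (\<integral>s. resolvent 0 K s * (\<psi> s + complex_of_real s * vderiv \<psi> s) \<partial>half_line)"
    using fK lp_fun_measurable[OF f] lp_fun_measurable[OF lp_fun_resolvent[OF p order_refl K]]
    by (intro integral_cong_AE) (auto elim: eventually_mono)
  also have "\<dots> = (\<integral>s. K s * \<psi> s \<partial>half_line)"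
    by (rule integral_resolvent_0_mult_test_fun[OF p K \<psi>])
  also have "\<dots> = (\<integral>s. g s * \<psi> s + complex_of_real (1 / p) * (f s * \<psi> s) \<partial>half_line)"
    by (simp add: K_def distrib_right mult.assoc)
  also have "\<dots> = (\<integral>s. g s * \<psi> s \<partial>half_line) + complex_of_real (1 / p) * (\<integral>s. f s * \<psi> s \<partial>half_line)"
    using int[OF f] int[OF g] by (subst Bochner_Integration.integral_add) auto
  finally show ?thesis by simp
qed

theorem theorem2p5:
  fixes p \<alpha> :: real
  assumes "p \<ge> 1" and "\<alpha> \<ge> 0"
  shows "(\<forall>t f. f \<in> T_space \<alpha> p \<longrightarrow>
              T_grp p t f \<in> T_space \<alpha> p \<and> T_space_norm \<alpha> p (T_grp p t f) = T_space_norm \<alpha> p f)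
       \<and> (\<forall>f. T_grp p 0 f = f)
       \<and> (\<forall>t u f. T_grp p (t + u) f = T_grp p t (T_grp p u f))
       \<and> (\<forall>f \<in> T_space \<alpha> p.
              ((\<lambda>t. T_space_norm \<alpha> p (\<lambda>s. T_grp p t f s - f s)) \<longlongrightarrow> 0) (at 0))
       \<and> {f \<in> T_space \<alpha> p. \<exists>g. is_generator_value \<alpha> p f g} = T_space (\<alpha> + 1) p
       \<and> (\<forall>f g. f \<in> T_space \<alpha> p \<longrightarrow> is_generator_value \<alpha> p f g \<longrightarrow>
              (\<forall>\<psi>. test_fun \<psi> \<longrightarrow>
                 (LINT s:{0<..}|lborel. g s * \<psi> s) =
                 (LINT s:{0<..}|lborel. f s * (\<psi> s + complex_of_real s * vderiv \<psi> s))
                 - complex_of_real (1 / p) * (LINT s:{0<..}|lborel. f s * \<psi> s)))"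
proof (intro conjI allI impI ballI)
  show "T_grp p t f \<in> T_space \<alpha> p" "T_space_norm \<alpha> p (T_grp p t f) = T_space_norm \<alpha> p f" if "f \<in> T_space \<alpha> p" for t f
    using T_space_T_grp[OF assms that] .
  show "T_grp p 0 f = f" for f by (rule T_grp_zero)
  show "T_grp p (t + u) f = T_grp p t (T_grp p u f)" for t u f by (rule T_grp_add)
  show "((\<lambda>t. T_space_norm \<alpha> p (\<lambda>s. T_grp p t f s - f s)) \<longlongrightarrow> 0) (at 0)" if "f \<in> T_space \<alpha> p" for f
    by (rule T_space_strongly_continuous[OF assms that])
  show "{f \<in> T_space \<alpha> p. \<exists>g. is_generator_value \<alpha> p f g} = T_space (\<alpha> + 1) p"
    by (rule generator_domain[OF assms])
  show "(LINT s:{0<..}|lborel. g s * \<psi> s) =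
      (LINT s:{0<..}|lborel. f s * (\<psi> s + complex_of_real s * vderiv \<psi> s))
      - complex_of_real (1 / p) * (LINT s:{0<..}|lborel. f s * \<psi> s)"
    if "f \<in> T_space \<alpha> p" "is_generator_value \<alpha> p f g" "test_fun \<psi>" for f g \<psi>
    using lp_generator_weak_derivative[OF assms(1) lp_generator_of_is_generator_value[OF assms that(1,2)] that(3)]
    unfolding integral_half_line .
qed

end
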